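(* Consider the function-on-function polynomial regression model of degree $p$ with Gaussian white noise errors described in the context. Let $R>0$, let $\varphi:[0,\eta]\to\mathbb{R}$ be an index function (continuous, non-decreasing, $\varphi(0)=0$), and let $\Omega_{\varphi,R}=\{f\in\mathbb{L}^2: f=\varphi(\mathbb{A}^*\mathbb{A})v,\ \|v\|_{\mathbb{L}^2}\le R\}$. Suppose that for some $b>1$ the eigenvalues $(\mu_i)_{i\in\mathbb{N}}$ of $\Gamma$ satisfy $i^{-b}\lesssim\mu_i\lesssim i^{-b}$ for all $i\in\mathbb{N}$, and put $\psi(x)=\varphi(x)x^{\frac12+\frac1{2b}}$. Then for $0\le s\le\frac12$, $$\lim_{a\to0}\ \lim_{n\to\infty}\ \inf_{\hat\beta}\ \sup_{\beta^*\in\Omega_{\varphi,R}}\ \mathbb{P}\left\{\|(\mathbb{A}^*\mathbb{A})^s(\hat\beta-\beta^* )\|_{\mathbb{L}^2}\ge a\,\varphi\big(\psi^{-1}(n^{-\frac12})\big)\big(\psi^{-1}(n^{-\frac12})\big)^{s}\right\}=1,$$ where the infimum is taken over all possible estimators $\hat\beta$ of $\beta^*$ based on the data $(X_1,Y_1),\dots,(X_n,Y_n)$.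
   Context: Let $S_1,S_2\subset\mathbb{R}$ be compact, $\mu$ the (Lebesgue) measure on them, and $p\ge1$ an integer. Put $L^2_0=\mathbb{R}$ and $L^2_l=L^2(S_1)^{\otimes l}$ ($l$-fold tensor product) for $1\le l\le p$. Put $\mathbb{L}^2=L^2(S_2)\oplus\bigoplus_{l=1}^p (L^2(S_2)\otimes L^2_l)$, with $\|u\|_{\mathbb{L}^2}^2=\sum_{l=0}^p\|u_l\|^2$ for $u=(u_0,\dots,u_p)$; it is isometrically isomorphic to $L^2(S_2)\otimes(\bigoplus_{l=0}^pL^2_l)$. $X(\omega,\cdot)\in L^2(S_1)$ is a random process on $(\Omega,\mathbb{P})$, and $\mathbb{A}:\mathbb{L}^2\to L^2(\Omega,\mathbb{P})\otimes L^2(S_2)$ is the operator $$(\mathbb{A}u)(\omega,t)=u_0(t)+\sum_{l=1}^p\int_{S_1}\cdots\int_{S_1}u_l(t,s_1,\dots,s_l)\prod_{i=1}^lX(\omega,s_i)\,d\mu(s_1)\cdots d\mu(s_l),$$ with adjoint $\mathbb{A}^*$. Let $\chi=(\chi_0,\dots,\chi_p)\in\bigoplus_{l=0}^pL^2_l$ with $\chi_0=1$, $\chi_k=\prod_{i=1}^kX(\omega,s_i)$, and $\Gamma=\mathbb{E}[\chi\otimes\chi]$ on $\bigoplus_{l=0}^pL^2_l$, where $(\chi\otimes\chi)f=\langle\chi,f\rangle\chi$ ($\Gamma$ and $\mathbb{A}$ are assumed well defined and bounded). The eigenvalues $\mu_1\ge\mu_2\ge\dots$ of $\Gamma$ are listed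 in non-increasing order with multiplicity. The interval $[0,\eta]$ contains the spectrum of $\mathbb{A}^*\mathbb{A}$. Functions of self-adjoint operators are defined by the functional calculus. Model: $(X_i,Y_i)$, $1\le i\le n$, are i.i.d., $X_i$ distributed as $X$, with $Y_i=\mathbb{B}_i\beta^*+\epsilon_i$, $\beta^*\in\mathbb{L}^2$ unknown, where $(\mathbb{B}_iu)(t)=u_0(t)+\sum_{l=1}^p\int_{S_1}\cdots\int_{S_1}u_l(t,s_1,\dots,s_l)\prod_{j=1}^lX_i(s_j)\,d\mu(s_1)\cdots d\mu(s_l)$. The errors $\epsilon_i$ are centred Gaussian white noise processes on $L^2(S_2)$ with covariance operator $\sigma^2I$, $\sigma>0$ (i.e. $\langle\epsilon_i,g\rangle$ is centred Gaussian with variance $\sigma^2\|g\|^2$, jointly Gaussian in $g\in L^2(S_2)$), independent across $i$ and independent of $(X_i)_{i=1}^n$. $\mathbb{P}$ in the claim is the law of the data when the true parameter is $\beta^*$. $a_i\lesssim b_i$ means $a_i\le Cb_i$ for a positive constant $C$ not depending on $i$. $\psi^{-1}$ is the inverse function of $\psi$ (its existence is presupposed, and $n$ is large enough that $n^{-1/2}$ lies in the range of $\psi$). *)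

theory Defs
  imports "HOL-Probability.Probability" "HOL-Computational_Algebra.Polynomial"
begin

section \<open>Real \<open>L\<^sup>2\<close> spaces and finite direct sums of them\<close>

text \<open>
  Elements of \<open>L\<^sup>2\<close> are represented by functions. Almost-everywhere equality is never quotiented
  out: equality of vectors is expressed as "distance zero".
\<close>

definition L2 :: "'a measure \<Rightarrow> ('a \<Rightarrow> real) set" where
  "L2 M = {f \<in> borel_measurable M. integrable M (\<lambda>x. (f x)\<^sup>2)}"

definition L2_inner :: "'a measure \<Rightarrow> ('a \<Rightarrow> real) \<Rightarrow> ('a \<Rightarrow> real) \<Rightarrow> real" where
  "L2_inner M f g = (\<integral>x. f x * g x \<partial>M)"

definition L2_norm :: "'a measure \<Rightarrow> ('a \<Rightarrow> real) \<Rightarrow> real" where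
  "L2_norm M f = sqrt (L2_inner M f f)"

definition L2_dist :: "'a measure \<Rightarrow> ('a \<Rightarrow> real) \<Rightarrow> ('a \<Rightarrow> real) \<Rightarrow> real" where
  "L2_dist M f g = L2_norm M (\<lambda>x. f x - g x)"

text \<open>
  \<open>L2_sum p M\<close> is the Hilbert direct sum of the spaces \<open>L2 (M l)\<close> for \<open>0 \<le> l \<le> p\<close>. The components
  \<open>u l\<close> with \<open>l > p\<close> of a representative \<open>u\<close> are irrelevant.
\<close>

definition L2_sum :: "nat \<Rightarrow> (nat \<Rightarrow> 'a measure) \<Rightarrow> (nat \<Rightarrow> 'a \<Rightarrow> real) set" where
  "L2_sum p M = {u. \<forall>l\<le>p. u l \<in> L2 (M l)}"

definition L2_sum_inner ::
    "nat \<Rightarrow> (nat \<Rightarrow> 'a measure) \<Rightarrow> (nat \<Rightarrow> 'a \<Rightarrow> real) \<Rightarrow> (nat \<Rightarrow> 'a \<Rightarrow> real) \<Rightarrow> real" where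
  "L2_sum_inner p M u v = (\<Sum>l\<le>p. L2_inner (M l) (u l) (v l))"

definition L2_sum_norm :: "nat \<Rightarrow> (nat \<Rightarrow> 'a measure) \<Rightarrow> (nat \<Rightarrow> 'a \<Rightarrow> real) \<Rightarrow> real" where
  "L2_sum_norm p M u = sqrt (L2_sum_inner p M u u)"

definition L2_sum_dist ::
    "nat \<Rightarrow> (nat \<Rightarrow> 'a measure) \<Rightarrow> (nat \<Rightarrow> 'a \<Rightarrow> real) \<Rightarrow> (nat \<Rightarrow> 'a \<Rightarrow> real) \<Rightarrow> real" where
  "L2_sum_dist p M u v = L2_sum_norm p M (\<lambda>l x. u l x - v l x)"

text \<open>The Borel \<open>\<sigma>\<close>-algebra of the (pseudo-)metric \<open>d\<close> on the carrier \<open>H\<close>.\<close>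

definition borel_dist :: "'a set \<Rightarrow> ('a \<Rightarrow> 'a \<Rightarrow> real) \<Rightarrow> 'a measure" where
  "borel_dist H d = sigma H {U. U \<subseteq> H \<and> (\<forall>u\<in>U. \<exists>r>0. \<forall>v\<in>H. d u v < r \<longrightarrow> v \<in> U)}"


section \<open>Operators\<close>

type_synonym 'a l2fam = "nat \<Rightarrow> 'a \<Rightarrow> real"

definition bounded_op :: "nat \<Rightarrow> (nat \<Rightarrow> 'a measure) \<Rightarrow> ('a l2fam \<Rightarrow> 'a l2fam) \<Rightarrow> bool" where
  "bounded_op p M S \<longleftrightarrow>
     (\<forall>u\<in>L2_sum p M. S u \<in> L2_sum p M) \<and>
     (\<forall>u\<in>L2_sum p M. \<forall>v\<in>L2_sum p M. \<forall>a b.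
        L2_sum_dist p M (S (\<lambda>l x. a * u l x + b * v l x)) (\<lambda>l x. a * S u l x + b * S v l x) = 0) \<and>
     (\<exists>C. \<forall>u\<in>L2_sum p M. L2_sum_norm p M (S u) \<le> C * L2_sum_norm p M u)"

definition spectrum :: "nat \<Rightarrow> (nat \<Rightarrow> 'a measure) \<Rightarrow> ('a l2fam \<Rightarrow> 'a l2fam) \<Rightarrow> real set" where
  "spectrum p M T = {c. \<not> (\<exists>S. bounded_op p M S \<and>
     (\<forall>u\<in>L2_sum p M.
        L2_sum_dist p M (S (\<lambda>l x. T u l x - c * u l x)) u = 0 \<and>
        L2_sum_dist p M (\<lambda>l x. T (S u) l x - c * S u l x) u = 0))}"

definition op_poly :: "real poly \<Rightarrow> ('a l2fam \<Rightarrow> 'a l2fam) \<Rightarrow> 'a l2fam \<Rightarrow> 'a l2fam" where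
  "op_poly q T u = (\<lambda>l x. \<Sum>k\<le>degree q. coeff q k * (T ^^ k) u l x)"

text \<open>
  Continuous functional calculus of a bounded self-adjoint \<open>T\<close>: \<open>f(T)u\<close> is the limit of \<open>q(T)u\<close>
  as the polynomial \<open>q\<close> tends to \<open>f\<close> uniformly on the spectrum of \<open>T\<close>.
\<close>

definition op_fun ::
    "nat \<Rightarrow> (nat \<Rightarrow> 'a measure) \<Rightarrow> ('a l2fam \<Rightarrow> 'a l2fam) \<Rightarrow> (real \<Rightarrow> real) \<Rightarrow> 'a l2fam \<Rightarrow> 'a l2fam" where
  "op_fun p M T f u = (SOME w. w \<in> L2_sum p M \<and>
     (\<forall>e>0. \<exists>d>0. \<forall>q. (\<forall>x\<in>spectrum p M T. \<bar>poly q x - f x\<bar> \<le> d) \<longrightarrow>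
        L2_sum_dist p M (op_poly q T u) w \<le> e))"

text \<open>\<open>powr\<close> has \<open>0 powr 0 = 0\<close>, whereas \<open>T\<^sup>0\<close> has to be the identity.\<close>

definition power_fun :: "real \<Rightarrow> real \<Rightarrow> real" where
  "power_fun s x = (if s = 0 then 1 else x powr s)"

definition adjoint_op ::
    "nat \<Rightarrow> (nat \<Rightarrow> 'a measure) \<Rightarrow> 'b measure \<Rightarrow> ('a l2fam \<Rightarrow> 'b \<Rightarrow> real) \<Rightarrow> ('b \<Rightarrow> real) \<Rightarrow> 'a l2fam" where
  "adjoint_op p M N A g =
     (SOME w. w \<in> L2_sum p M \<and> (\<forall>u\<in>L2_sum p M. L2_sum_inner p M u w = L2_inner N (A u) g))"

text \<open>
  \<open>has_indep_eigenvectors p M T c m\<close>: the eigenspace of \<open>T\<close> for \<open>c\<close> has dimension at least \<open>m\<close>.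
\<close>

definition has_indep_eigenvectors ::
    "nat \<Rightarrow> (nat \<Rightarrow> 'a measure) \<Rightarrow> ('a l2fam \<Rightarrow> 'a l2fam) \<Rightarrow> real \<Rightarrow> nat \<Rightarrow> bool" where
  "has_indep_eigenvectors p M T c m \<longleftrightarrow> (\<exists>f.
     (\<forall>k<m. f k \<in> L2_sum p M \<and> L2_sum_dist p M (T (f k)) (\<lambda>l x. c * f k l x) = 0) \<and>
     (\<forall>a. L2_sum_norm p M (\<lambda>l x. \<Sum>k<m. a k * f k l x) = 0 \<longrightarrow> (\<forall>k<m. a k = 0)))"

text \<open>
  \<open>\<mu> 1 \<ge> \<mu> 2 \<ge> \<dots>\<close> lists the eigenvalues of \<open>T\<close>, each nonzero one as often as the dimension of its
  eigenspace (both sides of the equivalence say that the respective cardinality is at least \<open>m\<close>).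
  The eigenvalue \<open>0\<close> is exempt, as usual for compact operators: if infinitely many
  eigenvalues are positive, a non-increasing list never reaches it, even if the kernel is nontrivial.
\<close>

definition eigenvalue_list ::
    "nat \<Rightarrow> (nat \<Rightarrow> 'a measure) \<Rightarrow> ('a l2fam \<Rightarrow> 'a l2fam) \<Rightarrow> (nat \<Rightarrow> real) \<Rightarrow> bool" where
  "eigenvalue_list p M T \<mu> \<longleftrightarrow>
     (\<forall>i j. 1 \<le> i \<and> i \<le> j \<longrightarrow> \<mu> j \<le> \<mu> i) \<and>
     (\<forall>c m. c \<noteq> 0 \<longrightarrow>
        (has_indep_eigenvectors p M T c m \<longleftrightarrow>
         (\<exists>I. finite I \<and> I \<subseteq> {i. 1 \<le> i \<and> \<mu> i = c} \<and> card I = m)))"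


section \<open>The polynomial regression model\<close>

definition leb :: "real set \<Rightarrow> real measure" where
  "leb S = restrict_space lborel S"

text \<open>
  The tensor power \<open>L\<^sup>2(S\<^sub>1)\<^sup>\<otimes>\<^sup>l\<close> is identified with \<open>L\<^sup>2(S\<^sub>1\<^sup>l)\<close>, and \<open>L\<^sup>2(S\<^sub>2) \<otimes> L\<^sup>2(S\<^sub>1)\<^sup>\<otimes>\<^sup>l\<close> with
  \<open>L\<^sup>2(S\<^sub>2 \<times> S\<^sub>1\<^sup>l)\<close>. For \<open>l = 0\<close> the measure \<open>cube S1 0\<close> is the unit mass at the single point
  \<open>\<lambda>_. undefined\<close>, so that the two spaces are \<open>\<real>\<close> and \<open>L\<^sup>2(S\<^sub>2)\<close>.
\<close>

definition cube :: "real set \<Rightarrow> nat \<Rightarrow> (nat \<Rightarrow> real) measure" where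
  "cube S1 l = PiM {1..l} (\<lambda>_. leb S1)"

definition coef :: "real set \<Rightarrow> real set \<Rightarrow> nat \<Rightarrow> (real \<times> (nat \<Rightarrow> real)) measure" where
  "coef S1 S2 l = leb S2 \<Otimes>\<^sub>M cube S1 l"

abbreviation LL2 :: "nat \<Rightarrow> real set \<Rightarrow> real set \<Rightarrow> (real \<times> (nat \<Rightarrow> real)) l2fam set" where
  "LL2 p S1 S2 \<equiv> L2_sum p (coef S1 S2)"

abbreviation norm_LL2 :: "nat \<Rightarrow> real set \<Rightarrow> real set \<Rightarrow> (real \<times> (nat \<Rightarrow> real)) l2fam \<Rightarrow> real" where
  "norm_LL2 p S1 S2 \<equiv> L2_sum_norm p (coef S1 S2)"

text \<open>The regression function of \<open>u\<close> at the covariate path \<open>x\<close>, evaluated at \<open>t\<close>.\<close>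

definition poly_reg ::
    "nat \<Rightarrow> real set \<Rightarrow> (real \<times> (nat \<Rightarrow> real)) l2fam \<Rightarrow> (real \<Rightarrow> real) \<Rightarrow> real \<Rightarrow> real" where
  "poly_reg p S1 u x t = u 0 (t, \<lambda>_. undefined) +
     (\<Sum>l=1..p. \<integral>s. u l (t, s) * (\<Prod>i=1..l. x (s i)) \<partial>cube S1 l)"

definition A_op ::
    "nat \<Rightarrow> real set \<Rightarrow> ('w \<Rightarrow> real \<Rightarrow> real) \<Rightarrow> (real \<times> (nat \<Rightarrow> real)) l2fam \<Rightarrow> 'w \<times> real \<Rightarrow> real" where
  "A_op p S1 X u = (\<lambda>(\<omega>, t). poly_reg p S1 u (X \<omega>) t)"

definition AA_op ::
    "nat \<Rightarrow> real set \<Rightarrow> real set \<Rightarrow> 'w measure \<Rightarrow> ('w \<Rightarrow> real \<Rightarrow> real) \<Rightarrow>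
     (real \<times> (nat \<Rightarrow> real)) l2fam \<Rightarrow> (real \<times> (nat \<Rightarrow> real)) l2fam" where
  "AA_op p S1 S2 P X u =
     adjoint_op p (coef S1 S2) (P \<Otimes>\<^sub>M leb S2) (A_op p S1 X) (A_op p S1 X u)"

definition chi :: "('w \<Rightarrow> real \<Rightarrow> real) \<Rightarrow> 'w \<Rightarrow> (nat \<Rightarrow> real) l2fam" where
  "chi X \<omega> l s = (\<Prod>i=1..l. X \<omega> (s i))"

text \<open>
  The operator expectation \<open>\<Gamma> = E[\<chi> \<otimes> \<chi>]\<close> is taken weakly: \<open>w = \<Gamma> f\<close> means
  \<open>\<langle>w, g\<rangle> = E[\<langle>\<chi>, f\<rangle> \<langle>\<chi>, g\<rangle>]\<close> for all \<open>g\<close>.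
\<close>

definition is_Gamma ::
    "nat \<Rightarrow> real set \<Rightarrow> 'w measure \<Rightarrow> ('w \<Rightarrow> real \<Rightarrow> real) \<Rightarrow>
     (nat \<Rightarrow> real) l2fam \<Rightarrow> (nat \<Rightarrow> real) l2fam \<Rightarrow> bool" where
  "is_Gamma p S1 P X f w \<longleftrightarrow> w \<in> L2_sum p (cube S1) \<and>
     (\<forall>g\<in>L2_sum p (cube S1).
        integrable P (\<lambda>\<omega>. L2_sum_inner p (cube S1) (chi X \<omega>) f * L2_sum_inner p (cube S1) (chi X \<omega>) g) \<and>
        L2_sum_inner p (cube S1) w g =
          (\<integral>\<omega>. L2_sum_inner p (cube S1) (chi X \<omega>) f * L2_sum_inner p (cube S1) (chi X \<omega>) g \<partial>P))"

definition Gamma_op ::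
    "nat \<Rightarrow> real set \<Rightarrow> 'w measure \<Rightarrow> ('w \<Rightarrow> real \<Rightarrow> real) \<Rightarrow>
     (nat \<Rightarrow> real) l2fam \<Rightarrow> (nat \<Rightarrow> real) l2fam" where
  "Gamma_op p S1 P X f = (SOME w. is_Gamma p S1 P X f w)"

definition source_set ::
    "nat \<Rightarrow> real set \<Rightarrow> real set \<Rightarrow> 'w measure \<Rightarrow> ('w \<Rightarrow> real \<Rightarrow> real) \<Rightarrow>
     (real \<Rightarrow> real) \<Rightarrow> real \<Rightarrow> (real \<times> (nat \<Rightarrow> real)) l2fam set" where
  "source_set p S1 S2 P X \<phi> R = {f \<in> LL2 p S1 S2. \<exists>v\<in>LL2 p S1 S2.
     norm_LL2 p S1 S2 v \<le> R \<and>
     L2_sum_dist p (coef S1 S2) f (op_fun p (coef S1 S2) (AA_op p S1 S2 P X) \<phi> v) = 0}"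

abbreviation path_space :: "real set \<Rightarrow> (real \<Rightarrow> real) measure" where
  "path_space S \<equiv> borel_dist (L2 (leb S)) (L2_dist (leb S))"

text \<open>
  White noise is not an element of \<open>L\<^sup>2(S)\<close>; a white noise observation is the family of its
  pairings with all \<open>g \<in> L\<^sup>2(S)\<close>.
\<close>

abbreviation noise_space :: "real set \<Rightarrow> ((real \<Rightarrow> real) \<Rightarrow> real) measure" where
  "noise_space S \<equiv> PiM (L2 (leb S)) (\<lambda>_. borel)"

definition centred_gaussian :: "'q measure \<Rightarrow> ('q \<Rightarrow> real) \<Rightarrow> real \<Rightarrow> bool" where
  "centred_gaussian Q Z v \<longleftrightarrow> Z \<in> borel_measurable Q \<and>
     distr Q borel Z =
       (if v = 0 then return borel 0 else density lborel (normal_density 0 (sqrt v)))"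

text \<open>
  All finite linear combinations of pairings are Gaussian (joint normality), with the variance
  dictated by the covariance operator \<open>\<sigma>\<^sup>2 I\<close>.
\<close>

definition white_noise ::
    "'q measure \<Rightarrow> real set \<Rightarrow> real \<Rightarrow> ('q \<Rightarrow> (real \<Rightarrow> real) \<Rightarrow> real) \<Rightarrow> bool" where
  "white_noise Q S \<sigma> \<epsilon> \<longleftrightarrow>
     (\<forall>m g c. (\<forall>k<m::nat. g k \<in> L2 (leb S)) \<longrightarrow>
        centred_gaussian Q (\<lambda>\<omega>. \<Sum>k<m. c k * \<epsilon> \<omega> (g k))
          (\<sigma>\<^sup>2 * (L2_norm (leb S) (\<lambda>t. \<Sum>k<m. c k * g k t))\<^sup>2))"

type_synonym sample = "nat \<Rightarrow> (real \<Rightarrow> real) \<times> ((real \<Rightarrow> real) \<Rightarrow> real)"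

text \<open>The observations \<open>(X\<^sub>i, Y\<^sub>i)\<close>, \<open>1 \<le> i \<le> n\<close>, under the parameter \<open>\<beta>\<close>.\<close>

definition data ::
    "nat \<Rightarrow> real set \<Rightarrow> real set \<Rightarrow> (nat \<Rightarrow> 'q \<Rightarrow> real \<Rightarrow> real) \<Rightarrow> (nat \<Rightarrow> 'q \<Rightarrow> (real \<Rightarrow> real) \<Rightarrow> real) \<Rightarrow>
     nat \<Rightarrow> (real \<times> (nat \<Rightarrow> real)) l2fam \<Rightarrow> 'q \<Rightarrow> sample" where
  "data p S1 S2 Xs \<epsilon> n \<beta> \<omega> = (\<lambda>i\<in>{1..n}. (Xs i \<omega>,
     \<lambda>g\<in>L2 (leb S2). L2_inner (leb S2) (poly_reg p S1 \<beta> (Xs i \<omega>)) g + \<epsilon> i \<omega> g))"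

definition estimators ::
    "nat \<Rightarrow> real set \<Rightarrow> real set \<Rightarrow> nat \<Rightarrow> (sample \<Rightarrow> (real \<times> (nat \<Rightarrow> real)) l2fam) set" where
  "estimators p S1 S2 n =
     PiM {1..n} (\<lambda>_. path_space S1 \<Otimes>\<^sub>M noise_space S2) \<rightarrow>\<^sub>M
     borel_dist (LL2 p S1 S2) (L2_sum_dist p (coef S1 S2))"

definition psi :: "(real \<Rightarrow> real) \<Rightarrow> real \<Rightarrow> real \<Rightarrow> real" where
  "psi \<phi> b x = \<phi> x * x powr (1 / 2 + 1 / (2 * b))"

definition rate :: "(real \<Rightarrow> real) \<Rightarrow> real \<Rightarrow> real \<Rightarrow> real \<Rightarrow> nat \<Rightarrow> real" where
  "rate \<phi> b \<eta> s n =
     (let x = the_inv_into {0..\<eta>} (psi \<phi> b) (real n powr (- 1 / 2)) in \<phi> x * x powr s)"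

end

theory Submission
  imports Defs "HOL-Computational_Algebra.Fundamental_Theorem_Algebra" "HOL-Library.Function_Algebras"
begin

text \<open>
  On elementary tensors \<open>A\<^sup>* A\<close> acts as \<open>I \<otimes> \<Gamma>\<close>, so the eigenspace of \<open>A\<^sup>* A\<close> for \<open>\<mu>\<^sub>1\<close> contains
  \<open>L\<^sup>2(S\<^sub>2) \<otimes> f\<close>, where \<open>f\<close> is a unit eigenvector of \<open>\<Gamma>\<close>. This space is infinite-dimensional, and the
  source set contains a ball of fixed radius in it. For fixed \<open>n\<close> consider the signals \<open>\<beta>\<^sub>k = c g\<^sub>k \<otimes> f\<close>
  with \<open>g\<^sub>1, \<dots>, g\<^sub>N\<close> orthonormal. By the Cameron--Martin formula, given the covariates, the law of the
  data under \<open>\<beta>\<^sub>k\<close> has a density with respect to the law under \<open>0\<close> whose second moment does not depend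
  on \<open>k\<close> or \<open>N\<close> (as long as the covariates stay in a set of large probability). An estimator can be
  close to \<open>\<beta>\<^sub>k\<close> only on the \<open>k\<close>-th of \<open>N\<close> disjoint regions, so as \<open>N\<close> grows it fails for some \<open>k\<close>
  with probability arbitrarily near 1. Hence, for every \<open>n\<close>, the minimax probability of an error above
  a fixed positive constant is 1; since the rate tends to 0, the limit in \<open>n\<close> is 1 for every \<open>a\<close>.
\<close>

text \<open>Vectors are functions rather than classes, and \<open>AA_op\<close> and
  \<open>op_fun\<close> are Hilbert choices, so operators are pinned down only up to vectors of
  seminorm zero. Identities between them are therefore tested against inner products and read as
  \<open>nrm (u - v) = 0\<close>. The functional calculus rests on one estimate, that a polynomial
  of the operator is bounded in norm by any bound of the polynomial on the spectrum; factoring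
  polynomials gives it without a spectral measure. The noise is a family indexed by all of
  \<open>L2 (leb S2)\<close>, with no reference measure on the sample space. The shift formula is
  thus derived from characteristic functions, which determine a law on an uncountable product
  through finitely many coordinates at a time. The scalar factor of the signal is a polynomial
  functional of the covariate and may lack exponential moments. Where it is bounded by
  \<open>B\<close>, the second moment of the density is at most
  \<open>exp (n * B^2 / \<sigma>^2)\<close>. The number \<open>N\<close> of signals is fixed by the
  sample size, the scalar factor and the tolerance alone, before the estimator enters.\<close>

instantiation "fun" :: (type, real_vector) real_vector
begin

definition scaleR_fun :: "real \<Rightarrow> ('a \<Rightarrow> 'b) \<Rightarrow> 'a \<Rightarrow> 'b" where
  "scaleR_fun a f = (\<lambda>x. a *\<^sub>R f x)"

instance
  by standard (auto simp: scaleR_fun_def fun_eq_iff scaleR_add_right scaleR_add_left)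

end

lemma scaleR_fun_apply [simp]: "(a *\<^sub>R f) x = a *\<^sub>R f x"
  by (simp add: scaleR_fun_def)

lemma sum_fun_apply [simp]: "(\<Sum>k\<in>K. f k) x = (\<Sum>k\<in>K. f k x)"
  by (induction K rule: infinite_finite_induct) auto

section \<open>Complete semi-inner product spaces\<close>

text \<open>The form may vanish on nonzero vectors, since functions that agree almost everywhere are
  still distinct. Equality in the Hilbert space becomes \<open>nrm (u - v) = 0\<close>.\<close>

locale semi_hilbert =
  fixes H :: "'v::real_vector set" and ip :: "'v \<Rightarrow> 'v \<Rightarrow> real"
  assumes subspace_H: "subspace H"
    and ip_add: "\<lbrakk>u \<in> H; v \<in> H; w \<in> H\<rbrakk> \<Longrightarrow> ip (u + v) w = ip u w + ip v w"
    and ip_scale: "\<lbrakk>u \<in> H; w \<in> H\<rbrakk> \<Longrightarrow> ip (a *\<^sub>R u) w = a * ip u w"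
    and ip_sym: "\<lbrakk>u \<in> H; w \<in> H\<rbrakk> \<Longrightarrow> ip u w = ip w u"
    and ip_nonneg: "u \<in> H \<Longrightarrow> 0 \<le> ip u u"
    and complete: "\<lbrakk>\<And>n::nat. x n \<in> H;
        \<And>e. e > 0 \<Longrightarrow> \<exists>N. \<forall>m\<ge>N. \<forall>n\<ge>N. sqrt (ip (x m - x n) (x m - x n)) < e\<rbrakk> \<Longrightarrow>
        \<exists>l\<in>H. (\<lambda>n. sqrt (ip (x n - l) (x n - l))) \<longlonglongrightarrow> 0"
begin

definition nrm :: "'v \<Rightarrow> real" where
  "nrm u = sqrt (ip u u)"

lemma H_add [simp]: "u \<in> H \<Longrightarrow> v \<in> H \<Longrightarrow> u + v \<in> H"
  and H_diff [simp]: "u \<in> H \<Longrightarrow> v \<in> H \<Longrightarrow> u - v \<in> H"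
  and H_scale [simp]: "u \<in> H \<Longrightarrow> a *\<^sub>R u \<in> H"
  and H_zero [simp]: "0 \<in> H"
  and H_sum [simp]: "(\<And>k. k \<in> K \<Longrightarrow> f k \<in> H) \<Longrightarrow> (\<Sum>k\<in>K. f k) \<in> H"
  using subspace_H by (auto intro: subspace_add subspace_diff subspace_scale subspace_0 subspace_sum)

lemma ip_diff: "\<lbrakk>u \<in> H; v \<in> H; w \<in> H\<rbrakk> \<Longrightarrow> ip (u - v) w = ip u w - ip v w"
  using ip_add[of "u - v" v w] by simp

lemma ip_add_right: "\<lbrakk>u \<in> H; v \<in> H; w \<in> H\<rbrakk> \<Longrightarrow> ip w (u + v) = ip w u + ip w v"
  using ip_add[of u v w] by (simp add: ip_sym)

lemma ip_diff_right: "\<lbrakk>u \<in> H; v \<in> H; w \<in> H\<rbrakk> \<Longrightarrow> ip w (u - v) = ip w u - ip w v"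
  using ip_diff[of u v w] by (simp add: ip_sym)

lemma ip_scale_right: "\<lbrakk>u \<in> H; w \<in> H\<rbrakk> \<Longrightarrow> ip w (a *\<^sub>R u) = a * ip w u"
  using ip_scale[of u w a] by (simp add: ip_sym)

lemmas ip_simps = ip_add ip_add_right ip_diff ip_diff_right ip_scale ip_scale_right

lemma ip_zero_left: "w \<in> H \<Longrightarrow> ip 0 w = 0"
  using ip_scale[of 0 w 0] by simp

lemma ip_sum: "(\<And>k. k \<in> K \<Longrightarrow> f k \<in> H) \<Longrightarrow> w \<in> H \<Longrightarrow> ip (\<Sum>k\<in>K. f k) w = (\<Sum>k\<in>K. ip (f k) w)"
  by (induction K rule: infinite_finite_induct) (auto simp: ip_zero_left ip_add)

lemma nrm_nonneg [simp]: "u \<in> H \<Longrightarrow> 0 \<le> nrm u"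
  by (simp add: nrm_def ip_nonneg)

lemma nrm_sq: "u \<in> H \<Longrightarrow> (nrm u)\<^sup>2 = ip u u"
  by (simp add: nrm_def ip_nonneg)

lemma Cauchy_Schwarz: assumes "u \<in> H" "v \<in> H" shows "\<bar>ip u v\<bar> \<le> nrm u * nrm v"
proof -
  have quad: "0 \<le> ip u u + 2 * t * ip u v + t\<^sup>2 * ip v v" for t
  proof -
    have "ip (u + t *\<^sub>R v) (u + t *\<^sub>R v) = ip u u + 2 * t * ip u v + t\<^sup>2 * ip v v"
      using assms by (simp add: ip_simps ip_sym[of v u] power2_eq_square algebra_simps)
    then show ?thesis using ip_nonneg[of "u + t *\<^sub>R v"] assms by simp
  qed
  have "(ip u v)\<^sup>2 \<le> ip u u * ip v v"
  proof (cases "ip v v = 0")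
    case True
    have "ip u v = 0"
    proof (rule ccontr)
      assume "ip u v \<noteq> 0"
      \<comment> \<open>For a null vector \<open>v\<close> the quadratic is affine in
        \<open>t\<close>, and this \<open>t\<close> gives it the value -1.\<close>
      then show False using quad[of "- (ip u u + 1) / (2 * ip u v)"] True by (simp add: field_simps)
    qed
    then show ?thesis using True by simp
  next
    case False
    then have "ip v v > 0" using ip_nonneg[OF assms(2)] by simp
    then show ?thesis using quad[of "- ip u v / ip v v"]
      by (simp add: field_simps power2_eq_square)
  qed
  then have "\<bar>ip u v\<bar> \<le> sqrt (ip u u * ip v v)"
    by (simp add: real_le_rsqrt)
  then show ?thesis by (simp add: nrm_def real_sqrt_mult)
qed

lemma nrm_triangle: assumes "u \<in> H" "v \<in> H" shows "nrm (u + v) \<le> nrm u + nrm v"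
proof -
  have "(nrm (u + v))\<^sup>2 = (nrm u)\<^sup>2 + 2 * ip u v + (nrm v)\<^sup>2"
    using assms by (simp add: nrm_sq ip_simps ip_sym[of v u])
  also have "\<dots> \<le> (nrm u + nrm v)\<^sup>2"
    using Cauchy_Schwarz[OF assms] by (simp add: power2_sum)
  finally show ?thesis
    using assms by (meson H_add add_nonneg_nonneg nrm_nonneg power2_le_imp_le)
qed

lemma nrm_scale: "u \<in> H \<Longrightarrow> nrm (a *\<^sub>R u) = \<bar>a\<bar> * nrm u"
  by (simp add: nrm_def ip_simps real_sqrt_mult flip: mult.assoc)

lemma nrm_minus: "u \<in> H \<Longrightarrow> v \<in> H \<Longrightarrow> nrm (u - v) = nrm (v - u)"
  using nrm_scale[of "u - v" "-1"] by simp

lemma nrm_triangle3: "\<lbrakk>u \<in> H; v \<in> H; w \<in> H\<rbrakk> \<Longrightarrow> nrm (u - w) \<le> nrm (u - v) + nrm (v - w)"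
  using nrm_triangle[of "u - v" "v - w"] by simp

lemma nrm_triangle_diff: "\<lbrakk>u \<in> H; v \<in> H\<rbrakk> \<Longrightarrow> nrm (u - v) \<le> nrm u + nrm v"
  using nrm_triangle3[of u 0 v] nrm_minus[of 0 v] by simp

lemma nrm_diff_le: "\<lbrakk>u \<in> H; v \<in> H\<rbrakk> \<Longrightarrow> \<bar>nrm u - nrm v\<bar> \<le> nrm (u - v)"
  using nrm_triangle[of "u - v" v] nrm_triangle[of "v - u" u] nrm_minus[of u v] by simp

text \<open>Replacing one argument at a time turns \<open>ip u u\<close> into \<open>ip v v\<close>.
  This is how facts about \<open>T\<close> are proved: the values of \<open>T\<close> are known only
  through their inner products.\<close>

lemma nrm_cong: assumes "u \<in> H" "v \<in> H" "\<And>w. w \<in> H \<Longrightarrow> ip u w = ip v w" shows "nrm u = nrm v"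
  using assms by (metis nrm_def ip_sym)

lemma nrm_diff_zeroI:
  assumes "u \<in> H" "v \<in> H" "\<And>w. w \<in> H \<Longrightarrow> ip u w = ip v w" shows "nrm (u - v) = 0"
  using assms nrm_cong[of "u - v" 0] by (simp add: ip_simps ip_zero_left nrm_def)

lemma nrm_diff_zeroD:
  assumes "u \<in> H" "v \<in> H" "w \<in> H" "nrm (u - v) = 0" shows "ip u w = ip v w"
  using Cauchy_Schwarz[of "u - v" w] assms by (simp add: ip_simps)

text \<open>Minimise \<open>\<parallel>u\<parallel>\<^sup>2 - 2 F(u)\<close>; the parallelogram law makes minimising sequences Cauchy.\<close>

lemma Riesz_representation:
  assumes add: "\<And>u v. \<lbrakk>u \<in> H; v \<in> H\<rbrakk> \<Longrightarrow> F (u + v) = F u + F v"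
    and scale: "\<And>u a. u \<in> H \<Longrightarrow> F (a *\<^sub>R u) = a * F u"
    and bdd: "\<And>u. u \<in> H \<Longrightarrow> \<bar>F u\<bar> \<le> C * nrm u"
  shows "\<exists>w\<in>H. \<forall>u\<in>H. ip u w = F u"
proof -
  define J where "J u = (nrm u)\<^sup>2 - 2 * F u" for u
  have diff: "F (u - v) = F u - F v" if "u \<in> H" "v \<in> H" for u v
    using add[of "u - v" v] that by simp
  have J_ge: "- C\<^sup>2 \<le> J u" if "u \<in> H" for u
  proof -
    have "0 \<le> (nrm u - C)\<^sup>2" by simp
    then have "2 * (C * nrm u) \<le> (nrm u)\<^sup>2 + C\<^sup>2" by (simp add: power2_diff mult_ac)
    then show ?thesis using bdd[OF that] unfolding J_def by linarith
  qed
  define m where "m = Inf (J ` H)"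
  have bb: "bdd_below (J ` H)" using J_ge by (auto intro!: bdd_belowI)
  have m_le: "m \<le> J u" if "u \<in> H" for u
    unfolding m_def using bb that by (auto intro: cInf_lower)
  have "\<exists>u\<in>H. J u < m + e" if "e > 0" for e
  proof -
    have "J ` H \<noteq> {}" using H_zero by blast
    then show ?thesis using cInf_lessD[of "J ` H" "m + e"] that unfolding m_def by force
  qed
  then have "\<exists>u. u \<in> H \<and> J u < m + inverse (Suc n)" for n by (meson inverse_positive_iff_positive of_nat_0_less_iff zero_less_Suc)
  then obtain x where x: "\<And>n. x n \<in> H" "\<And>n. J (x n) < m + inverse (Suc n)" by metis
  have par: "(nrm (u - v))\<^sup>2 = 2 * J u + 2 * J v - 4 * J ((1/2) *\<^sub>R (u + v))" if "u \<in> H" "v \<in> H" for u v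
    using that by (simp add: J_def nrm_sq ip_simps ip_sym[of v u] add scale algebra_simps)
  have close: "(nrm (u - v))\<^sup>2 \<le> 2 * (J u - m) + 2 * (J v - m)" if "u \<in> H" "v \<in> H" for u v
    using par[OF that] m_le[of "(1/2) *\<^sub>R (u + v)"] that by simp
  have "\<exists>N. \<forall>i\<ge>N. \<forall>j\<ge>N. nrm (x i - x j) < e" if "e > 0" for e
  proof -
    obtain N where N: "inverse (real (Suc N)) < e\<^sup>2 / 4"
      using reals_Archimedean[of "e\<^sup>2 / 4"] \<open>e > 0\<close> by auto
    have "nrm (x i - x j) < e" if "i \<ge> N" "j \<ge> N" for i j
    proof -
      have "inverse (real (Suc i)) \<le> inverse (real (Suc N))" "inverse (real (Suc j)) \<le> inverse (real (Suc N))"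
        using that by (auto intro!: le_imp_inverse_le)
      moreover have "z < E" if "a \<le> c" "b \<le> c" "z \<le> 2 * (p - m) + 2 * (q - m)" "p < m + a" "q < m + b" "c < E / 4"
        for a b c p q z E :: real using that by argo
      ultimately have "(nrm (x i - x j))\<^sup>2 < e\<^sup>2"
        using close[OF x(1) x(1), of i j] x(2)[of i] x(2)[of j] N by blast
      then show ?thesis using \<open>e > 0\<close> by (simp add: power2_less_imp_less)
    qed
    then show ?thesis by blast
  qed
  then obtain l where l: "l \<in> H" "(\<lambda>n. nrm (x n - l)) \<longlonglongrightarrow> 0"
    using complete[of x] x unfolding nrm_def by blast
  have Jl: "J l \<le> m"
  proof -
    have "(\<lambda>n. nrm (x n)) \<longlonglongrightarrow> nrm l"
    proof (rule LIM_zero_cancel, rule Lim_null_comparison[OF _ l(2)])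
      show "\<forall>\<^sub>F n in sequentially. norm (nrm (x n) - nrm l) \<le> nrm (x n - l)"
        using nrm_diff_le[OF x(1) l(1)] by simp
    qed
    moreover have "(\<lambda>n. F (x n)) \<longlonglongrightarrow> F l"
    proof (rule LIM_zero_cancel, rule Lim_null_comparison)
      show "\<forall>\<^sub>F n in sequentially. norm (F (x n) - F l) \<le> C * nrm (x n - l)"
        using bdd x(1) l(1) by (auto simp flip: diff)
      show "(\<lambda>n. C * nrm (x n - l)) \<longlonglongrightarrow> 0" using tendsto_mult_left[OF l(2), of C] by simp
    qed
    ultimately have "(\<lambda>n. J (x n)) \<longlonglongrightarrow> J l"
      unfolding J_def by (intro tendsto_intros)
    moreover have "(\<lambda>n. m + inverse (real (Suc n))) \<longlonglongrightarrow> m + 0"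
      by (intro tendsto_intros LIMSEQ_inverse_real_of_nat)
    ultimately show ?thesis
      using x(2) by (intro LIMSEQ_le[of "\<lambda>n. J (x n)" "J l"]) (auto intro: less_imp_le)
  qed
  have "ip u l = F u" if u: "u \<in> H" for u
  proof -
    have ge: "0 \<le> 2 * t * (ip u l - F u) + t\<^sup>2 * ip u u" for t
    proof -
      have "J (l + t *\<^sub>R u) - J l = 2 * t * (ip u l - F u) + t\<^sup>2 * ip u u"
      proof -
        have "ip (l + t *\<^sub>R u) (l + t *\<^sub>R u) = ip l l + 2 * t * ip u l + t\<^sup>2 * ip u u"
          using u l(1) by (simp add: ip_simps ip_sym[of l u] power2_eq_square algebra_simps)
        then show ?thesis using u l(1) by (simp add: J_def nrm_sq add scale algebra_simps)
      qed
      then show ?thesis using m_le[of "l + t *\<^sub>R u"] Jl u l(1) by simp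
    qed
    show ?thesis
    proof (rule ccontr)
      define z where "z = ip u l - F u"
      assume "ip u l \<noteq> F u"
      then have z: "z \<noteq> 0" by (simp add: z_def)
      \<comment> \<open>The added 1 keeps \<open>U\<close> positive when \<open>u\<close> is a null
        vector; at \<open>t = - z / U\<close> the nonnegative expression would be at most
        \<open>- (z^2 / U)\<close>.\<close>
      define U where "U = ip u u + 1"
      have U: "U > 0" using ip_nonneg[OF u] by (simp add: U_def)
      have "0 \<le> 2 * (- z / U) * z + (- z / U)\<^sup>2 * ip u u"
        using ge[of "- z / U"] by (simp add: z_def)
      also have "\<dots> \<le> 2 * (- z / U) * z + (- z / U)\<^sup>2 * U"
        by (intro add_left_mono mult_left_mono) (auto simp: U_def)
      also have "\<dots> = - (z\<^sup>2 / U)"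
        using U by (simp add: field_simps power2_eq_square)
      also have "\<dots> < 0" using z U by simp
      finally show False by simp
    qed
  qed
  then show ?thesis using l(1) by blast
qed

end

section \<open>Continuous functional calculus\<close>

abbreviation complex_poly :: "real poly \<Rightarrow> complex poly" where
  "complex_poly \<equiv> map_poly complex_of_real"

lemma complex_poly_pCons: "complex_poly (pCons a q) = pCons (of_real a) (complex_poly q)"
  by (simp add: map_poly_pCons)

lemma complex_poly_add: "complex_poly (q + r) = complex_poly q + complex_poly r"
  by (induction q r rule: poly_induct2) (simp_all add: complex_poly_pCons)

lemma complex_poly_smult: "complex_poly (smult a q) = smult (of_real a) (complex_poly q)"
  by (induction q) (simp_all add: complex_poly_pCons)

lemma complex_poly_mult: "complex_poly (q * r) = complex_poly q * complex_poly r"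
  by (induction q) (simp_all add: complex_poly_pCons complex_poly_add complex_poly_smult)

lemma poly_complex_poly: "poly (complex_poly q) (of_real t) = of_real (poly q t)"
  by (induction q) (simp_all add: complex_poly_pCons)

text \<open>
  The spectrum enters only through a nonempty set \<open>\<sigma>\<close> off which \<open>T - c\<close> is bounded below.
\<close>

locale symmetric_op = semi_hilbert H ip for H :: "'v::real_vector set" and ip +
  fixes T :: "'v \<Rightarrow> 'v" and \<sigma> :: "real set" and \<eta> :: real
  assumes T_in [simp]: "u \<in> H \<Longrightarrow> T u \<in> H"
    and T_sym: "\<lbrakk>u \<in> H; v \<in> H\<rbrakk> \<Longrightarrow> ip (T u) v = ip u (T v)"
    and T_bdd: "\<exists>C. \<forall>u\<in>H. nrm (T u) \<le> C * nrm u"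
    and \<sigma>_ne: "\<sigma> \<noteq> {}" and \<sigma>_sub: "\<sigma> \<subseteq> {0..\<eta>}"
    and below: "c \<notin> \<sigma> \<Longrightarrow> \<exists>k>0. \<forall>u\<in>H. k * nrm u \<le> nrm (T u - c *\<^sub>R u)"
begin

definition opp :: "real poly \<Rightarrow> 'v \<Rightarrow> 'v" where
  "opp q u = (\<Sum>k\<le>degree q. coeff q k *\<^sub>R (T ^^ k) u)"

lemma funpow_in [simp]: "u \<in> H \<Longrightarrow> (T ^^ k) u \<in> H"
  by (induction k) auto

lemma funpow_sym: "\<lbrakk>u \<in> H; v \<in> H\<rbrakk> \<Longrightarrow> ip ((T ^^ k) u) v = ip u ((T ^^ k) v)"
  by (induction k arbitrary: v) (simp_all add: T_sym flip: funpow_swap1)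

lemma opp_in [simp]: "u \<in> H \<Longrightarrow> opp q u \<in> H"
  by (simp add: opp_def)

lemma opp_eq: "degree q \<le> n \<Longrightarrow> opp q u = (\<Sum>k\<le>n. coeff q k *\<^sub>R (T ^^ k) u)"
  unfolding opp_def by (intro sum.mono_neutral_left) (auto simp: coeff_eq_0)

lemma opp_add: "opp (q + r) u = opp q u + opp r u"
proof -
  define n where "n = max (degree q) (degree r)"
  have "degree (q + r) \<le> n" "degree q \<le> n" "degree r \<le> n"
    unfolding n_def by (auto intro: degree_add_le)
  then show ?thesis by (simp add: opp_eq[of _ n] scaleR_add_left sum.distrib)
qed

lemma opp_smult: "opp (smult a q) u = a *\<^sub>R opp q u"
  by (simp add: opp_eq[OF degree_smult_le] opp_def scaleR_sum_right)

lemma opp_diff: "opp (q - r) u = opp q u - opp r u"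
  using opp_add[of "q - r" r u] by simp

lemma opp_pCons: "opp (pCons a q) u = a *\<^sub>R u + opp q (T u)"
proof -
  have "opp (pCons a q) u = (\<Sum>k\<le>Suc (degree q). coeff (pCons a q) k *\<^sub>R (T ^^ k) u)"
    by (rule opp_eq) (simp add: degree_pCons_le)
  also have "\<dots> = a *\<^sub>R u + (\<Sum>k\<le>degree q. coeff q k *\<^sub>R (T ^^ k) (T u))"
    by (subst sum.atMost_Suc_shift) (simp add: funpow_swap1)
  finally show ?thesis by (simp add: opp_def)
qed

lemma opp_0 [simp]: "opp 0 u = 0"
  by (simp add: opp_def)

lemma opp_const: "opp [:a:] u = a *\<^sub>R u"
  by (simp add: opp_pCons)

lemma opp_sym: assumes "u \<in> H" "v \<in> H" shows "ip (opp q u) v = ip u (opp q v)"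
proof -
  have "ip (opp q u) v = (\<Sum>k\<le>degree q. coeff q k * ip ((T ^^ k) u) v)"
    using assms by (simp add: opp_def ip_sum ip_simps)
  also have "\<dots> = (\<Sum>k\<le>degree q. coeff q k * ip ((T ^^ k) v) u)"
    by (intro sum.cong refl arg_cong2[where f="(*)"]) (metis assms funpow_sym funpow_in ip_sym)
  also have "\<dots> = ip (opp q v) u"
    using assms by (simp add: opp_def ip_sum ip_simps)
  finally show ?thesis using assms by (simp add: ip_sym)
qed

text \<open>\<open>T\<close> is not assumed linear (symmetry makes it so only up to null vectors),
  hence \<open>opp q (opp r w)\<close> and \<open>opp (q * r) w\<close> may differ as vectors.
  Composition is handled under the inner product, by moving factors across with symmetry.\<close>

lemma ip_opp_opp: "\<lbrakk>u \<in> H; w \<in> H\<rbrakk> \<Longrightarrow> ip (opp q u) (opp r w) = ip (opp (q * r) u) w"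
proof (induction q arbitrary: u)
  case 0
  then show ?case by (simp add: ip_zero_left)
next
  case (pCons a q)
  then show ?case
    by (simp add: opp_pCons opp_add opp_smult ip_simps opp_sym[of u w r])
qed

lemma nrm_opp_mult: assumes "u \<in> H" shows "nrm (opp q (opp r u)) = nrm (opp (q * r) u)"
  using assms by (intro nrm_cong) (auto simp: opp_sym[of "opp r u"] ip_opp_opp mult.commute)

lemma opp_bdd: "\<exists>C\<ge>0. \<forall>u\<in>H. nrm (opp q u) \<le> C * nrm u"
proof (induction q)
  case 0
  then show ?case by (intro exI[of _ 0]) (auto simp: nrm_def ip_zero_left)
next
  case (pCons a q)
  then obtain C where C: "C \<ge> 0" "\<And>u. u \<in> H \<Longrightarrow> nrm (opp q u) \<le> C * nrm u" by blast
  obtain D where D: "\<And>u. u \<in> H \<Longrightarrow> nrm (T u) \<le> D * nrm u" using T_bdd by blast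
  have "nrm (opp (pCons a q) u) \<le> (\<bar>a\<bar> + C * \<bar>D\<bar>) * nrm u" if u: "u \<in> H" for u
  proof -
    have "nrm (opp (pCons a q) u) \<le> \<bar>a\<bar> * nrm u + nrm (opp q (T u))"
      using nrm_triangle[of "a *\<^sub>R u" "opp q (T u)"] u by (simp add: opp_pCons nrm_scale)
    also have "nrm (opp q (T u)) \<le> C * nrm (T u)" using C u by simp
    also have "C * nrm (T u) \<le> C * (\<bar>D\<bar> * nrm u)"
      using D[OF u] C(1) u by (intro mult_left_mono order_trans[OF D[OF u]] mult_right_mono) auto
    finally show ?thesis by (simp add: algebra_simps)
  qed
  then show ?case using C(1) by (intro exI[of _ "\<bar>a\<bar> + C * \<bar>D\<bar>"]) auto
qed

text \<open>Factor \<open>r\<close> over the reals; a quadratic factor \<open>(x - a)\<^sup>2 + b\<^sup>2\<close> is bounded below by \<open>b\<^sup>2\<close>.\<close>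

lemma opp_below:
  assumes "r \<noteq> 0" "\<And>x. x \<in> \<sigma> \<Longrightarrow> poly r x \<noteq> 0"
  shows "\<exists>k>0. \<forall>u\<in>H. k * nrm u \<le> nrm (opp r u)"
  using assms
proof (induction "degree r" arbitrary: r rule: less_induct)
  case less
  have step: "\<exists>k>0. \<forall>u\<in>H. k * nrm u \<le> nrm (opp r u)"
    if r: "r = m * g" and dm: "degree m > 0"
      and km: "k1 > 0" "\<And>u. u \<in> H \<Longrightarrow> k1 * nrm u \<le> nrm (opp m u)" for m g k1
  proof -
    have "m \<noteq> 0" "g \<noteq> 0" using less.prems(1) r by auto
    then have "degree g < degree r" using r dm by (simp add: degree_mult_eq)
    then obtain k2 where k2: "k2 > 0" "\<And>u. u \<in> H \<Longrightarrow> k2 * nrm u \<le> nrm (opp g u)"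
      using less.hyps[of g] \<open>g \<noteq> 0\<close> less.prems(2) r by auto
    have "k1 * k2 * nrm u \<le> nrm (opp r u)" if "u \<in> H" for u
    proof -
      have "k1 * k2 * nrm u \<le> k1 * nrm (opp g u)" using k2 km(1) that by simp
      also have "\<dots> \<le> nrm (opp m (opp g u))" using km(2) that by simp
      finally show ?thesis using that by (simp add: nrm_opp_mult r)
    qed
    then show ?thesis using k2 km by (intro exI[of _ "k1 * k2"]) auto
  qed
  show ?case
  proof (cases "\<exists>x. poly r x = 0")
    case True
    then obtain x where x: "poly r x = 0" by blast
    then obtain g where g: "r = [:-x, 1:] * g" by (auto simp: poly_eq_0_iff_dvd)
    have "x \<notin> \<sigma>" using x less.prems(2) by blast
    then obtain k where "k > 0" "\<forall>u\<in>H. k * nrm u \<le> nrm (T u - x *\<^sub>R u)" using below by blast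
    then show ?thesis by (intro step[OF g]) (auto simp: opp_pCons)
  next
    case False
    show ?thesis
    proof (cases "degree r = 0")
      case True
      then obtain a where "r = [:a:]" by (auto elim: degree_eq_zeroE)
      then show ?thesis using less.prems(1) by (intro exI[of _ "\<bar>a\<bar>"]) (auto simp: opp_const nrm_scale)
    next
      case deg: False
      define R where "R = complex_poly r"
      have "\<not> constant (poly R)"
        unfolding R_def constant_degree using deg by (simp add: degree_map_poly)
      then obtain z where z: "poly R z = 0" using fundamental_theorem_of_algebra by blast
      have im: "Im z \<noteq> 0"
      proof
        assume "Im z = 0"
        then have "z = complex_of_real (Re z)" by (simp add: complex_eq_iff)
        then have "complex_of_real (poly r (Re z)) = 0" using z poly_complex_poly[of r "Re z"] unfolding R_def by metis
        then show False using False by auto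
      qed
      define a where "a = Re z"
      define c where "c = Im z"
      define m where "m = [:a\<^sup>2 + c\<^sup>2, - 2 * a, 1:]"
      have mz: "poly (complex_poly m) z = 0"
        by (simp add: m_def map_poly_pCons a_def c_def complex_eq_iff power2_eq_square algebra_simps)
      have dm: "degree m = 2" by (simp add: m_def)
      \<comment> \<open>\<open>m\<close> has the roots \<open>z\<close> and its conjugate. The
        remainder has real coefficients and degree at most 1, and it vanishes at the nonreal
        \<open>z\<close>, so it is zero and \<open>m\<close> divides \<open>r\<close>.\<close>
      define q where "q = r mod m"
      have "degree q < 2"
        using degree_mod_less[of m r] dm unfolding q_def by (auto simp: m_def)
      then have q: "q = [:coeff q 0, coeff q 1:]"
        by (intro poly_eqI) (auto simp: coeff_pCons coeff_eq_0 split: nat.split)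
      have "r = q + m * (r div m)" by (simp add: q_def)
      then have "poly (complex_poly q) z = 0"
        using z mz complex_poly_add[of q "m * (r div m)"] unfolding R_def by (simp add: complex_poly_mult)
      then have "complex_of_real (coeff q 0) + z * complex_of_real (coeff q 1) = 0"
        by (subst (asm) q) (simp add: map_poly_pCons)
      then have "coeff q 1 = 0" "coeff q 0 = 0" using im by (auto simp: complex_eq_iff)
      then have "q = 0" using q by simp
      then have rm: "r = m * (r div m)" using q_def by (metis mod_0_imp_dvd dvd_mult_div_cancel)
      show ?thesis
      proof (rule step[OF rm])
        show "c\<^sup>2 > 0" using im by (simp add: c_def)
        show "c\<^sup>2 * nrm u \<le> nrm (opp m u)" if u: "u \<in> H" for u
        proof -
          have "opp m u = (opp ([:-a, 1:] * [:-a, 1:]) u) + c\<^sup>2 *\<^sub>R u"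
            by (simp add: m_def opp_pCons scaleR_add_left power2_eq_square)
          moreover have "ip (opp ([:-a, 1:] * [:-a, 1:]) u) u = ip (opp [:-a, 1:] u) (opp [:-a, 1:] u)"
            using u by (simp only: ip_opp_opp)
          ultimately have "ip (opp m u) u \<ge> c\<^sup>2 * ip u u"
            using u ip_nonneg[of "opp [:-a, 1:] u"] by (simp only: ip_simps opp_in H_scale) simp
          moreover have "ip (opp m u) u \<le> nrm (opp m u) * nrm u"
            using Cauchy_Schwarz[of "opp m u" u] u by simp
          moreover have "c\<^sup>2 * ip u u = c\<^sup>2 * nrm u * nrm u"
            using nrm_sq[OF u] by (simp add: power2_eq_square)
          ultimately have "c\<^sup>2 * nrm u * nrm u \<le> nrm (opp m u) * nrm u" by linarith
          then show ?thesis using u by (cases "nrm u = 0") (auto simp: mult_le_cancel_right dest: nrm_nonneg)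
        qed
      qed (simp add: dm)
    qed
  qed
qed

text \<open>If the least bound \<open>M\<close> of \<open>q(T)\<close> exceeded \<open>d\<close>, then \<open>M\<^sup>2 - q(T)\<^sup>2\<close> would be bounded below.\<close>

lemma nrm_opp_le:
  assumes d: "d \<ge> 0" "\<And>x. x \<in> \<sigma> \<Longrightarrow> \<bar>poly q x\<bar> \<le> d" and u: "u \<in> H"
  shows "nrm (opp q u) \<le> d * nrm u"
proof -
  define B where "B = {C. C \<ge> 0 \<and> (\<forall>u\<in>H. nrm (opp q u) \<le> C * nrm u)}"
  define M where "M = Inf B"
  have "B \<noteq> {}" using opp_bdd[of q] by (auto simp: B_def)
  have bb: "bdd_below B" by (auto simp: B_def bdd_below_def)
  have M0: "M \<ge> 0" unfolding M_def using \<open>B \<noteq> {}\<close> by (intro cInf_greatest) (auto simp: B_def)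
  have MB: "nrm (opp q v) \<le> M * nrm v" if v: "v \<in> H" for v
  proof (cases "nrm v = 0")
    case True
    then show ?thesis using opp_bdd[of q] v nrm_nonneg[of "opp q v"] by fastforce
  next
    case False
    then have nv: "nrm v > 0" using nrm_nonneg[OF v] by linarith
    have "nrm (opp q v) / nrm v \<le> M" unfolding M_def
      using \<open>B \<noteq> {}\<close> nv v by (intro cInf_greatest) (auto simp: B_def field_simps)
    then show ?thesis using nv by (simp add: field_simps)
  qed
  have "M \<le> d"
  proof (rule ccontr)
    assume "\<not> M \<le> d"
    then have M: "M > d" "M > 0" using d by auto
    define r where "r = [:M\<^sup>2:] - q * q"
    have nz: "poly r x \<noteq> 0" if "x \<in> \<sigma>" for x
    proof -
      have "\<bar>poly q x\<bar> < M" using d(2)[OF that] M by linarith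
      then have "(poly q x)\<^sup>2 < M\<^sup>2" using M by (metis power2_abs abs_ge_zero power_strict_mono pos2)
      then show ?thesis by (simp add: r_def power2_eq_square)
    qed
    then have "r \<noteq> 0" using \<sigma>_ne by (metis all_not_in_conv poly_0)
    then obtain k where k: "k > 0" "\<And>v. v \<in> H \<Longrightarrow> k * nrm v \<le> nrm (opp r v)"
      using opp_below nz by blast
    \<comment> \<open>Expanding the square of \<open>M^2 v - q(T)^2 v\<close> leaves
      \<open>- 2 M^2\<close> times the square of \<open>nrm (opp q v)\<close>; the last square gives
      back at most one \<open>M^2\<close> of it, by \<open>MB\<close> applied to
      \<open>opp q v\<close>.\<close>
    have main: "(M * nrm (opp q v))\<^sup>2 \<le> (M^4 - k\<^sup>2) * (nrm v)\<^sup>2" if v: "v \<in> H" for v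
    proof -
      have "(k * nrm v)\<^sup>2 \<le> (nrm (opp r v))\<^sup>2" using k v by (intro power_mono) auto
      also have "\<dots> = (nrm (M\<^sup>2 *\<^sub>R v - opp (q * q) v))\<^sup>2" by (simp add: r_def opp_diff opp_const)
      also have "\<dots> = M^4 * (nrm v)\<^sup>2 - 2 * M\<^sup>2 * ip (opp (q * q) v) v + (nrm (opp (q * q) v))\<^sup>2"
      proof -
        have "ip (M\<^sup>2 *\<^sub>R v - w) (M\<^sup>2 *\<^sub>R v - w) = M\<^sup>2 * (M\<^sup>2 * ip v v) - 2 * M\<^sup>2 * ip w v + ip w w"
          if "w \<in> H" for w
          using that v ip_sym[of v w] by (simp add: ip_simps algebra_simps)
        moreover have "M\<^sup>2 * (M\<^sup>2 * z) = M^4 * z" for z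
          by (simp add: power2_eq_square power4_eq_xxxx)
        ultimately show ?thesis using v by (simp add: nrm_sq)
      qed
      also have "ip (opp (q * q) v) v = (nrm (opp q v))\<^sup>2" using v by (simp add: nrm_sq ip_opp_opp)
      also have "(nrm (opp (q * q) v))\<^sup>2 \<le> (M * nrm (opp q v))\<^sup>2"
        using MB[of "opp q v"] v by (intro power_mono) (auto simp: nrm_opp_mult)
      finally show ?thesis by (simp add: algebra_simps power_mult_distrib)
    qed
    \<comment> \<open>By \<open>main\<close> this is again a bound of \<open>q(T)\<close>, and it is
      strictly smaller than \<open>M\<close>, against the choice of \<open>M\<close> as infimum. The
      \<open>max\<close> keeps the square root nonnegative.\<close>
    define M' where "M' = sqrt (max 0 (M^4 - k\<^sup>2)) / M"
    have "M' \<in> B"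
      unfolding B_def
    proof safe
      show "M' \<ge> 0" using M by (simp add: M'_def)
      fix v assume v: "v \<in> H"
      have "(M * nrm (opp q v))\<^sup>2 \<le> max 0 (M^4 - k\<^sup>2) * (nrm v)\<^sup>2"
        by (rule order_trans[OF main[OF v]]) (auto intro: mult_right_mono)
      then have "M * nrm (opp q v) \<le> sqrt (max 0 (M^4 - k\<^sup>2) * (nrm v)\<^sup>2)" by (rule real_le_rsqrt)
      then show "nrm (opp q v) \<le> M' * nrm v" using M v by (simp add: M'_def real_sqrt_mult field_simps)
    qed
    then have "M \<le> M'" unfolding M_def using bb by (rule cInf_lower)
    then have "M * M \<le> sqrt (max 0 (M^4 - k\<^sup>2))" using M by (simp add: M'_def field_simps)
    then have "(M * M)\<^sup>2 \<le> (sqrt (max 0 (M^4 - k\<^sup>2)))\<^sup>2" using M by (intro power_mono) auto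
    then have "(M * M)\<^sup>2 \<le> max 0 (M^4 - k\<^sup>2)" by simp
    moreover have "(M * M)\<^sup>2 = M^4" by (simp add: power2_eq_square power4_eq_xxxx)
    moreover have "M^4 > 0" using M by simp
    ultimately show False using k(1) by (auto simp: max_def split: if_splits)
  qed
  then have "M * nrm u \<le> d * nrm u" using u by (intro mult_right_mono) auto
  then show ?thesis using MB[OF u] by linarith
qed

section \<open>Functions of an operator as limits of polynomials\<close>

lemma poly_approx:
  fixes f :: "real \<Rightarrow> real"
  assumes f: "continuous_on {0..\<eta>} f" and "e > 0"
  obtains q where "\<And>x. x \<in> \<sigma> \<Longrightarrow> \<bar>poly q x - f x\<bar> \<le> e"
proof -
  obtain g where g: "real_polynomial_function g" "\<And>x. x \<in> {0..\<eta>} \<Longrightarrow> \<bar>f x - g x\<bar> < e"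
    using Stone_Weierstrass_real_polynomial_function[OF _ f \<open>e > 0\<close>] by auto
  obtain a n where an: "g = (\<lambda>x. \<Sum>i\<le>n. a i * x ^ i)"
    using g(1) unfolding real_polynomial_function_iff_sum by blast
  define q where "q = (\<Sum>i\<le>n. monom (a i) i)"
  have "poly q x = g x" for x by (simp add: q_def an poly_sum poly_monom)
  then have "\<bar>poly q x - f x\<bar> \<le> e" if "x \<in> \<sigma>" for x
    using g(2)[of x] that \<sigma>_sub by force
  then show ?thesis using that by blast
qed

abbreviation near :: "real poly \<Rightarrow> (real \<Rightarrow> real) \<Rightarrow> real \<Rightarrow> bool" where
  "near q f d \<equiv> \<forall>x\<in>\<sigma>. \<bar>poly q x - f x\<bar> \<le> d"

text \<open>The predicate from which \<open>op_fun\<close> makes its choice, in vector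
  notation.\<close>

definition is_fun :: "(real \<Rightarrow> real) \<Rightarrow> 'v \<Rightarrow> 'v \<Rightarrow> bool" where
  "is_fun f u w \<longleftrightarrow> w \<in> H \<and>
     (\<forall>e>0. \<exists>d>0. \<forall>q. near q f d \<longrightarrow> nrm (opp q u - w) \<le> e)"

lemma opp_close:
  assumes "\<And>x. x \<in> \<sigma> \<Longrightarrow> \<bar>poly q x - f x\<bar> \<le> d" "\<And>x. x \<in> \<sigma> \<Longrightarrow> \<bar>poly r x - f x\<bar> \<le> d'"
    and u: "u \<in> H"
  shows "nrm (opp q u - opp r u) \<le> (d + d') * nrm u"
proof -
  \<comment> \<open>A point of the spectrum is what forces the tolerance \<open>d + d'\<close> to be
    nonnegative, as \<open>nrm_opp_le\<close> demands.\<close>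
  obtain x0 where "x0 \<in> \<sigma>" using \<sigma>_ne by blast
  then have "0 \<le> d + d'" using assms(1)[of x0] assms(2)[of x0] by linarith
  moreover have "\<bar>poly (q - r) x\<bar> \<le> d + d'" if "x \<in> \<sigma>" for x
    using assms(1)[OF that] assms(2)[OF that] by simp
  ultimately show ?thesis using nrm_opp_le[of "d + d'" "q - r" u] u by (simp add: opp_diff)
qed

text \<open>One approximating sequence yields the limit \<open>w\<close>, by completeness. The
  predicate speaks of all polynomials close to \<open>f\<close>, though, and \<open>close\<close>
  reaches those by comparing an arbitrary one with the sequence.\<close>

lemma is_fun_exists:
  assumes f: "continuous_on {0..\<eta>} f" and u: "u \<in> H"
  shows "\<exists>w. is_fun f u w"
proof -
  have "\<exists>q. near q f (inverse (Suc n))" for n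
    using poly_approx[OF f, of "inverse (Suc n)"] by (metis inverse_positive_iff_positive of_nat_0_less_iff zero_less_Suc)
  then obtain q where q: "\<And>n x. x \<in> \<sigma> \<Longrightarrow> \<bar>poly (q n) x - f x\<bar> \<le> inverse (Suc n)" by metis
  have "\<exists>N. \<forall>i\<ge>N. \<forall>j\<ge>N. nrm (opp (q i) u - opp (q j) u) < e" if "e > 0" for e
  proof -
    obtain N where N: "inverse (real (Suc N)) < e / (2 * (nrm u + 1))"
      using reals_Archimedean[of "e / (2 * (nrm u + 1))"] \<open>e > 0\<close> nrm_nonneg[OF u] by auto
    have "nrm (opp (q i) u - opp (q j) u) < e" if "i \<ge> N" "j \<ge> N" for i j
    proof -
      have "inverse (real (Suc i)) \<le> inverse (real (Suc N))" "inverse (real (Suc j)) \<le> inverse (real (Suc N))"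
        using that by (auto intro!: le_imp_inverse_le)
      then have "inverse (real (Suc i)) + inverse (real (Suc j)) \<le> 2 * inverse (real (Suc N))"
        by (metis add_mono mult_2)
      then have "(inverse (real (Suc i)) + inverse (real (Suc j))) * nrm u \<le> (2 * inverse (real (Suc N))) * (nrm u + 1)"
        using u by (intro mult_mono) (simp_all del: of_nat_Suc)
      also have "\<dots> < e" using N nrm_nonneg[OF u] by (simp add: field_simps)
      finally show ?thesis using opp_close[OF q q u, of i j] by linarith
    qed
    then show ?thesis by blast
  qed
  then obtain w where w: "w \<in> H" "(\<lambda>n. nrm (opp (q n) u - w)) \<longlonglongrightarrow> 0"
    using complete[of "\<lambda>n. opp (q n) u"] u unfolding nrm_def by auto
  have close: "nrm (opp r u - w) \<le> d * nrm u" if r: "near r f d" for r d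
  proof (rule LIMSEQ_le_const)
    show "(\<lambda>n. (d + inverse (Suc n)) * nrm u + nrm (opp (q n) u - w)) \<longlonglongrightarrow> d * nrm u"
      using tendsto_add[OF tendsto_mult_right[OF tendsto_add[OF tendsto_const LIMSEQ_inverse_real_of_nat], of d "nrm u"] w(2)] by simp
    show "\<exists>N. \<forall>n\<ge>N. nrm (opp r u - w) \<le> (d + inverse (Suc n)) * nrm u + nrm (opp (q n) u - w)"
    proof (intro exI allI impI)
      fix n
      have "nrm (opp r u - w) \<le> nrm (opp r u - opp (q n) u) + nrm (opp (q n) u - w)"
        using u w(1) by (intro nrm_triangle3) auto
      also have "nrm (opp r u - opp (q n) u) \<le> (d + inverse (Suc n)) * nrm u"
        using r q u by (intro opp_close) auto
      finally show "nrm (opp r u - w) \<le> (d + inverse (Suc n)) * nrm u + nrm (opp (q n) u - w)" by simp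
    qed
  qed
  have "is_fun f u w" unfolding is_fun_def
  proof (intro conjI allI impI)
    fix e :: real assume "e > 0"
    define d where "d = e / (nrm u + 1)"
    have "d > 0" "d * nrm u \<le> e" using \<open>e > 0\<close> nrm_nonneg[OF u] by (auto simp: d_def field_simps)
    then show "\<exists>d>0. \<forall>q. near q f d \<longrightarrow> nrm (opp q u - w) \<le> e"
      using close[of _ d] by (meson order_trans)
  qed (use w in auto)
  then show ?thesis by blast
qed

lemma is_fun_unique:
  assumes f: "continuous_on {0..\<eta>} f" and u: "u \<in> H" and w: "is_fun f u w" "is_fun f u w'"
  shows "nrm (w - w') = 0"
proof -
  have H: "w \<in> H" "w' \<in> H" using w by (auto simp: is_fun_def)
  have "nrm (w - w') \<le> e" if "e > 0" for e
  proof -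
    have "e / 2 > 0" using that by simp
    obtain d where d: "d > 0" "\<And>q. near q f d \<Longrightarrow> nrm (opp q u - w) \<le> e / 2"
      using w(1) \<open>e / 2 > 0\<close> unfolding is_fun_def by blast
    obtain d' where d': "d' > 0" "\<And>q. near q f d' \<Longrightarrow> nrm (opp q u - w') \<le> e / 2"
      using w(2) \<open>e / 2 > 0\<close> unfolding is_fun_def by blast
    obtain q where q: "\<And>x. x \<in> \<sigma> \<Longrightarrow> \<bar>poly q x - f x\<bar> \<le> min d d'"
      using poly_approx[OF f, of "min d d'"] d d' by auto
    then have "nrm (opp q u - w) \<le> e / 2" "nrm (opp q u - w') \<le> e / 2" using d d' by auto
    then show ?thesis using nrm_triangle3[of w "opp q u" w'] nrm_minus[of w "opp q u"] H u by simp
  qed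
  then have "nrm (w - w') \<le> 0" by (meson dense_ge)
  then show ?thesis using H by (intro antisym) auto
qed

text \<open>Needed to turn the difference of two estimation errors into the image of the difference
  of two signals. \<open>opp q (u - v)\<close> and \<open>opp q u - opp q v\<close> agree only when
  tested against vectors.\<close>

lemma is_fun_diff:
  assumes f: "continuous_on {0..\<eta>} f" and u: "u \<in> H" "v \<in> H"
    and w: "is_fun f u w" "is_fun f v w'"
  shows "is_fun f (u - v) (w - w')"
  unfolding is_fun_def
proof (intro conjI allI impI)
  have H: "w \<in> H" "w' \<in> H" using w by (auto simp: is_fun_def)
  then show "w - w' \<in> H" by simp
  fix e :: real assume "e > 0"
  then have "e / 2 > 0" by simp
  obtain d where d: "d > 0" "\<And>q. near q f d \<Longrightarrow> nrm (opp q u - w) \<le> e / 2"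
    using w(1) \<open>e / 2 > 0\<close> unfolding is_fun_def by blast
  obtain d' where d': "d' > 0" "\<And>q. near q f d' \<Longrightarrow> nrm (opp q v - w') \<le> e / 2"
    using w(2) \<open>e / 2 > 0\<close> unfolding is_fun_def by blast
  have "nrm (opp q (u - v) - (w - w')) \<le> e" if q: "near q f (min d d')" for q
  proof -
    have "nrm (opp q (u - v) - (w - w')) = nrm ((opp q u - w) - (opp q v - w'))"
    proof (rule nrm_cong)
      fix z assume z: "z \<in> H"
      have "ip (opp q (u - v)) z = ip (opp q u) z - ip (opp q v) z"
        using u z by (simp add: ip_simps opp_sym[of _ z])
      then show "ip (opp q (u - v) - (w - w')) z = ip ((opp q u - w) - (opp q v - w')) z"
        using u z H by (simp add: ip_diff)
    qed (use u H in auto)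
    also have "\<dots> \<le> nrm (opp q u - w) + nrm (opp q v - w')"
      using u H by (intro nrm_triangle_diff) auto
    also have "\<dots> \<le> e / 2 + e / 2" using d d' q by (intro add_mono) auto
    finally show ?thesis by simp
  qed
  then show "\<exists>d>0. \<forall>q. near q f d \<longrightarrow> nrm (opp q (u - v) - (w - w')) \<le> e"
    using d d' by (intro exI[of _ "min d d'"]) auto
qed

text \<open>A continuous \<open>f\<close> is bounded on the interval; the 1 added to its bound is
  slack for an approximating polynomial. The estimate makes the loss continuous in the estimate,
  hence measurable.\<close>

lemma is_fun_bdd:
  assumes f: "continuous_on {0..\<eta>} f"
  obtains C where "\<And>u w. u \<in> H \<Longrightarrow> is_fun f u w \<Longrightarrow> nrm w \<le> C * nrm u"
proof -
  obtain B where B: "\<And>x. x \<in> {0..\<eta>} \<Longrightarrow> \<bar>f x\<bar> \<le> B"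
    using compact_imp_bounded[OF compact_continuous_image[OF f compact_Icc]] by (force simp: bounded_iff)
  have "nrm w \<le> (\<bar>B\<bar> + 1) * nrm u" if u: "u \<in> H" and w: "is_fun f u w" for u w
  proof -
    have H: "w \<in> H" using w by (auto simp: is_fun_def)
    have "nrm w \<le> (\<bar>B\<bar> + 1) * nrm u + e" if "e > 0" for e
    proof -
      obtain d where d: "d > 0" "\<And>q. near q f d \<Longrightarrow> nrm (opp q u - w) \<le> e"
        using w \<open>e > 0\<close> unfolding is_fun_def by meson
      obtain q where q: "\<And>x. x \<in> \<sigma> \<Longrightarrow> \<bar>poly q x - f x\<bar> \<le> min d 1"
        using poly_approx[OF f, of "min d 1"] d by auto
      have "\<bar>poly q x\<bar> \<le> \<bar>B\<bar> + 1" if "x \<in> \<sigma>" for x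
        using q[OF that] B[of x] that \<sigma>_sub by force
      then have "nrm (opp q u) \<le> (\<bar>B\<bar> + 1) * nrm u" using u by (intro nrm_opp_le) auto
      moreover have "nrm (opp q u - w) \<le> e" using d q by auto
      ultimately show ?thesis using nrm_diff_le[of "opp q u" w] u H by simp
    qed
    then show ?thesis by (rule field_le_epsilon)
  qed
  then show ?thesis using that by blast
qed

text \<open>Up to null vectors \<open>q(T) u\<close> is \<open>poly q c\<close> times
  \<open>u\<close>. Since \<open>c\<close> lies in the spectrum, polynomials close to
  \<open>f\<close> there are close to it at \<open>c\<close>.\<close>

lemma is_fun_eigenvector:
  assumes u: "u \<in> H" and eig: "nrm (T u - c *\<^sub>R u) = 0" and c: "c \<in> \<sigma>"
  shows "is_fun f u (f c *\<^sub>R u)"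
proof -
  have pow: "ip ((T ^^ k) u) w = c ^ k * ip u w" if w: "w \<in> H" for w k
    using w
  proof (induction k arbitrary: w)
    case (Suc k)
    have "ip ((T ^^ Suc k) u) w = ip ((T ^^ k) u) (T w)" using u Suc.prems by (simp add: T_sym)
    also have "\<dots> = c ^ k * ip (T u) w" using Suc u by (simp add: T_sym)
    also have "ip (T u) w = c * ip u w"
      using nrm_diff_zeroD[OF _ _ Suc.prems eig] u Suc.prems by (simp add: ip_simps)
    finally show ?case by simp
  qed simp
  have q: "nrm (opp q u - f c *\<^sub>R u) = \<bar>poly q c - f c\<bar> * nrm u" for q
  proof -
    have "nrm (opp q u - f c *\<^sub>R u) = nrm ((poly q c - f c) *\<^sub>R u)"
    proof (rule nrm_cong)
      fix w assume w: "w \<in> H"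
      have "ip (opp q u) w = poly q c * ip u w"
        using u w by (simp add: opp_def ip_sum ip_simps pow poly_altdef sum_distrib_right mult.assoc)
      then show "ip (opp q u - f c *\<^sub>R u) w = ip ((poly q c - f c) *\<^sub>R u) w"
        using u w by (simp add: ip_simps algebra_simps)
    qed (use u in auto)
    then show ?thesis using u by (simp add: nrm_scale)
  qed
  show ?thesis unfolding is_fun_def
  proof (intro conjI allI impI)
    fix e :: real assume "e > 0"
    have "\<bar>poly q c - f c\<bar> * nrm u \<le> e" if "\<bar>poly q c - f c\<bar> \<le> e / (nrm u + 1)" for q
    proof -
      have "\<bar>poly q c - f c\<bar> * nrm u \<le> e / (nrm u + 1) * (nrm u + 1)"
        using that u by (intro mult_mono) auto
      then show ?thesis using nrm_nonneg[OF u] by simp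
    qed
    then show "\<exists>d>0. \<forall>q. near q f d \<longrightarrow> nrm (opp q u - f c *\<^sub>R u) \<le> e"
      using c \<open>e > 0\<close> nrm_nonneg[OF u] by (intro exI[of _ "e / (nrm u + 1)"]) (auto simp: q)
  qed (use u in auto)
qed

end

section \<open>Completeness of \<open>L\<^sup>2\<close>\<close>

lemma L2_measurable: "f \<in> L2 M \<Longrightarrow> f \<in> borel_measurable M"
  by (simp add: L2_def)

lemma L2_integrable_mult:
  assumes "f \<in> L2 M" "g \<in> L2 M"
  shows "integrable M (\<lambda>x. f x * g x)"
proof (rule Bochner_Integration.integrable_bound)
  show "integrable M (\<lambda>x. (f x)\<^sup>2 + (g x)\<^sup>2)" using assms by (auto simp: L2_def)
  have "\<bar>a * b\<bar> \<le> a\<^sup>2 + b\<^sup>2" for a b :: real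
  proof -
    have "0 \<le> (\<bar>a\<bar> - \<bar>b\<bar>)\<^sup>2" by simp
    then have "2 * (\<bar>a\<bar> * \<bar>b\<bar>) \<le> a\<^sup>2 + b\<^sup>2" by (simp add: power2_diff)
    moreover have "0 \<le> \<bar>a\<bar> * \<bar>b\<bar>" by simp
    ultimately show ?thesis unfolding abs_mult by linarith
  qed
  then show "AE x in M. norm (f x * g x) \<le> norm ((f x)\<^sup>2 + (g x)\<^sup>2)" by (auto intro!: AE_I2)
  show "(\<lambda>x. f x * g x) \<in> borel_measurable M" using assms by (auto simp: L2_def)
qed

lemma L2_scale: "f \<in> L2 M \<Longrightarrow> (\<lambda>x. c * f x) \<in> L2 M"
  by (auto simp: L2_def power_mult_distrib)

lemma L2_add: assumes "f \<in> L2 M" "g \<in> L2 M" shows "(\<lambda>x. f x + g x) \<in> L2 M"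
proof -
  have "integrable M (\<lambda>x. (f x)\<^sup>2 + (g x)\<^sup>2 + 2 * (f x * g x))"
    using assms L2_integrable_mult[OF assms] by (auto simp: L2_def)
  then show ?thesis using assms by (auto simp: L2_def power2_sum mult.assoc)
qed

lemma L2_diff: assumes "f \<in> L2 M" "g \<in> L2 M" shows "(\<lambda>x. f x - g x) \<in> L2 M"
  using L2_add[OF assms(1) L2_scale[OF assms(2), of "-1"]] by simp

lemma L2_zero: "(\<lambda>x. 0) \<in> L2 M"
  by (simp add: L2_def)

lemma L2_norm_eq: "L2_norm M f = sqrt (\<integral>x. (f x)\<^sup>2 \<partial>M)"
  by (simp add: L2_norm_def L2_inner_def power2_eq_square)

lemma L2_nn_integral: "f \<in> L2 M \<Longrightarrow> (\<integral>\<^sup>+x. ennreal ((f x)\<^sup>2) \<partial>M) = ennreal ((L2_norm M f)\<^sup>2)"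
  by (simp add: L2_norm_eq L2_def nn_integral_eq_integral)

lemma L2I_nn_integral:
  assumes f: "f \<in> borel_measurable M" and e: "(\<integral>\<^sup>+x. ennreal ((f x)\<^sup>2) \<partial>M) \<le> ennreal (e\<^sup>2)" "e \<ge> 0"
  shows "f \<in> L2 M" "L2_norm M f \<le> e"
proof -
  have "integrable M (\<lambda>x. (f x)\<^sup>2)"
    using f e le_less_trans[OF e(1) ennreal_less_top] by (intro integrableI_nonneg) auto
  then show *: "f \<in> L2 M" using f by (simp add: L2_def)
  have "(L2_norm M f)\<^sup>2 \<le> e\<^sup>2" using e L2_nn_integral[OF *] by (simp add: ennreal_le_iff)
  then show "L2_norm M f \<le> e" using e(2) by (rule power2_le_imp_le)
qed

text \<open>The Riesz-Fischer argument: a fast subsequence converges almost everywhere, and Fatou's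
  lemma shows that its pointwise limit is also the limit in norm.\<close>

lemma L2_complete:
  assumes f: "\<And>n::nat. f n \<in> L2 M"
    and cauchy: "\<And>e. e > 0 \<Longrightarrow> \<exists>N. \<forall>m\<ge>N. \<forall>n\<ge>N. L2_norm M (\<lambda>x. f m x - f n x) < e"
  shows "\<exists>g\<in>L2 M. (\<lambda>n. L2_norm M (\<lambda>x. f n x - g x)) \<longlonglongrightarrow> 0"
proof -
  have fm [measurable]: "f n \<in> borel_measurable M" for n using f by (rule L2_measurable)
  have "\<exists>N. \<forall>m\<ge>N. \<forall>n\<ge>N. L2_norm M (\<lambda>x. f m x - f n x) < (1/2)^k" for k
    by (rule cauchy) simp
  then obtain N where N: "\<And>k m n. m \<ge> N k \<Longrightarrow> n \<ge> N k \<Longrightarrow> L2_norm M (\<lambda>x. f m x - f n x) < (1/2)^k"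
    by metis
  \<comment> \<open>A monotone majorant of \<open>N\<close>, so that the subsequence has increments
    below \<open>(1/2)^k\<close>.\<close>
  define r where "r k = (\<Sum>i\<le>k. N i) + k" for k
  have rN: "r k \<ge> N k" for k
    unfolding r_def using member_le_sum[of k "{..k}" N] by (simp add: trans_le_add1)
  have rmono: "k \<le> k' \<Longrightarrow> r k \<le> r k'" for k k'
    unfolding r_def by (intro add_mono sum_mono2) auto
  define d where "d k x = f (r (Suc k)) x - f (r k) x" for k x
  have dL2: "d k \<in> L2 M" for k unfolding d_def using L2_diff[OF f f] by simp
  have dm [measurable]: "d k \<in> borel_measurable M" for k using dL2 by (rule L2_measurable)
  have dn: "L2_norm M (d k) \<le> (1/2)^k" for k
    using N[of k "r (Suc k)" "r k"] rN[of k] rmono[of k "Suc k"] unfolding d_def by simp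
  \<comment> \<open>The squared increments have integral at most \<open>(1/4)^k\<close>, which
    leaves room for the weight \<open>2^k\<close>. Below,
    \<open>\<bar>d\<bar> \<le> (1/2)^k + 2^k * d^2\<close> turns weighted summability of squares
    into absolute convergence.\<close>
  have "(\<integral>\<^sup>+x. (\<Sum>k. ennreal (2^k * (d k x)\<^sup>2)) \<partial>M) = (\<Sum>k. \<integral>\<^sup>+x. ennreal (2^k * (d k x)\<^sup>2) \<partial>M)"
    by (intro nn_integral_suminf) measurable
  also have "\<dots> \<le> (\<Sum>k. ennreal ((1/2)^k))"
  proof (intro suminf_le)
    fix k
    have "(\<integral>\<^sup>+x. ennreal (2^k * (d k x)\<^sup>2) \<partial>M) = ennreal (2^k) * ennreal ((L2_norm M (d k))\<^sup>2)"
      by (subst L2_nn_integral[OF dL2, symmetric]) (simp add: ennreal_mult nn_integral_cmult)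
    also have "\<dots> \<le> ennreal (2^k) * ennreal (((1/2)^k)\<^sup>2)"
      using dn[of k] by (intro mult_left_mono ennreal_leI power_mono) (auto simp: L2_norm_eq)
    also have "\<dots> = ennreal ((1/2)^k)"
      by (simp add: power_divide power2_eq_square flip: ennreal_mult)
    finally show "(\<integral>\<^sup>+x. ennreal (2^k * (d k x)\<^sup>2) \<partial>M) \<le> ennreal ((1/2)^k)" .
  qed auto
  also have "\<dots> = ennreal (\<Sum>k. (1/2)^k)"
    by (intro suminf_ennreal2 summable_geometric) auto
  also have "\<dots> < \<infinity>" by simp
  finally have "AE x in M. (\<Sum>k. ennreal (2^k * (d k x)\<^sup>2)) \<noteq> \<infinity>"
    by (intro nn_integral_PInf_AE) auto
  then have conv: "AE x in M. convergent (\<lambda>k. f (r k) x)"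
  proof eventually_elim
    case (elim x)
    have "summable (\<lambda>k. 2^k * (d k x)\<^sup>2)"
      using elim by (intro summable_suminf_not_top) (auto simp: top_unique)
    then have s: "summable (\<lambda>k. (1/2)^k + 2^k * (d k x)\<^sup>2)"
      by (intro summable_add summable_geometric) auto
    have "norm (d k x) \<le> (1/2)^k + 2^k * (d k x)\<^sup>2" for k
    proof -
      define a where "a = (2::real)^k"
      have a: "a > 0" by (simp add: a_def)
      have "0 \<le> (a * \<bar>d k x\<bar> - 1)\<^sup>2" by simp
      then have "2 * (a * \<bar>d k x\<bar>) \<le> a * a * (d k x)\<^sup>2 + 1"
        by (simp add: power2_diff power_mult_distrib power2_eq_square[of a])
      moreover have "0 \<le> a * \<bar>d k x\<bar>" using a by simp
      ultimately have "a * \<bar>d k x\<bar> \<le> 1 + a * a * (d k x)\<^sup>2" by linarith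
      then have "\<bar>d k x\<bar> \<le> 1 / a + a * (d k x)\<^sup>2" using a by (simp add: field_simps)
      then show ?thesis by (simp add: a_def power_divide)
    qed
    then have "summable (\<lambda>k. d k x)" by (intro summable_comparison_test[OF _ s]) auto
    then have "(\<lambda>n. \<Sum>k<n. d k x) \<longlonglongrightarrow> (\<Sum>k. d k x)" by (rule summable_LIMSEQ)
    moreover have "(\<Sum>k<n. d k x) = f (r n) x - f (r 0) x" for n
      unfolding d_def by (rule sum_lessThan_telescope)
    ultimately have "(\<lambda>n. f (r n) x - f (r 0) x + f (r 0) x) \<longlonglongrightarrow> (\<Sum>k. d k x) + f (r 0) x"
      by (intro tendsto_add) auto
    then show ?case by (auto simp: convergent_def)
  qed
  define g where "g x = lim (\<lambda>k. f (r k) x)" for x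
  have gm [measurable]: "g \<in> borel_measurable M" unfolding g_def[abs_def] by measurable
  have lim: "AE x in M. (\<lambda>k. f (r k) x) \<longlonglongrightarrow> g x"
    using conv by eventually_elim (simp add: g_def convergent_LIMSEQ_iff)
  have close: "(\<lambda>x. f n x - g x) \<in> L2 M" "L2_norm M (\<lambda>x. f n x - g x) \<le> (1/2)^j" if n: "n \<ge> N j" for n j
  proof -
    \<comment> \<open>Fatou along the subsequence transfers the Cauchy estimate from
      \<open>f (r k)\<close> to \<open>g\<close>.\<close>
    have "(\<integral>\<^sup>+x. ennreal ((f n x - g x)\<^sup>2) \<partial>M) = (\<integral>\<^sup>+x. liminf (\<lambda>k. ennreal ((f n x - f (r k) x)\<^sup>2)) \<partial>M)"
    proof (rule nn_integral_cong_AE, use lim in eventually_elim)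
      case (elim x)
      then have "(\<lambda>k. ennreal ((f n x - f (r k) x)\<^sup>2)) \<longlonglongrightarrow> ennreal ((f n x - g x)\<^sup>2)"
        by (intro tendsto_ennrealI tendsto_intros)
      then show ?case using lim_imp_Liminf[OF sequentially_bot] by metis
    qed
    also have "\<dots> \<le> liminf (\<lambda>k. \<integral>\<^sup>+x. ennreal ((f n x - f (r k) x)\<^sup>2) \<partial>M)"
      by (rule nn_integral_liminf) measurable
    also have "\<dots> \<le> ennreal (((1/2)^j)\<^sup>2)"
    proof (rule Liminf_le)
      show "\<forall>\<^sub>F k in sequentially. (\<integral>\<^sup>+x. ennreal ((f n x - f (r k) x)\<^sup>2) \<partial>M) \<le> ennreal (((1/2)^j)\<^sup>2)"
      proof (rule eventually_sequentiallyI[of j])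
        fix k assume "j \<le> k"
        then have "r k \<ge> N j" using rN[of j] rmono[of j k] by linarith
        then have "L2_norm M (\<lambda>x. f n x - f (r k) x) < (1/2)^j" using N n by blast
        then show "(\<integral>\<^sup>+x. ennreal ((f n x - f (r k) x)\<^sup>2) \<partial>M) \<le> ennreal (((1/2)^j)\<^sup>2)"
          by (subst L2_nn_integral[OF L2_diff[OF f f]]) (intro ennreal_leI power_mono, auto simp: L2_norm_eq)
      qed
    qed simp
    finally have *: "(\<integral>\<^sup>+x. ennreal ((f n x - g x)\<^sup>2) \<partial>M) \<le> ennreal (((1/2)^j)\<^sup>2)" .
    show "(\<lambda>x. f n x - g x) \<in> L2 M" "L2_norm M (\<lambda>x. f n x - g x) \<le> (1/2)^j"
      by (rule L2I_nn_integral[OF _ *], simp, simp)+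
  qed
  have "(\<lambda>x. f (N 0) x - (f (N 0) x - g x)) \<in> L2 M"
    by (rule L2_diff[OF f close(1)[of 0]]) simp
  then have gL2: "g \<in> L2 M" by simp
  have "(\<lambda>n. L2_norm M (\<lambda>x. f n x - g x)) \<longlonglongrightarrow> 0"
  proof (rule LIMSEQ_I)
    fix e :: real assume "e > 0"
    then obtain j where j: "(1/2)^j < e" using real_arch_pow_inv[of e "1/2"] by auto
    then show "\<exists>no. \<forall>n\<ge>no. norm (L2_norm M (\<lambda>x. f n x - g x) - 0) < e"
      using close(2)[of j] by (intro exI[of _ "N j"]) (auto simp: L2_norm_eq intro: le_less_trans)
  qed
  then show ?thesis using gL2 by blast
qed

section \<open>Direct sums as complete semi-inner product spaces\<close>

lemma L2_sum_diff_eq: "(\<lambda>l x. u l x - v l x) = u - (v :: nat \<Rightarrow> 'a \<Rightarrow> real)"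
  by (simp add: fun_eq_iff)

lemma L2_sum_dist_eq: "L2_sum_dist p M u v = L2_sum_norm p M (u - v)"
  by (simp add: L2_sum_dist_def L2_sum_diff_eq)

lemma L2_sum_norm_component_le: "l \<le> p \<Longrightarrow> L2_norm (M l) (u l) \<le> L2_sum_norm p M u"
  unfolding L2_sum_norm_def L2_norm_def L2_sum_inner_def
  by (intro real_sqrt_le_mono member_le_sum[of l "{..p}" "\<lambda>l. L2_inner (M l) (u l) (u l)"]) (auto simp: L2_inner_def)

lemma semi_hilbert_L2_sum: "semi_hilbert (L2_sum p M) (L2_sum_inner p M)"
proof
  show "subspace (L2_sum p M)"
    by (auto simp: subspace_def L2_sum_def L2_zero[unfolded zero_fun_def[symmetric]] plus_fun_def scaleR_fun_def
        intro!: L2_add L2_scale)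
  show "L2_sum_inner p M (u + v) w = L2_sum_inner p M u w + L2_sum_inner p M v w"
    if "u \<in> L2_sum p M" "v \<in> L2_sum p M" "w \<in> L2_sum p M" for u v w
    unfolding L2_sum_inner_def L2_inner_def sum.distrib[symmetric]
  proof (intro sum.cong refl)
    fix l assume "l \<in> {..p}"
    then have "u l \<in> L2 (M l)" "v l \<in> L2 (M l)" "w l \<in> L2 (M l)" using that by (auto simp: L2_sum_def)
    then show "(\<integral>x. (u + v) l x * w l x \<partial>M l) = (\<integral>x. u l x * w l x \<partial>M l) + (\<integral>x. v l x * w l x \<partial>M l)"
      by (simp add: distrib_right L2_integrable_mult)
  qed
  show "L2_sum_inner p M (a *\<^sub>R u) w = a * L2_sum_inner p M u w" for u w a
    by (simp add: L2_sum_inner_def L2_inner_def sum_distrib_left mult.assoc)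
  show "L2_sum_inner p M u w = L2_sum_inner p M w u" for u w
    by (simp add: L2_sum_inner_def L2_inner_def mult.commute)
  show "0 \<le> L2_sum_inner p M u u" for u
    by (auto simp: L2_sum_inner_def L2_inner_def intro!: sum_nonneg)
  fix x :: "nat \<Rightarrow> nat \<Rightarrow> 'a \<Rightarrow> real"
  assume x: "\<And>n. x n \<in> L2_sum p M"
    and cauchy: "\<And>e. e > 0 \<Longrightarrow> \<exists>N. \<forall>m\<ge>N. \<forall>n\<ge>N. sqrt (L2_sum_inner p M (x m - x n) (x m - x n)) < e"
  have "\<exists>g\<in>L2 (M l). (\<lambda>n. L2_norm (M l) (\<lambda>z. x n l z - g z)) \<longlonglongrightarrow> 0" if l: "l \<le> p" for l
  proof (rule L2_complete)
    show "x n l \<in> L2 (M l)" for n using x l by (auto simp: L2_sum_def)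
    fix e :: real assume "e > 0"
    then obtain N where N: "\<forall>m\<ge>N. \<forall>n\<ge>N. L2_sum_norm p M (x m - x n) < e"
      using cauchy unfolding L2_sum_norm_def by blast
    have "L2_norm (M l) (\<lambda>z. x m l z - x n l z) < e" if "m \<ge> N" "n \<ge> N" for m n
    proof -
      have "(\<lambda>z. x m l z - x n l z) = (x m - x n) l" by (simp add: fun_eq_iff)
      then show ?thesis using N that L2_sum_norm_component_le[OF l, of M "x m - x n"] by (metis le_less_trans)
    qed
    then show "\<exists>N. \<forall>m\<ge>N. \<forall>n\<ge>N. L2_norm (M l) (\<lambda>z. x m l z - x n l z) < e" by blast
  qed
  then obtain g where g: "\<And>l. l \<le> p \<Longrightarrow> g l \<in> L2 (M l)"
    "\<And>l. l \<le> p \<Longrightarrow> (\<lambda>n. L2_norm (M l) (\<lambda>z. x n l z - g l z)) \<longlonglongrightarrow> 0" by metis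
  have "(\<lambda>n. sqrt (\<Sum>l\<le>p. (L2_norm (M l) (\<lambda>z. x n l z - g l z))\<^sup>2)) \<longlonglongrightarrow> sqrt (\<Sum>l\<le>p. 0\<^sup>2)"
    using g(2) by (intro tendsto_intros) auto
  moreover have "sqrt (\<Sum>l\<le>p. (L2_norm (M l) (\<lambda>z. x n l z - g l z))\<^sup>2) = sqrt (L2_sum_inner p M (x n - g) (x n - g))" for n
    unfolding L2_sum_inner_def L2_norm_def
    by (intro arg_cong[where f=sqrt] sum.cong refl) (simp add: L2_inner_def)
  ultimately have "(\<lambda>n. sqrt (L2_sum_inner p M (x n - g) (x n - g))) \<longlonglongrightarrow> 0" by simp
  moreover have "g \<in> L2_sum p M" using g(1) by (simp add: L2_sum_def)
  ultimately show "\<exists>l\<in>L2_sum p M. (\<lambda>n. sqrt (L2_sum_inner p M (x n - l) (x n - l))) \<longlonglongrightarrow> 0" by blast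
qed

interpretation LS: semi_hilbert "L2_sum p M" "L2_sum_inner p M" for p M
  by (rule semi_hilbert_L2_sum)

lemma LS_nrm: "LS.nrm p M u = L2_sum_norm p M u"
  by (simp add: LS.nrm_def L2_sum_norm_def)

section \<open>Tensors in \<open>L\<^sup>2\<close> of product spaces\<close>

text \<open>The direct sum with \<open>p = 0\<close> has a single summand.\<close>

lemma L2_Cauchy_Schwarz: assumes "f \<in> L2 M" "g \<in> L2 M" shows "\<bar>L2_inner M f g\<bar> \<le> L2_norm M f * L2_norm M g"
  using LS.Cauchy_Schwarz[of "\<lambda>_. f" 0 "\<lambda>_. M" "\<lambda>_. g"] assms
  by (simp add: L2_sum_def L2_sum_inner_def LS_nrm L2_sum_norm_def L2_norm_def)

lemma L2_norm_nonneg [simp]: "0 \<le> L2_norm M f"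
  by (simp add: L2_norm_eq)

lemma L2_norm_sq: "(L2_norm M f)\<^sup>2 = L2_inner M f f"
  by (simp add: L2_norm_def L2_inner_def)

lemma L2_inner_commute: "L2_inner M f g = L2_inner M g f"
  by (simp add: L2_inner_def mult.commute)

lemma L2_section:
  assumes "pair_sigma_finite M1 M2" and f: "f \<in> L2 (M1 \<Otimes>\<^sub>M M2)"
  shows "AE x in M1. (\<lambda>y. f (x, y)) \<in> L2 M2"
proof -
  interpret pair_sigma_finite M1 M2 by fact
  have fm [measurable]: "f \<in> borel_measurable (M1 \<Otimes>\<^sub>M M2)" using f by (rule L2_measurable)
  have "AE x in M1. integrable M2 (\<lambda>y. (f (x, y))\<^sup>2)"
    using AE_integrable_fst'[of "\<lambda>z. (f z)\<^sup>2"] f by (simp add: L2_def)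
  with AE_space show ?thesis
  proof eventually_elim
    case (elim x)
    then show ?case by (auto simp: L2_def)
  qed
qed

lemma L2_tensor:
  assumes "pair_sigma_finite M1 M2" and f: "f \<in> L2 M1" and g: "g \<in> L2 M2"
  shows "(\<lambda>(x, y). f x * g y) \<in> L2 (M1 \<Otimes>\<^sub>M M2)"
proof -
  interpret pair_sigma_finite M1 M2 by fact
  have [measurable]: "f \<in> borel_measurable M1" "g \<in> borel_measurable M2" using f g by (auto dest: L2_measurable)
  have "integrable (M1 \<Otimes>\<^sub>M M2) (\<lambda>(x, y). (f x)\<^sup>2 * (g y)\<^sup>2)"
    using f g by (intro Fubini_integrable) (auto simp: L2_def abs_mult)
  then show ?thesis by (auto simp: L2_def case_prod_beta' power_mult_distrib)
qed

text \<open>Cauchy-Schwarz on almost every section bounds the square of the integral by a multiple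
  of the squared norm of the section, which is integrable by Fubini.\<close>

lemma L2_partial_integral:
  assumes "pair_sigma_finite M1 M2" and u: "u \<in> L2 (M1 \<Otimes>\<^sub>M M2)" and g: "g \<in> L2 M1"
  shows "(\<lambda>y. \<integral>x. u (x, y) * g x \<partial>M1) \<in> L2 M2"
proof -
  interpret pair_sigma_finite M1 M2 by fact
  interpret sw: pair_sigma_finite M2 M1 ..
  have [measurable]: "u \<in> borel_measurable (M1 \<Otimes>\<^sub>M M2)" "g \<in> borel_measurable M1" using u g by (auto dest: L2_measurable)
  have int: "integrable (M1 \<Otimes>\<^sub>M M2) (\<lambda>(x, y). (u (x, y))\<^sup>2)" using u by (simp add: L2_def case_prod_beta')
  have i2: "integrable M2 (\<lambda>y. \<integral>x. (u (x, y))\<^sup>2 \<partial>M1)" by (rule integrable_snd[OF int])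
  have "AE y in M2. integrable M1 (\<lambda>x. (u (x, y))\<^sup>2)" by (rule AE_integrable_snd[OF int])
  with AE_space have ae: "AE y in M2. (\<integral>x. u (x, y) * g x \<partial>M1)\<^sup>2 \<le> (L2_norm M1 g)\<^sup>2 * (\<integral>x. (u (x, y))\<^sup>2 \<partial>M1)"
  proof eventually_elim
    case (elim y)
    then have uy: "(\<lambda>x. u (x, y)) \<in> L2 M1" by (auto simp: L2_def)
    have "\<bar>\<integral>x. u (x, y) * g x \<partial>M1\<bar>\<^sup>2 \<le> (L2_norm M1 (\<lambda>x. u (x, y)) * L2_norm M1 g)\<^sup>2"
      using L2_Cauchy_Schwarz[OF uy g] unfolding L2_inner_def by (intro power_mono) auto
    then show ?case by (simp add: power_mult_distrib L2_norm_eq mult.commute)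
  qed
  have m: "(\<lambda>y. \<integral>x. u (x, y) * g x \<partial>M1) \<in> borel_measurable M2" by measurable
  have "integrable M2 (\<lambda>y. (\<integral>x. u (x, y) * g x \<partial>M1)\<^sup>2)"
  proof (rule Bochner_Integration.integrable_bound)
    show "integrable M2 (\<lambda>y. (L2_norm M1 g)\<^sup>2 * (\<integral>x. (u (x, y))\<^sup>2 \<partial>M1))" using i2 by simp
    show "AE y in M2. norm ((\<integral>x. u (x, y) * g x \<partial>M1)\<^sup>2) \<le> norm ((L2_norm M1 g)\<^sup>2 * (\<integral>x. (u (x, y))\<^sup>2 \<partial>M1))"
      using ae by eventually_elim auto
  qed (use m in measurable)
  then show ?thesis using m by (simp add: L2_def)
qed

text \<open>All three facts are Fubini for the product of \<open>u\<close> with the tensor of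
  \<open>g\<close> and \<open>f\<close>, integrable as a product of two square integrable
  functions.\<close>

lemma L2_integral_tensor:
  assumes "pair_sigma_finite M1 M2" and u: "u \<in> L2 (M1 \<Otimes>\<^sub>M M2)" and g: "g \<in> L2 M1" and f: "f \<in> L2 M2"
  shows "(\<integral>z. u z * (case z of (x, y) \<Rightarrow> g x * f y) \<partial>(M1 \<Otimes>\<^sub>M M2)) = (\<integral>y. f y * (\<integral>x. u (x, y) * g x \<partial>M1) \<partial>M2)"
    and "(\<integral>x. (\<integral>y. u (x, y) * f y \<partial>M2) * g x \<partial>M1) = (\<integral>y. f y * (\<integral>x. u (x, y) * g x \<partial>M1) \<partial>M2)"
    and "integrable M1 (\<lambda>x. (\<integral>y. u (x, y) * f y \<partial>M2) * g x)"
proof -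
  interpret pair_sigma_finite M1 M2 by fact
  have int: "integrable (M1 \<Otimes>\<^sub>M M2) (\<lambda>(x, y). u (x, y) * g x * f y)"
    using L2_integrable_mult[OF u L2_tensor[OF assms(1) g f]] by (simp add: case_prod_beta' mult.assoc)
  have 1: "(\<lambda>z. u z * (case z of (x, y) \<Rightarrow> g x * f y)) = (\<lambda>(x, y). u (x, y) * g x * f y)"
    by (auto simp: fun_eq_iff)
  have 2: "(\<integral>y. u (x, y) * f y \<partial>M2) * g x = (\<integral>y. u (x, y) * g x * f y \<partial>M2)" for x
    by (subst integral_mult_left_zero[symmetric]) (simp add: mult_ac)
  have 3: "f y * (\<integral>x. u (x, y) * g x \<partial>M1) = (\<integral>x. u (x, y) * g x * f y \<partial>M1)" for y
    by (subst integral_mult_right_zero[symmetric]) (simp add: mult_ac)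
  show "(\<integral>z. u z * (case z of (x, y) \<Rightarrow> g x * f y) \<partial>(M1 \<Otimes>\<^sub>M M2)) = (\<integral>y. f y * (\<integral>x. u (x, y) * g x \<partial>M1) \<partial>M2)"
    unfolding 1 3 by (rule integral_snd[OF int, symmetric])
  show "(\<integral>x. (\<integral>y. u (x, y) * f y \<partial>M2) * g x \<partial>M1) = (\<integral>y. f y * (\<integral>x. u (x, y) * g x \<partial>M1) \<partial>M2)"
    unfolding 2 3 by (rule Fubini_integral[OF int, symmetric])
  show "integrable M1 (\<lambda>x. (\<integral>y. u (x, y) * f y \<partial>M2) * g x)"
    unfolding 2 by (rule integrable_fst[OF int])
qed

lemma AE_pair_snd:
  assumes "pair_sigma_finite M1 M2" and "AE y in M2. Q y"
  shows "AE z in M1 \<Otimes>\<^sub>M M2. Q (snd z)"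
proof -
  interpret pair_sigma_finite M1 M2 by fact
  obtain N where N: "{y \<in> space M2. \<not> Q y} \<subseteq> N" "N \<in> sets M2" "emeasure M2 N = 0"
    using AE_E[OF assms(2)] by auto
  have "space M1 \<times> N \<in> null_sets (M1 \<Otimes>\<^sub>M M2)"
    using N by (intro null_setsI) (auto simp: M2.emeasure_pair_measure_Times)
  then show ?thesis by (rule AE_I') (use N in \<open>auto simp: space_pair_measure\<close>)
qed

section \<open>Tensor powers, elementary tensors and contractions\<close>

lemma finite_measure_leb: assumes "compact S" shows "finite_measure (leb S)"
proof (rule finite_measureI)
  have "emeasure (leb S) (space (leb S)) = emeasure lborel S"
    using assms by (simp add: leb_def emeasure_restrict_space space_restrict_space compact_imp_closed borel_closed)
  also have "\<dots> \<noteq> \<infinity>" using emeasure_compact_finite[OF assms] by simp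
  finally show "emeasure (leb S) (space (leb S)) \<noteq> \<infinity>" .
qed

lemma sigma_finite_leb: "compact S \<Longrightarrow> sigma_finite_measure (leb S)"
  by (simp add: finite_measure_leb finite_measure.axioms(1))

lemma sigma_finite_cube: assumes "compact S" shows "sigma_finite_measure (cube S l)"
proof -
  interpret product_sigma_finite "\<lambda>_::nat. leb S"
    using sigma_finite_leb[OF assms] by (simp add: product_sigma_finite_def)
  show ?thesis unfolding cube_def by (rule sigma_finite) simp
qed

lemma pair_leb_cube: "\<lbrakk>compact S1; compact S2\<rbrakk> \<Longrightarrow> pair_sigma_finite (leb S2) (cube S1 l)"
  by (simp add: pair_sigma_finite_def sigma_finite_leb sigma_finite_cube)

text \<open>\<open>chi\<close> as a function of the path alone, so that the same formula serves the
  process and the sampled covariates.\<close>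

definition tens :: "(real \<Rightarrow> real) \<Rightarrow> (nat \<Rightarrow> real) l2fam" where
  "tens x l s = (\<Prod>i=1..l. x (s i))"

lemma chi_eq: "chi X \<omega> = tens (X \<omega>)"
  by (simp add: chi_def tens_def fun_eq_iff)

lemma tens_measurable:
  assumes [measurable]: "x \<in> borel_measurable (leb S)" shows "tens x l \<in> borel_measurable (cube S l)"
  unfolding tens_def[abs_def] cube_def by measurable

lemma tens_inner:
  assumes "compact S" and x: "x \<in> L2 (leb S)" and y: "y \<in> L2 (leb S)"
  shows "L2_inner (cube S l) (tens x l) (tens y l) = L2_inner (leb S) x y ^ l"
    and "integrable (cube S l) (\<lambda>s. tens x l s * tens y l s)"
proof -
  interpret product_sigma_finite "\<lambda>_::nat. leb S"
    using sigma_finite_leb[OF assms(1)] by (simp add: product_sigma_finite_def)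
  have eq: "(\<lambda>s. tens x l s * tens y l s) = (\<lambda>s. \<Prod>i=1..l. x (s i) * y (s i))"
    by (simp add: tens_def prod.distrib fun_eq_iff)
  show "integrable (cube S l) (\<lambda>s. tens x l s * tens y l s)"
    unfolding eq cube_def using L2_integrable_mult[OF x y] by (intro product_integrable_prod) auto
  show "L2_inner (cube S l) (tens x l) (tens y l) = L2_inner (leb S) x y ^ l"
    unfolding L2_inner_def eq cube_def using L2_integrable_mult[OF x y] by (subst product_integral_prod) auto
qed

lemma tens_L2: assumes "compact S" "x \<in> L2 (leb S)" shows "tens x l \<in> L2 (cube S l)"
  using tens_inner(2)[OF assms assms(2), of l] tens_measurable[OF L2_measurable[OF assms(2)]]
  by (simp add: L2_def power2_eq_square)

lemma tens_L2_sum: "\<lbrakk>compact S; x \<in> L2 (leb S)\<rbrakk> \<Longrightarrow> tens x \<in> L2_sum p (cube S)"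
  by (simp add: L2_sum_def tens_L2)

lemma integral_cube_0: "(\<integral>s. f s \<partial>cube S 0) = (f (\<lambda>_. undefined) :: real)"
  by (simp add: cube_def PiM_empty lebesgue_integral_count_space_finite)

text \<open>The intercept is the term \<open>l = 0\<close>: the cube is then a single point of mass
  1, and the product is empty.\<close>

lemma poly_reg_eq: "poly_reg p S u x t = (\<Sum>l\<le>p. \<integral>s. u l (t, s) * tens x l s \<partial>cube S l)"
proof -
  have "{..p} = insert 0 {1..p}" by auto
  then show ?thesis by (simp add: poly_reg_def integral_cube_0 tens_def)
qed

text \<open>The elementary tensors \<open>g \<otimes> f\<close> of \<open>L\<^sup>2(S\<^sub>2) \<otimes> (\<Oplus>\<^sub>l L\<^sup>2(S\<^sub>1\<^sup>l))\<close>.\<close>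

definition etens :: "(real \<Rightarrow> real) \<Rightarrow> (nat \<Rightarrow> real) l2fam \<Rightarrow> (real \<times> (nat \<Rightarrow> real)) l2fam" where
  "etens g f l = (\<lambda>(t, s). g t * f l s)"

lemma etens_in:
  assumes "compact S1" "compact S2" "g \<in> L2 (leb S2)" "f \<in> L2_sum p (cube S1)"
  shows "etens g f \<in> LL2 p S1 S2"
  using assms by (auto simp: L2_sum_def etens_def coef_def intro!: L2_tensor pair_leb_cube)

text \<open>The adjoint of \<open>f \<mapsto> etens g f\<close>, as \<open>inner_etens\<close>
  confirms.\<close>

definition contract :: "real set \<Rightarrow> (real \<Rightarrow> real) \<Rightarrow> (real \<times> (nat \<Rightarrow> real)) l2fam \<Rightarrow> (nat \<Rightarrow> real) l2fam" where
  "contract S2 g u l s = (\<integral>t. u l (t, s) * g t \<partial>leb S2)"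

lemma contract_in:
  assumes "compact S1" "compact S2" "g \<in> L2 (leb S2)" "u \<in> LL2 p S1 S2"
  shows "contract S2 g u \<in> L2_sum p (cube S1)"
  using assms by (auto simp: L2_sum_def coef_def contract_def[abs_def] intro!: L2_partial_integral pair_leb_cube)

lemma inner_etens:
  assumes "compact S1" "compact S2" "g \<in> L2 (leb S2)" "f \<in> L2_sum p (cube S1)" "u \<in> LL2 p S1 S2"
  shows "L2_sum_inner p (coef S1 S2) u (etens g f) = L2_sum_inner p (cube S1) f (contract S2 g u)"
  unfolding L2_sum_inner_def
proof (intro sum.cong refl)
  fix l assume "l \<in> {..p}"
  then have "u l \<in> L2 (leb S2 \<Otimes>\<^sub>M cube S1 l)" "f l \<in> L2 (cube S1 l)" using assms by (auto simp: L2_sum_def coef_def)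
  from L2_integral_tensor(1)[OF pair_leb_cube[OF assms(1,2)] this(1) assms(3) this(2)]
  show "L2_inner (coef S1 S2 l) (u l) (etens g f l) = L2_inner (cube S1 l) (f l) (contract S2 g u l)"
    by (simp add: L2_inner_def etens_def coef_def contract_def)
qed

lemma contract_etens: "contract S2 g (etens g' f) l s = L2_inner (leb S2) g g' * f l s"
  by (simp add: contract_def etens_def L2_inner_def mult.assoc mult.commute[of _ "g _"] mult.left_commute[of _ "f l s"]
      flip: integral_mult_left_zero)

lemma inner_etens_etens:
  assumes "compact S1" "compact S2" "g \<in> L2 (leb S2)" "g' \<in> L2 (leb S2)" "f \<in> L2_sum p (cube S1)"
  shows "L2_sum_inner p (coef S1 S2) (etens g f) (etens g' f) =
    L2_inner (leb S2) g g' * L2_sum_inner p (cube S1) f f"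
proof -
  have "L2_sum_inner p (coef S1 S2) (etens g f) (etens g' f) = L2_sum_inner p (cube S1) f (contract S2 g' (etens g f))"
    using assms by (intro inner_etens etens_in) auto
  also have "\<dots> = L2_inner (leb S2) g g' * L2_sum_inner p (cube S1) f f"
    by (simp add: L2_sum_inner_def L2_inner_def contract_etens[unfolded L2_inner_def] sum_distrib_left
      mult.left_commute[of "f _ _"] mult.commute[of "g' _"])
  finally show ?thesis .
qed

text \<open>An elementary tensor separates the output from the covariate: the path enters only
  through a scalar that does not involve \<open>g\<close>. This is why signals with different
  \<open>g\<close> are equally hard to detect.\<close>

lemma poly_reg_etens: "poly_reg p S1 (etens g f) x t = g t * L2_sum_inner p (cube S1) (tens x) f"
  by (simp add: poly_reg_eq etens_def L2_sum_inner_def L2_inner_def sum_distrib_left mult.assoc mult.commute[of "f _ _"])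

text \<open>Integrating \<open>t\<close> out first leaves a pairing over powers of \<open>S1\<close>
  alone, the form in which \<open>\<Gamma>\<close> is given.\<close>

lemma poly_reg_contract:
  assumes "compact S1" "compact S2" and g: "g \<in> L2 (leb S2)" and u: "u \<in> LL2 p S1 S2" and x: "x \<in> L2 (leb S1)"
  shows "(\<integral>t. poly_reg p S1 u x t * g t \<partial>leb S2) = L2_sum_inner p (cube S1) (tens x) (contract S2 g u)"
proof -
  have ul: "u l \<in> L2 (leb S2 \<Otimes>\<^sub>M cube S1 l)" if "l \<le> p" for l using u that by (auto simp: L2_sum_def coef_def)
  note T = L2_integral_tensor(2,3)[OF pair_leb_cube[OF assms(1,2)] ul g tens_L2[OF assms(1) x]]
  show ?thesis
    unfolding poly_reg_eq sum_distrib_right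
    by (subst Bochner_Integration.integral_sum) (auto simp: T L2_sum_inner_def L2_inner_def contract_def)
qed

section \<open>Measurability on pseudo-metric spaces\<close>

lemma borel_dist_subset: "{U. U \<subseteq> H \<and> (\<forall>u\<in>U. \<exists>r>0. \<forall>v\<in>H. d u v < r \<longrightarrow> v \<in> U)} \<subseteq> Pow H"
  by auto

lemma space_borel_dist [simp]: "space (borel_dist H d) = H"
  unfolding borel_dist_def by (rule space_measure_of[OF borel_dist_subset])

lemma borel_dist_measurableI:
  fixes F :: "'a \<Rightarrow> real"
  assumes "\<And>x e. x \<in> H \<Longrightarrow> e > 0 \<Longrightarrow> \<exists>r>0. \<forall>y\<in>H. d x y < r \<longrightarrow> \<bar>F x - F y\<bar> < e"
  shows "F \<in> borel_measurable (borel_dist H d)"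
proof (rule borel_measurableI)
  fix S :: "real set" assume S: "open S"
  have "F -` S \<inter> H \<in> {U. U \<subseteq> H \<and> (\<forall>u\<in>U. \<exists>r>0. \<forall>v\<in>H. d u v < r \<longrightarrow> v \<in> U)}"
  proof (intro CollectI conjI ballI)
    fix x assume x: "x \<in> F -` S \<inter> H"
    then obtain e where e: "e > 0" "\<And>z. dist z (F x) < e \<Longrightarrow> z \<in> S" using S by (auto simp: open_dist)
    obtain r where "r > 0" "\<forall>y\<in>H. d x y < r \<longrightarrow> \<bar>F x - F y\<bar> < e" using assms[of x e] x e by auto
    then show "\<exists>r>0. \<forall>y\<in>H. d x y < r \<longrightarrow> y \<in> F -` S \<inter> H"
      using e(2) by (intro exI[of _ r]) (auto simp: dist_real_def abs_minus_commute)
  qed auto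
  then show "F -` S \<inter> space (borel_dist H d) \<in> sets (borel_dist H d)"
    unfolding space_borel_dist unfolding borel_dist_def sets_measure_of[OF borel_dist_subset]
    by (rule sigma_sets.Basic)
qed

text \<open>\<open>\<parallel>x\<^sup>\<otimes>\<^sup>l - y\<^sup>\<otimes>\<^sup>l\<parallel>\<^sup>2 = \<langle>x, x\<rangle>\<^sup>l - 2 \<langle>x, y\<rangle>\<^sup>l + \<langle>y, y\<rangle>\<^sup>l\<close> makes \<open>x \<mapsto> x\<^sup>\<otimes>\<^sup>l\<close> continuous.\<close>

lemma tens_inner_measurable:
  assumes S: "compact S" and f: "f \<in> L2_sum p (cube S)"
  shows "(\<lambda>x. L2_sum_inner p (cube S) (tens x) f) \<in> borel_measurable (path_space S)"
proof (rule borel_dist_measurableI, rule ccontr)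
  let ?N = "L2_sum_norm p (cube S)"
  fix x and e :: real assume x: "x \<in> L2 (leb S)" and e: "e > 0"
  assume "\<not> (\<exists>r>0. \<forall>y\<in>L2 (leb S). L2_dist (leb S) x y < r \<longrightarrow>
    \<bar>L2_sum_inner p (cube S) (tens x) f - L2_sum_inner p (cube S) (tens y) f\<bar> < e)"
  then have "\<exists>y\<in>L2 (leb S). L2_dist (leb S) x y < r \<and>
    \<bar>L2_sum_inner p (cube S) (tens x) f - L2_sum_inner p (cube S) (tens y) f\<bar> \<ge> e" if "r > 0" for r
    using that by (meson not_le)
  then have "\<exists>y. y \<in> L2 (leb S) \<and> L2_dist (leb S) x y < inverse (Suc n) \<and>
    \<bar>L2_sum_inner p (cube S) (tens x) f - L2_sum_inner p (cube S) (tens y) f\<bar> \<ge> e" for n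
    by (metis inverse_positive_iff_positive of_nat_0_less_iff zero_less_Suc)
  then obtain y where y: "\<And>n. y n \<in> L2 (leb S)" "\<And>n. L2_dist (leb S) x (y n) < inverse (Suc n)"
    "\<And>n. \<bar>L2_sum_inner p (cube S) (tens x) f - L2_sum_inner p (cube S) (tens (y n)) f\<bar> \<ge> e" by metis
  let ?i = "L2_inner (leb S)"
  define d where "d n = (\<lambda>t. x t - y n t)" for n
  have d: "d n \<in> L2 (leb S)" for n unfolding d_def by (rule L2_diff[OF x y(1)])
  have dn: "(\<lambda>n. L2_norm (leb S) (d n)) \<longlonglongrightarrow> 0"
  proof (rule Lim_null_comparison[OF _ LIMSEQ_inverse_real_of_nat], intro always_eventually allI)
    show "norm (L2_norm (leb S) (d n)) \<le> inverse (Suc n)" for n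
      using y(2)[of n] by (simp add: L2_dist_def d_def del: of_nat_Suc)
  qed
  have xd: "(\<lambda>n. ?i x (d n)) \<longlonglongrightarrow> 0"
  proof (rule Lim_null_comparison)
    show "\<forall>\<^sub>F n in sequentially. norm (?i x (d n)) \<le> L2_norm (leb S) x * L2_norm (leb S) (d n)"
      using L2_Cauchy_Schwarz[OF x d] by simp
    show "(\<lambda>n. L2_norm (leb S) x * L2_norm (leb S) (d n)) \<longlonglongrightarrow> 0"
      using tendsto_mult_left[OF dn] by simp
  qed
  have dd: "(\<lambda>n. ?i (d n) (d n)) \<longlonglongrightarrow> 0"
    using tendsto_power[OF dn, of 2] by (simp add: L2_norm_sq)
  \<comment> \<open>Writing \<open>y n\<close> as \<open>x\<close> minus \<open>d n\<close> leaves
    only inner products that involve \<open>d n\<close>, and these tend to 0.\<close>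
  have e1: "?i x (y n) = ?i x x - ?i x (d n)" for n
  proof -
    have "?i x (d n) = (\<integral>t. x t * x t - x t * y n t \<partial>leb S)"
      by (simp add: L2_inner_def d_def algebra_simps)
    also have "\<dots> = ?i x x - ?i x (y n)"
      unfolding L2_inner_def by (intro Bochner_Integration.integral_diff L2_integrable_mult x y)
    finally show ?thesis by simp
  qed
  have e2: "?i (y n) (y n) = ?i x x - 2 * ?i x (d n) + ?i (d n) (d n)" for n
  proof -
    have "?i (y n) (y n) = (\<integral>t. x t * x t - 2 * (x t * d n t) + d n t * d n t \<partial>leb S)"
      by (simp add: L2_inner_def d_def algebra_simps)
    also have "\<dots> = ?i x x - 2 * ?i x (d n) + ?i (d n) (d n)"
      unfolding L2_inner_def using L2_integrable_mult[OF x x] L2_integrable_mult[OF x d] L2_integrable_mult[OF d d]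
      by simp
    finally show ?thesis .
  qed
  have "(\<lambda>n. ?i x (y n)) \<longlonglongrightarrow> ?i x x - 0" "(\<lambda>n. ?i (y n) (y n)) \<longlonglongrightarrow> ?i x x - 2 * 0 + 0"
    unfolding e1 e2 by (intro tendsto_intros xd dd)+
  then have lim: "(\<lambda>n. ?i x (y n)) \<longlonglongrightarrow> ?i x x" "(\<lambda>n. ?i (y n) (y n)) \<longlonglongrightarrow> ?i x x" by simp_all
  have T: "tens x \<in> L2_sum p (cube S)" "tens (y n) \<in> L2_sum p (cube S)" for n
    using tens_L2_sum S x y by auto
  have sum_pow: "L2_sum_inner p (cube S) (tens u) (tens v) = (\<Sum>l\<le>p. ?i u v ^ l)"
    if "u \<in> L2 (leb S)" "v \<in> L2 (leb S)" for u v
    unfolding L2_sum_inner_def using tens_inner(1)[OF S that] by simp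
  have "(?N (tens x - tens (y n)))\<^sup>2 = (\<Sum>l\<le>p. ?i x x ^ l) - 2 * (\<Sum>l\<le>p. ?i x (y n) ^ l) + (\<Sum>l\<le>p. ?i (y n) (y n) ^ l)" for n
  proof -
    have "(?N (tens x - tens (y n)))\<^sup>2 = L2_sum_inner p (cube S) (tens x - tens (y n)) (tens x - tens (y n))"
      using LS.nrm_sq[of "tens x - tens (y n)"] T by (simp add: LS_nrm)
    then show ?thesis
      using T LS.ip_sym[OF T(2) T(1), of n] sum_pow[OF x x] sum_pow[OF x y(1)] sum_pow[OF y(1) y(1)]
      by (simp add: LS.ip_simps)
  qed
  moreover have "(\<lambda>n. (\<Sum>l\<le>p. ?i x x ^ l) - 2 * (\<Sum>l\<le>p. ?i x (y n) ^ l) + (\<Sum>l\<le>p. ?i (y n) (y n) ^ l))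
      \<longlonglongrightarrow> (\<Sum>l\<le>p. ?i x x ^ l) - 2 * (\<Sum>l\<le>p. ?i x x ^ l) + (\<Sum>l\<le>p. ?i x x ^ l)"
    by (intro tendsto_intros lim)
  ultimately have "(\<lambda>n. (?N (tens x - tens (y n)))\<^sup>2) \<longlonglongrightarrow> 0" by simp
  then have "(\<lambda>n. sqrt ((?N (tens x - tens (y n)))\<^sup>2)) \<longlonglongrightarrow> sqrt 0" by (rule tendsto_real_sqrt)
  then have "(\<lambda>n. ?N (tens x - tens (y n))) \<longlonglongrightarrow> 0"
    using LS.nrm_nonneg[of "tens x - tens (y _)" p "cube S"] T by (simp add: LS_nrm)
  then have "(\<lambda>n. ?N (tens x - tens (y n)) * ?N f) \<longlonglongrightarrow> 0 * ?N f" by (rule tendsto_mult_right)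
  moreover have "e \<le> ?N (tens x - tens (y n)) * ?N f" for n
    using y(3)[of n] LS.Cauchy_Schwarz[of "tens x - tens (y n)" p "cube S" f] T f by (simp add: LS.ip_simps LS_nrm)
  ultimately have "e \<le> 0 * ?N f" by (meson LIMSEQ_le_const)
  then show False using e by simp
qed

section \<open>The operator \<open>A\<^sup>* A\<close> and its eigenvectors\<close>

locale regression_operator = prob_space P for P :: "'w measure" +
  fixes S1 S2 :: "real set" and p :: nat and X :: "'w \<Rightarrow> real \<Rightarrow> real"
  assumes S1: "compact S1" and S2: "compact S2"
    and X_paths: "X \<in> P \<rightarrow>\<^sub>M path_space S1"
    and A_in: "\<And>u. u \<in> LL2 p S1 S2 \<Longrightarrow> A_op p S1 X u \<in> L2 (P \<Otimes>\<^sub>M leb S2)"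
    and A_bdd: "\<exists>C. \<forall>u\<in>LL2 p S1 S2. L2_norm (P \<Otimes>\<^sub>M leb S2) (A_op p S1 X u) \<le> C * norm_LL2 p S1 S2 u"
begin

abbreviation "H \<equiv> LL2 p S1 S2"
abbreviation "ip \<equiv> L2_sum_inner p (coef S1 S2)"
abbreviation "A \<equiv> A_op p S1 X"
abbreviation "T \<equiv> AA_op p S1 S2 P X"
abbreviation "PS \<equiv> P \<Otimes>\<^sub>M leb S2"

lemma X_in: "\<omega> \<in> space P \<Longrightarrow> X \<omega> \<in> L2 (leb S1)"
  using measurable_space[OF X_paths] by simp

lemma pair_PS: "pair_sigma_finite P (leb S2)"
  by (simp add: pair_sigma_finite_def sigma_finite_leb[OF S2] sigma_finite_measure_axioms)

text \<open>At exceptional \<open>t\<close> a section of \<open>u l\<close> or \<open>v l\<close>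
  may fail to be square integrable, and its integral may take the default value 0; additivity can
  break there. Such \<open>t\<close> form a null set.\<close>

lemma A_add:
  assumes u: "u \<in> H" and v: "v \<in> H"
  shows "AE z in PS. A (u + v) z = A u z + A v z"
proof -
  have sec: "AE t in leb S2. \<forall>l\<in>{..p}. (\<lambda>s. w l (t, s)) \<in> L2 (cube S1 l)" if "w \<in> H" for w
  proof (intro eventually_ball_finite ballI)
    fix l assume "l \<in> {..p}"
    then have "w l \<in> L2 (leb S2 \<Otimes>\<^sub>M cube S1 l)" using that by (auto simp: L2_sum_def coef_def)
    then show "AE t in leb S2. (\<lambda>s. w l (t, s)) \<in> L2 (cube S1 l)"
      by (rule L2_section[OF pair_leb_cube[OF S1 S2]])
  qed simp
  have "AE z in PS. z \<in> space PS" by simp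
  with AE_pair_snd[OF pair_PS sec[OF u]] AE_pair_snd[OF pair_PS sec[OF v]] show ?thesis
  proof eventually_elim
    case (elim z)
    then have x: "X (fst z) \<in> L2 (leb S1)" by (auto simp: space_pair_measure intro: X_in)
    have "(\<integral>s. (u + v) l (snd z, s) * tens (X (fst z)) l s \<partial>cube S1 l) =
       (\<integral>s. u l (snd z, s) * tens (X (fst z)) l s \<partial>cube S1 l) + (\<integral>s. v l (snd z, s) * tens (X (fst z)) l s \<partial>cube S1 l)"
      if "l \<le> p" for l
      using elim that by (simp add: distrib_right L2_integrable_mult tens_L2[OF S1 x])
    then show ?case
      by (simp add: A_op_def poly_reg_eq case_prod_beta' sum.distrib)
  qed
qed

lemma A_scale: "A (c *\<^sub>R u) z = c * A u z"
  by (simp add: A_op_def poly_reg_eq case_prod_beta' sum_distrib_left mult.assoc)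

text \<open>The Hilbert choice in \<open>adjoint_op\<close> has a witness: the inner product of
  \<open>A v\<close> with \<open>A u\<close> is a bounded linear functional of \<open>v\<close>,
  which Riesz represents. The null sets of \<open>A_add\<close> vanish under the integral.\<close>

lemma T_spec:
  assumes u: "u \<in> H"
  shows "T u \<in> H \<and> (\<forall>v\<in>H. ip v (T u) = L2_inner PS (A v) (A u))"
proof -
  define F where "F v = L2_inner PS (A v) (A u)" for v
  obtain C where C: "\<And>v. v \<in> H \<Longrightarrow> L2_norm PS (A v) \<le> C * norm_LL2 p S1 S2 v" using A_bdd by blast
  have "\<exists>w\<in>H. \<forall>v\<in>H. ip v w = F v"
  proof (rule LS.Riesz_representation)
    fix v w assume vw: "v \<in> H" "w \<in> H"
    have "F (v + w) = (\<integral>z. A v z * A u z + A w z * A u z \<partial>PS)"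
      unfolding F_def L2_inner_def
    proof (rule integral_cong_AE)
      show "AE z in PS. A (v + w) z * A u z = A v z * A u z + A w z * A u z"
        using A_add[OF vw] by eventually_elim (simp add: distrib_right)
    qed (use L2_measurable[OF A_in] u vw in \<open>auto intro!: borel_measurable_times borel_measurable_add\<close>)
    then show "F (v + w) = F v + F w"
      unfolding F_def L2_inner_def using vw u by (simp add: L2_integrable_mult A_in)
  next
    show "F (c *\<^sub>R v) = c * F v" for v c
      by (simp add: F_def L2_inner_def A_scale mult.assoc)
  next
    fix v assume v: "v \<in> H"
    have "\<bar>F v\<bar> \<le> L2_norm PS (A v) * L2_norm PS (A u)"
      unfolding F_def by (intro L2_Cauchy_Schwarz A_in u v)
    also have "\<dots> \<le> C * norm_LL2 p S1 S2 v * L2_norm PS (A u)"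
      by (intro mult_right_mono C v) simp
    finally show "\<bar>F v\<bar> \<le> C * L2_norm PS (A u) * LS.nrm p (coef S1 S2) v"
      by (simp add: LS_nrm mult_ac)
  qed
  then have "\<exists>w. w \<in> H \<and> (\<forall>v\<in>H. ip v w = L2_inner PS (A v) (A u))"
    unfolding F_def by blast
  from someI_ex[OF this] show ?thesis
    unfolding AA_op_def adjoint_op_def by simp
qed

lemma T_in: "u \<in> H \<Longrightarrow> T u \<in> H"
  and ip_T: "u \<in> H \<Longrightarrow> v \<in> H \<Longrightarrow> ip v (T u) = L2_inner PS (A v) (A u)"
  using T_spec by auto

lemma T_sym: "u \<in> H \<Longrightarrow> v \<in> H \<Longrightarrow> ip (T u) v = ip u (T v)"
  by (metis ip_T LS.ip_sym T_in L2_inner_commute)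

lemma T_bdd: "\<exists>C. \<forall>u\<in>H. LS.nrm p (coef S1 S2) (T u) \<le> C * LS.nrm p (coef S1 S2) u"
proof -
  let ?n = "LS.nrm p (coef S1 S2)"
  obtain C where C: "\<And>v. v \<in> H \<Longrightarrow> L2_norm PS (A v) \<le> C * ?n v" using A_bdd by (auto simp: LS_nrm)
  have "?n (T u) \<le> C\<^sup>2 * ?n u" if u: "u \<in> H" for u
  proof (cases "?n (T u) = 0")
    case True
    then show ?thesis using LS.nrm_nonneg[OF u] by simp
  next
    case False
    then have pos: "?n (T u) > 0" using LS.nrm_nonneg[OF T_in[OF u]] by linarith
    have "(?n (T u))\<^sup>2 = L2_inner PS (A (T u)) (A u)"
      using ip_T[OF u T_in[OF u]] LS.nrm_sq[OF T_in[OF u]] by simp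
    also have "\<dots> \<le> L2_norm PS (A (T u)) * L2_norm PS (A u)"
      using L2_Cauchy_Schwarz[OF A_in[OF T_in[OF u]] A_in[OF u]] by simp
    also have "\<dots> \<le> (C * ?n (T u)) * (C * ?n u)"
      using C[OF T_in[OF u]] C[OF u] by (intro mult_mono) (auto intro: order_trans[OF L2_norm_nonneg])
    finally have "?n (T u) * ?n (T u) \<le> ?n (T u) * (C\<^sup>2 * ?n u)"
      by (simp add: power2_eq_square mult_ac)
    then show ?thesis using pos by simp
  qed
  then show ?thesis by blast
qed

lemma A_etens: "A (etens g f) (\<omega>, t) = g t * L2_sum_inner p (cube S1) (tens (X \<omega>)) f"
  by (simp add: A_op_def poly_reg_etens)

text \<open>Tested against any \<open>u\<close>, Fubini integrates \<open>t\<close> out first and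
  contracts \<open>u\<close> with \<open>g\<close>. What remains is the expectation of two pairings
  with \<open>chi\<close>, that is, the inner product of \<open>w\<close> with the
  contraction.\<close>

lemma T_etens_eigen:
  assumes g: "g \<in> L2 (leb S2)" and f: "f \<in> L2_sum p (cube S1)"
    and w: "is_Gamma p S1 P X f w"
    and eig: "L2_sum_norm p (cube S1) (w - c *\<^sub>R f) = 0"
  shows "LS.nrm p (coef S1 S2) (T (etens g f) - c *\<^sub>R etens g f) = 0"
proof -
  have gf: "etens g f \<in> H" by (rule etens_in[OF S1 S2 g f])
  interpret PP: pair_sigma_finite P "leb S2" by (rule pair_PS)
  have wH: "w \<in> L2_sum p (cube S1)" using w by (simp add: is_Gamma_def)
  show ?thesis
  proof (rule LS.nrm_diff_zeroI)
    fix u assume u: "u \<in> H"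
    let ?k = "contract S2 g u"
    have k: "?k \<in> L2_sum p (cube S1)" by (rule contract_in[OF S1 S2 g u])
    have int: "integrable PS (\<lambda>(\<omega>, t). A u (\<omega>, t) * A (etens g f) (\<omega>, t))"
      using L2_integrable_mult[OF A_in[OF u] A_in[OF gf]] by (simp add: case_prod_beta')
    have "ip (T (etens g f)) u = L2_inner PS (A u) (A (etens g f))"
      using ip_T[OF gf u] LS.ip_sym[OF u T_in[OF gf]] by simp
    also have "\<dots> = (\<integral>\<omega>. \<integral>t. A u (\<omega>, t) * A (etens g f) (\<omega>, t) \<partial>leb S2 \<partial>P)"
      unfolding L2_inner_def using PP.integral_fst'[OF int] by (simp add: case_prod_beta')
    also have "\<dots> = (\<integral>\<omega>. L2_sum_inner p (cube S1) (chi X \<omega>) f * L2_sum_inner p (cube S1) (chi X \<omega>) ?k \<partial>P)"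
    proof (rule Bochner_Integration.integral_cong[OF refl])
      fix \<omega> assume \<omega>: "\<omega> \<in> space P"
      have "(\<integral>t. A u (\<omega>, t) * A (etens g f) (\<omega>, t) \<partial>leb S2) =
          (\<integral>t. L2_sum_inner p (cube S1) (tens (X \<omega>)) f * (poly_reg p S1 u (X \<omega>) t * g t) \<partial>leb S2)"
      proof (intro Bochner_Integration.integral_cong refl)
        fix t
        have "A u (\<omega>, t) = poly_reg p S1 u (X \<omega>) t" by (simp add: A_op_def)
        then show "A u (\<omega>, t) * A (etens g f) (\<omega>, t) =
            L2_sum_inner p (cube S1) (tens (X \<omega>)) f * (poly_reg p S1 u (X \<omega>) t * g t)"
          by (simp add: A_etens)
      qed
      also have "\<dots> = L2_sum_inner p (cube S1) (tens (X \<omega>)) f * L2_sum_inner p (cube S1) (tens (X \<omega>)) ?k"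
        using poly_reg_contract[OF S1 S2 g u X_in[OF \<omega>]] by simp
      finally show "(\<integral>t. A u (\<omega>, t) * A (etens g f) (\<omega>, t) \<partial>leb S2) =
        L2_sum_inner p (cube S1) (chi X \<omega>) f * L2_sum_inner p (cube S1) (chi X \<omega>) ?k"
        by (simp add: chi_eq)
    qed
    also have "\<dots> = L2_sum_inner p (cube S1) w ?k"
      using w k by (simp add: is_Gamma_def)
    also have "\<dots> = L2_sum_inner p (cube S1) (c *\<^sub>R f) ?k"
      by (rule LS.nrm_diff_zeroD) (use wH f k eig in \<open>auto simp: LS_nrm\<close>)
    also have "\<dots> = c * ip u (etens g f)"
      using f k by (simp add: LS.ip_simps inner_etens[OF S1 S2 g f u])
    also have "\<dots> = ip (c *\<^sub>R etens g f) u"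
      using gf u by (simp add: LS.ip_simps LS.ip_sym[OF u gf])
    finally show "ip (T (etens g f)) u = ip (c *\<^sub>R etens g f) u" .
  qed (use gf T_in in auto)
qed

text \<open>A bounded inverse of \<open>T - c\<close> would send the null vector
  \<open>T u - c u\<close> to a null vector, but also back to \<open>u\<close>.\<close>

lemma eigenvalue_in_spectrum:
  assumes u: "u \<in> H" and eig: "LS.nrm p (coef S1 S2) (T u - c *\<^sub>R u) = 0" and nz: "LS.nrm p (coef S1 S2) u \<noteq> 0"
  shows "c \<in> spectrum p (coef S1 S2) T"
proof (rule ccontr)
  let ?n = "LS.nrm p (coef S1 S2)"
  assume "c \<notin> spectrum p (coef S1 S2) T"
  then obtain S where S: "bounded_op p (coef S1 S2) S" "L2_sum_dist p (coef S1 S2) (S (\<lambda>l x. T u l x - c * u l x)) u = 0"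
    unfolding spectrum_def using u by blast
  have e: "(\<lambda>l x. T u l x - c * u l x) = T u - c *\<^sub>R u" by (simp add: fun_eq_iff)
  have in_H: "T u - c *\<^sub>R u \<in> H" using u T_in by simp
  obtain C where C: "?n (S (T u - c *\<^sub>R u)) \<le> C * ?n (T u - c *\<^sub>R u)" "S (T u - c *\<^sub>R u) \<in> H"
    using S(1) in_H unfolding bounded_op_def by (auto simp: LS_nrm)
  then have "?n (S (T u - c *\<^sub>R u)) \<le> 0" using eig by simp
  moreover have "?n (S (T u - c *\<^sub>R u) - u) = 0" using S(2) by (simp add: e L2_sum_dist_eq LS_nrm)
  ultimately have "?n u \<le> 0"
    using LS.nrm_diff_le[OF C(2) u] by linarith
  then show False using nz LS.nrm_nonneg[OF u] by linarith
qed

text \<open>If \<open>C\<close> bounds the inverse, then \<open>T - c\<close> is bounded below by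
  \<open>inverse (\<bar>C\<bar> + 1)\<close>, which is positive for every real
  \<open>C\<close>.\<close>

lemma below_off_spectrum:
  assumes "c \<notin> spectrum p (coef S1 S2) T"
  shows "\<exists>k>0. \<forall>u\<in>H. k * LS.nrm p (coef S1 S2) u \<le> LS.nrm p (coef S1 S2) (T u - c *\<^sub>R u)"
proof -
  let ?n = "LS.nrm p (coef S1 S2)"
  obtain S where S: "bounded_op p (coef S1 S2) S" "\<And>u. u \<in> H \<Longrightarrow> L2_sum_dist p (coef S1 S2) (S (\<lambda>l x. T u l x - c * u l x)) u = 0"
    using assms unfolding spectrum_def by blast
  have e: "(\<lambda>l x. T u l x - c * u l x) = T u - c *\<^sub>R u" for u by (simp add: fun_eq_iff)
  obtain C where "\<forall>u\<in>H. norm_LL2 p S1 S2 (S u) \<le> C * norm_LL2 p S1 S2 u"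
    using S(1) unfolding bounded_op_def by blast
  then have C: "\<And>u. u \<in> H \<Longrightarrow> S u \<in> H" "\<And>u. u \<in> H \<Longrightarrow> ?n (S u) \<le> C * ?n u"
    using S(1) unfolding bounded_op_def by (auto simp: LS_nrm)
  have "inverse (\<bar>C\<bar> + 1) * ?n u \<le> ?n (T u - c *\<^sub>R u)" if u: "u \<in> H" for u
  proof -
    let ?w = "T u - c *\<^sub>R u"
    have w: "?w \<in> H" using u T_in by simp
    have "?n (S ?w - u) = 0" using S(2)[OF u] by (simp add: e L2_sum_dist_eq LS_nrm)
    then have "?n u \<le> ?n (S ?w)" using LS.nrm_diff_le[OF C(1)[OF w] u] by linarith
    also have "\<dots> \<le> C * ?n ?w" by (rule C(2)[OF w])
    also have "\<dots> \<le> (\<bar>C\<bar> + 1) * ?n ?w" using LS.nrm_nonneg[OF w] by (intro mult_right_mono) auto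
    finally show ?thesis by (simp add: field_simps)
  qed
  then show ?thesis by (intro exI[of _ "inverse (\<bar>C\<bar> + 1)"]) auto
qed

lemma symmetric_op_T:
  assumes "spectrum p (coef S1 S2) T \<noteq> {}" "spectrum p (coef S1 S2) T \<subseteq> {0..\<eta>}"
  shows "symmetric_op H ip T (spectrum p (coef S1 S2) T) \<eta>"
  using assms T_in T_sym T_bdd below_off_spectrum
  by unfold_locales auto

end

section \<open>Characteristic functions on product spaces\<close>

lemma integrable_times_iexp:
  assumes "finite_measure M" and P: "P \<in> borel_measurable M" "\<And>x. \<bar>P x\<bar> \<le> c"
    and X: "X \<in> borel_measurable M"
  shows "integrable M (\<lambda>x. complex_of_real (P x) * iexp (X x))"
proof -
  interpret finite_measure M by fact
  have [measurable]: "P \<in> borel_measurable M" "X \<in> borel_measurable M" by fact+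
  show ?thesis
  proof (rule integrable_const_bound[of _ c])
    show "AE x in M. norm (complex_of_real (P x) * iexp (X x)) \<le> c"
      using P(2) by (auto simp: norm_mult)
  qed measurable
qed

text \<open>Levy uniqueness concerns probability distributions. The characteristic function at 0 is
  the total mass, so both measures can be divided by the same mass unless it is 0.\<close>

lemma finite_measure_eqI_char:
  fixes M1 M2 :: "real measure"
  assumes "finite_measure M1" "finite_measure M2" and [simp, measurable_cong]: "sets M1 = sets borel" "sets M2 = sets borel"
    and char: "\<And>t. char M1 t = char M2 t"
  shows "M1 = M2"
proof -
  interpret M1: finite_measure M1 by fact
  interpret M2: finite_measure M2 by fact
  have sp [simp]: "space M1 = UNIV" "space M2 = UNIV"
    using sets_eq_imp_space_eq[of M1 borel] sets_eq_imp_space_eq[of M2 borel] by simp_all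
  have "char M1 0 = of_real (measure M1 UNIV)" "char M2 0 = of_real (measure M2 UNIV)"
    by (simp_all add: char_def scaleR_conv_of_real)
  then have eq: "measure M1 UNIV = measure M2 UNIV" using char[of 0] by simp
  define m where "m = measure M1 UNIV"
  show ?thesis
  proof (cases "m = 0")
    case True
    have "emeasure M1 A = 0" "emeasure M2 A = 0" for A
      using emeasure_mono[of A UNIV M1] emeasure_mono[of A UNIV M2] True eq emeasure_notin_sets[of A]
      unfolding m_def by (auto simp: M1.emeasure_eq_measure M2.emeasure_eq_measure)
       (metis le_zero_eq measure_le_0_iff order.trans zero_less_measure_iff M1.bounded_measure M2.bounded_measure sp)+
    then show ?thesis by (intro measure_eqI) auto
  next
    case False
    then have m: "m > 0" unfolding m_def by (simp add: zero_less_measure_iff)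
    have N: "real_distribution (density M (\<lambda>_. ennreal (1 / m))) \<and>
        (\<forall>t. char (density M (\<lambda>_. ennreal (1 / m))) t = of_real (1 / m) * char M t)"
      if "finite_measure M" "sets M = sets borel" "measure M UNIV = m" for M :: "real measure"
    proof -
      interpret M: finite_measure M by fact
      have [simp, measurable_cong]: "sets M = sets borel" by fact
      have [simp]: "space M = UNIV" using sets_eq_imp_space_eq[OF that(2)] by simp
      have "emeasure (density M (\<lambda>_. ennreal (1 / m))) UNIV = 1"
        using that(3) m by (simp add: emeasure_density M.emeasure_eq_measure flip: ennreal_mult)
      then have "real_distribution (density M (\<lambda>_. ennreal (1 / m)))"
        by (auto simp: real_distribution_def real_distribution_axioms_def intro!: prob_spaceI)
      moreover have "char (density M (\<lambda>_. ennreal (1 / m))) t = of_real (1 / m) * char M t" for t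
        unfolding char_def using m by (subst integral_density) (auto simp: scaleR_conv_of_real)
      ultimately show ?thesis by blast
    qed
    have eqd: "density M1 (\<lambda>_. ennreal (1 / m)) = density M2 (\<lambda>_. ennreal (1 / m))"
      using N[of M1] N[of M2] assms(1,2) eq char by (intro Levy_uniqueness) (auto simp: m_def)
    have "ennreal (1 / m) * emeasure M1 A = ennreal (1 / m) * emeasure M2 A" if "A \<in> sets borel" for A
      using that eqd emeasure_density_const[of A M1 "ennreal (1 / m)"] emeasure_density_const[of A M2 "ennreal (1 / m)"]
      by simp
    then show ?thesis using m
      by (intro measure_eqI) (auto simp: ennreal_mult_cancel_left)
  qed
qed

text \<open>The weighted integrals are the characteristic function of the law of \<open>X\<close>
  under \<open>density M w\<close>, so the two pushforwards coincide.\<close>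

lemma weighted_char_unique:
  assumes fin: "finite_measure M1" "finite_measure M2" and sets: "sets M1 = sets M2"
    and w [measurable]: "w \<in> borel_measurable M1" and w_bdd: "\<And>x. 0 \<le> w x" "\<And>x. w x \<le> c"
    and X [measurable]: "X \<in> borel_measurable M1"
    and char: "\<And>s. (CLINT x|M1. of_real (w x) * iexp (s * X x)) = (CLINT x|M2. of_real (w x) * iexp (s * X x))"
    and B [measurable]: "B \<in> sets borel"
  shows "(\<integral>x. w x * indicator B (X x) \<partial>M1) = (\<integral>x. w x * indicator B (X x) \<partial>M2)"
proof -
  note sets [measurable_cong]
  have w2 [measurable]: "w \<in> borel_measurable M2" and X2 [measurable]: "X \<in> borel_measurable M2"
    using w X unfolding measurable_cong_sets[OF sets refl] by auto
  have N: "finite_measure (distr (density M w) borel X)"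
    "char (distr (density M w) borel X) s = (CLINT x|M. of_real (w x) * iexp (s * X x))"
    "measure (distr (density M w) borel X) B = (\<integral>x. w x * indicator B (X x) \<partial>M)"
    if "finite_measure M" and [measurable]: "w \<in> borel_measurable M" "X \<in> borel_measurable M" for M s
  proof -
    interpret finite_measure M by fact
    have int: "integrable M w" using w_bdd by (intro integrable_const_bound[of _ c]) auto
    then have "(\<integral>\<^sup>+x. w x \<partial>M) < \<infinity>" using w_bdd by (simp add: nn_integral_eq_integral)
    then have "emeasure (density M w) (space M) < \<infinity>"
      by (simp add: emeasure_density cong: nn_integral_cong)
    then have fd: "finite_measure (density M w)" by (intro finite_measureI) auto
    then show "finite_measure (distr (density M w) borel X)"
      by (rule finite_measure.finite_measure_distr) simp
    show "char (distr (density M w) borel X) s = (CLINT x|M. of_real (w x) * iexp (s * X x))"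
      unfolding char_def using w_bdd by (simp add: integral_distr integral_density scaleR_conv_of_real)
    have "measure (distr (density M w) borel X) B = (\<integral>x. indicator B x \<partial>distr (density M w) borel X)"
      by simp
    also have "\<dots> = (\<integral>x. w x * indicator B (X x) \<partial>M)"
      by (subst integral_distr) (use w_bdd in \<open>auto simp: integral_density\<close>)
    finally show "measure (distr (density M w) borel X) B = (\<integral>x. w x * indicator B (X x) \<partial>M)" .
  qed
  have "distr (density M1 w) borel X = distr (density M2 w) borel X"
    using N(1,2)[OF fin(1)] N(1,2)[OF fin(2)] char by (intro finite_measure_eqI_char) auto
  then show ?thesis using N(3)[OF fin(1)] N(3)[OF fin(2)] by simp
qed

text \<open>
  Levy uniqueness needs a positive measure, so the factor \<open>exp(\<i> S)\<close> is absorbed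
  into the nonnegative weights \<open>1 + cos(S - \<theta>)\<close> with \<open>\<theta> \<in> {0, \<pi>/2}\<close>.
\<close>

lemma char_indicator_step:
  assumes fin: "finite_measure M1" "finite_measure M2" and sets: "sets M1 = sets M2"
    and P [measurable]: "P \<in> borel_measurable M1" and P_bdd: "\<And>x. 0 \<le> P x" "\<And>x. P x \<le> 1"
    and X [measurable]: "X \<in> borel_measurable M1" and S [measurable]: "S \<in> borel_measurable M1"
    and char: "\<And>s c. (CLINT x|M1. of_real (P x) * iexp (s * X x + c * S x)) =
                      (CLINT x|M2. of_real (P x) * iexp (s * X x + c * S x))"
    and B [measurable]: "B \<in> sets borel"
  shows "(CLINT x|M1. of_real (P x * indicator B (X x)) * iexp (S x)) =
         (CLINT x|M2. of_real (P x * indicator B (X x)) * iexp (S x))"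
proof -
  note sets [measurable_cong]
  have m2: "P \<in> borel_measurable M2" "X \<in> borel_measurable M2" "S \<in> borel_measurable M2"
    using P X S by (simp_all cong: measurable_cong_sets[OF sets refl])
  define W where "W \<theta> x = P x * (1 + cos (S x - \<theta>))" for \<theta> x
  have W_bdd: "0 \<le> W \<theta> x" "W \<theta> x \<le> 2" for \<theta> x
  proof -
    have "0 \<le> 1 + cos (S x - \<theta>)" "1 + cos (S x - \<theta>) \<le> 2"
      using cos_ge_minus_one[of "S x - \<theta>"] cos_le_one[of "S x - \<theta>"] by linarith+
    then show "0 \<le> W \<theta> x" "W \<theta> x \<le> 2"
      using P_bdd[of x] mult_mono[of "P x" 1 "1 + cos (S x - \<theta>)" 2] by (auto simp: W_def)
  qed
  define I where "I M s c = (CLINT x|M. of_real (P x) * iexp (s * X x + c * S x))" for M s c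
  \<comment> \<open>The cosine is a combination of two exponentials, so only the coefficients 0, 1
    and -1 of \<open>S\<close> occur and the hypothesis covers all of them.\<close>
  have char_W: "(CLINT x|M. of_real (W \<theta> x) * iexp (s * X x)) =
      I M s 0 + iexp (- \<theta>) / 2 * I M s 1 + iexp \<theta> / 2 * I M s (- 1)"
    if M: "M = M1 \<or> M = M2" for M s \<theta>
  proof -
    have i: "integrable M (\<lambda>x. of_real (P x) * iexp (s * X x + c * S x))" for c
    proof -
      have f: "finite_measure M" "P \<in> borel_measurable M" "(\<lambda>x. s * X x + c * S x) \<in> borel_measurable M"
        using M fin by (auto simp: P X S m2)
      show ?thesis using integrable_times_iexp[OF f(1,2) _ f(3), of 1] P_bdd by simp
    qed
    have "(CLINT x|M. of_real (W \<theta> x) * iexp (s * X x)) =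
      (CLINT x|M. of_real (P x) * iexp (s * X x + 0 * S x)
        + iexp (- \<theta>) / 2 * (of_real (P x) * iexp (s * X x + 1 * S x))
        + iexp \<theta> / 2 * (of_real (P x) * iexp (s * X x + (- 1) * S x)))"
      by (intro Bochner_Integration.integral_cong refl)
        (simp add: W_def cos_of_real[symmetric] cos_exp_eq exp_add exp_diff exp_minus field_simps)
    then show ?thesis
      unfolding I_def by (simp only: Bochner_Integration.integral_add i Bochner_Integration.integrable_add
            integrable_mult_right integral_mult_right_zero)
  qed
  have W_eq: "(\<integral>x. W \<theta> x * indicator B (X x) \<partial>M1) = (\<integral>x. W \<theta> x * indicator B (X x) \<partial>M2)" for \<theta>
  proof (rule weighted_char_unique[OF fin sets _ W_bdd X _ B])
    show "(CLINT x|M1. of_real (W \<theta> x) * iexp (s * X x)) = (CLINT x|M2. of_real (W \<theta> x) * iexp (s * X x))" for s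
      unfolding char_W[of M1, OF disjI1[OF refl]] char_W[of M2, OF disjI2[OF refl]] I_def char ..
  qed (simp add: W_def[abs_def])
  have P_eq: "(\<integral>x. P x * indicator B (X x) \<partial>M1) = (\<integral>x. P x * indicator B (X x) \<partial>M2)"
    using fin sets P_bdd char[of _ 0] by (intro weighted_char_unique[where c=1]) auto
  \<comment> \<open>\<open>W 0 - P\<close> is \<open>P\<close> times the cosine of \<open>S\<close>,
    and \<open>W (pi / 2) - P\<close> is \<open>P\<close> times its sine; together they restore the
    exponential.\<close>
  have "(CLINT x|M. of_real (P x * indicator B (X x)) * iexp (S x)) =
      of_real ((\<integral>x. W 0 x * indicator B (X x) \<partial>M) - (\<integral>x. P x * indicator B (X x) \<partial>M)) +
      \<i> * of_real ((\<integral>x. W (pi / 2) x * indicator B (X x) \<partial>M) - (\<integral>x. P x * indicator B (X x) \<partial>M))"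
    if M: "M = M1 \<or> M = M2" for M
  proof -
    have f: "finite_measure M" using M fin by auto
    have [measurable]: "P \<in> borel_measurable M" "X \<in> borel_measurable M" "S \<in> borel_measurable M" using M P X S m2 by auto
    have bdd: "\<bar>P x * indicator B (X x)\<bar> \<le> 1" "\<bar>W \<theta> x * indicator B (X x)\<bar> \<le> 2" for x \<theta>
      using P_bdd[of x] W_bdd[of \<theta> x] by (auto simp: indicator_def)
    have i: "integrable M (\<lambda>x. P x * indicator B (X x))"
      using bdd(1) by (intro finite_measure.integrable_const_bound[OF f, of _ 1]) auto
    have iW: "integrable M (\<lambda>x. W \<theta> x * indicator B (X x))" for \<theta>
      using bdd(2) by (intro finite_measure.integrable_const_bound[OF f, of _ 2]) (auto simp: W_def[abs_def])
    have "(CLINT x|M. of_real (P x * indicator B (X x)) * iexp (S x)) =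
      (CLINT x|M. of_real (W 0 x * indicator B (X x) - P x * indicator B (X x)) +
        \<i> * of_real (W (pi / 2) x * indicator B (X x) - P x * indicator B (X x)))"
      by (intro Bochner_Integration.integral_cong refl)
        (simp add: W_def cos_diff exp_Euler cos_of_real sin_of_real algebra_simps)
    also have "\<dots> = of_real (\<integral>x. W 0 x * indicator B (X x) - P x * indicator B (X x) \<partial>M) +
        \<i> * of_real (\<integral>x. W (pi / 2) x * indicator B (X x) - P x * indicator B (X x) \<partial>M)"
      using i iW by (simp only: Bochner_Integration.integral_add integrable_of_real integrable_mult_right
          integral_mult_right_zero integral_of_real Bochner_Integration.integrable_diff)
    finally show ?thesis using i iW by simp
  qed
  then show ?thesis using W_eq P_eq by simp
qed

text \<open>Finite-dimensional boxes determine the measure. In \<open>key\<close>, coordinates in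
  \<open>J\<close> carry indicators and those in \<open>K\<close> carry frequencies; the case of
  empty \<open>J\<close> is the hypothesis, and each step of the induction trades the frequency of
  one coordinate for an indicator.\<close>

lemma PiM_eqI_char:
  fixes M1 M2 :: "('i \<Rightarrow> real) measure"
  assumes fin: "finite_measure M1" "finite_measure M2"
    and sets [measurable_cong]: "sets M1 = sets (PiM I (\<lambda>_. borel))" "sets M2 = sets (PiM I (\<lambda>_. borel))"
    and char: "\<And>J t. finite J \<Longrightarrow> J \<subseteq> I \<Longrightarrow>
       (CLINT y|M1. iexp (\<Sum>j\<in>J. t j * y j)) = (CLINT y|M2. iexp (\<Sum>j\<in>J. t j * y j))"
  shows "M1 = M2"
proof (rule measure_eqI_PiM_infinite[OF sets])
  interpret M1: finite_measure M1 by fact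
  interpret M2: finite_measure M2 by fact
  have ms: "sets M1 = sets M2" using sets by simp
  have comp [measurable]: "(\<lambda>y. y j) \<in> borel_measurable M1" if "j \<in> I" for j
    using that by measurable
  have key: "(CLINT y|M1. of_real (\<Prod>j\<in>J. indicator (B j) (y j)) * iexp (\<Sum>k\<in>K. t k * y k)) =
      (CLINT y|M2. of_real (\<Prod>j\<in>J. indicator (B j) (y j)) * iexp (\<Sum>k\<in>K. t k * y k))"
    if "finite J" "J \<subseteq> I" "finite K" "K \<subseteq> I" "J \<inter> K = {}" and B: "\<And>j. B j \<in> sets borel" for J K t and B :: "'i \<Rightarrow> real set"
    using that(1-5)
  proof (induction J arbitrary: K t rule: finite_induct)
    case empty
    then show ?case using char by simp
  next
    case (insert i J)
    have [measurable]: "B j \<in> sets borel" for j by (rule B)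
    have mK: "(\<lambda>y. \<Sum>k\<in>K. t k * y k) \<in> borel_measurable M1"
      using insert.prems by (intro borel_measurable_sum borel_measurable_times borel_measurable_const comp) auto
    have mJ: "(\<lambda>y. \<Prod>j\<in>J. indicator (B j) (y j) :: real) \<in> borel_measurable M1"
      using insert.prems by (intro borel_measurable_prod measurable_compose[OF comp borel_measurable_indicator] B) auto
    have "(CLINT y|M1. of_real ((\<Prod>j\<in>J. indicator (B j) (y j)) * indicator (B i) (y i)) * iexp (\<Sum>k\<in>K. t k * y k)) =
      (CLINT y|M2. of_real ((\<Prod>j\<in>J. indicator (B j) (y j)) * indicator (B i) (y i)) * iexp (\<Sum>k\<in>K. t k * y k))"
    proof (rule char_indicator_step[OF fin ms mJ _ _ comp mK _ B])
      show "i \<in> I" using insert.prems by auto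
      fix s c
      have i: "i \<notin> K" "i \<notin> J" using insert by auto
      \<comment> \<open>The coordinate \<open>i\<close> joins \<open>K\<close> with frequency
        \<open>s\<close>, while \<open>c\<close> rescales the old frequencies; the induction
        hypothesis holds for arbitrary \<open>K\<close> and \<open>t\<close>, so it applies.\<close>
      define t' where "t' k = (if k = i then s else c * t k)" for k
      have "s * y i + c * (\<Sum>k\<in>K. t k * y k) = (\<Sum>k\<in>insert i K. t' k * y k)" for y :: "'i \<Rightarrow> real"
      proof -
        have "(\<Sum>k\<in>insert i K. t' k * y k) = s * y i + (\<Sum>k\<in>K. t' k * y k)"
          using i insert.prems by (simp add: t'_def)
        also have "(\<Sum>k\<in>K. t' k * y k) = c * (\<Sum>k\<in>K. t k * y k)"
          using i by (auto simp: t'_def sum_distrib_left intro!: sum.cong)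
        finally show ?thesis by simp
      qed
      then show "(CLINT y|M1. of_real (\<Prod>j\<in>J. indicator (B j) (y j)) * iexp (s * y i + c * (\<Sum>k\<in>K. t k * y k))) =
        (CLINT y|M2. of_real (\<Prod>j\<in>J. indicator (B j) (y j)) * iexp (s * y i + c * (\<Sum>k\<in>K. t k * y k)))"
        using insert.IH[of "insert i K" t'] insert.prems i by simp
    qed (auto intro!: prod_nonneg prod_le_1)
    then show ?case using insert by (simp add: mult.commute)
  qed
  fix A J assume J: "finite J" "J \<subseteq> I" and A: "\<And>i. i \<in> J \<Longrightarrow> A i \<in> sets (borel :: real measure)"
  \<comment> \<open>The default \<open>{}\<close> off \<open>J\<close> makes every
    \<open>B j\<close> a Borel set, as \<open>key\<close> requires.\<close>
  define B where "B j = (if j \<in> J then A j else {})" for j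
  have B: "B j \<in> sets borel" for j using A by (simp add: B_def)
  let ?E = "prod_emb I (\<lambda>_. borel) J (Pi\<^sub>E J A)"
  have E: "?E \<in> sets (PiM I (\<lambda>_. borel))" using J A by (intro sets_PiM_I) auto
  have ind: "(\<Prod>j\<in>J. indicator (B j) (y j)) = (indicator ?E y :: real)" if "y \<in> space (PiM I (\<lambda>_. borel :: real measure))" for y
  proof (cases "\<forall>j\<in>J. y j \<in> A j")
    case True
    then have "y \<in> ?E" using that J by (auto simp: prod_emb_def space_PiM PiE_iff extensional_def)
    then show ?thesis using True by (simp add: B_def)
  next
    case False
    then obtain j where j: "j \<in> J" "y j \<notin> A j" by blast
    then have "y \<notin> ?E" by (auto simp: prod_emb_def PiE_iff)
    moreover have "(\<Prod>j\<in>J. indicator (B j) (y j)) = (0::real)"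
      using j J by (intro prod_zero bexI[of _ j]) (auto simp: B_def)
    ultimately show ?thesis by simp
  qed
  have m: "(CLINT y|M. of_real (\<Prod>j\<in>J. indicator (B j) (y j)) * iexp (\<Sum>k\<in>{}. 0 * y k)) = of_real (measure M ?E)"
    if "sets M = sets (PiM I (\<lambda>_. borel))" "finite_measure M" for M
  proof -
    interpret finite_measure M by fact
    have sp: "space M = space (PiM I (\<lambda>_. borel))" using sets_eq_imp_space_eq[OF that(1)] .
    have "(CLINT y|M. of_real (\<Prod>j\<in>J. indicator (B j) (y j)) * iexp (\<Sum>k\<in>{}. 0 * y k)) = (CLINT y|M. of_real (indicator ?E y))"
      by (intro Bochner_Integration.integral_cong refl) (simp add: ind sp del: of_real_prod)
    also have "\<dots> = of_real (measure M ?E)" using E that(1) by simp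
    finally show ?thesis .
  qed
  have "measure M1 ?E = measure M2 ?E"
    using key[of J "{}" B "\<lambda>_. 0"] J B m[OF sets(1) fin(1)] m[OF sets(2) fin(2)] by auto
  then show "emeasure M1 ?E = emeasure M2 ?E"
    by (simp add: M1.emeasure_eq_measure M2.emeasure_eq_measure)
qed (fact fin)

section \<open>The Cameron--Martin shift of a Gaussian process\<close>

text \<open>Completing the square: the tilt moves the centre of the density from 0 to
  \<open>c\<close>. This is the one-dimensional case to which \<open>Cameron_Martin\<close> is
  reduced.\<close>

lemma nn_integral_std_normal_tilt:
  assumes [measurable]: "f \<in> borel_measurable borel"
  shows "(\<integral>\<^sup>+x. f x * ennreal (exp (c * x - c\<^sup>2 / 2)) \<partial>std_normal_distribution) =
         (\<integral>\<^sup>+x. f (x + c) \<partial>std_normal_distribution)"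
proof -
  have "(\<integral>\<^sup>+x. f x * ennreal (exp (c * x - c\<^sup>2 / 2)) \<partial>std_normal_distribution) =
      (\<integral>\<^sup>+x. ennreal (std_normal_density x) * (f x * ennreal (exp (c * x - c\<^sup>2 / 2))) \<partial>lborel)"
    by (subst nn_integral_density) auto
  also have "\<dots> = (\<integral>\<^sup>+x. ennreal (std_normal_density (x - c)) * f x \<partial>lborel)"
  proof (intro nn_integral_cong)
    fix x :: real
    have "std_normal_density x * exp (c * x - c\<^sup>2 / 2) = std_normal_density (x - c)"
      by (simp add: std_normal_density_def power2_eq_square field_simps flip: exp_add)
    then show "ennreal (std_normal_density x) * (f x * ennreal (exp (c * x - c\<^sup>2 / 2))) = ennreal (std_normal_density (x - c)) * f x"
      by (metis (no_types, lifting) ennreal_mult' exp_ge_zero mult.assoc mult.commute)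
  qed
  also have "\<dots> = (\<integral>\<^sup>+x. ennreal (std_normal_density x) * f (x + c) \<partial>lborel)"
    by (subst nn_integral_real_affine[where c=1 and t=c]) (auto simp: add.commute)
  also have "\<dots> = (\<integral>\<^sup>+x. f (x + c) \<partial>std_normal_distribution)"
    by (subst nn_integral_density) auto
  finally show ?thesis .
qed

lemma CLINT_pair_times:
  fixes f :: "'a \<Rightarrow> complex" and g :: "'b \<Rightarrow> complex"
  assumes "sigma_finite_measure M" "sigma_finite_measure N"
    and int: "integrable (M \<Otimes>\<^sub>M N) (\<lambda>(x, y). f x * g y)"
  shows "(CLINT z|(M \<Otimes>\<^sub>M N). f (fst z) * g (snd z)) = (CLINT x|M. f x) * (CLINT y|N. g y)"
proof -
  interpret pair_sigma_finite M N using assms(1,2) by (simp add: pair_sigma_finite_def)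
  show ?thesis using integral_fst'[OF int] by (simp add: case_prod_beta')
qed

text \<open>The law is prescribed by characteristic functions of finitely many coordinates, with
  \<open>\<kappa>\<close> as covariance kernel; \<open>I\<close> may be uncountable.\<close>

locale gaussian_process = prob_space \<nu> for \<nu> :: "('i \<Rightarrow> real) measure" +
  fixes I :: "'i set" and \<kappa> :: "'i \<Rightarrow> 'i \<Rightarrow> real"
  assumes sets_\<nu> [measurable_cong]: "sets \<nu> = sets (PiM I (\<lambda>_. borel))"
    and \<kappa>_sym: "\<kappa> i j = \<kappa> j i"
    and char_\<nu>: "\<And>J t. finite J \<Longrightarrow> J \<subseteq> I \<Longrightarrow>
       (CLINT y|\<nu>. iexp (\<Sum>j\<in>J. t j * y j)) = exp (- (\<Sum>i\<in>J. \<Sum>j\<in>J. t i * t j * \<kappa> i j) / 2)"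
begin

lemma space_\<nu>: "space \<nu> = space (PiM I (\<lambda>_. borel))"
  using sets_eq_imp_space_eq[OF sets_\<nu>] .

lemma component_measurable [measurable]: "i \<in> I \<Longrightarrow> (\<lambda>y. y i) \<in> borel_measurable \<nu>"
  by measurable

context
  fixes J0 :: "'i set" and a :: "'i \<Rightarrow> real"
  assumes J0: "finite J0" "J0 \<subseteq> I"
begin

text \<open>Under \<open>\<nu>\<close> this functional is centred normal with variance
  \<open>vari\<close>, and \<open>cov i\<close> is its covariance with coordinate \<open>i\<close>.
  Shifting by \<open>cov\<close> is the translation whose density is the exponential tilt by
  \<open>lin\<close>.\<close>

definition lin :: "('i \<Rightarrow> real) \<Rightarrow> real" where
  "lin y = (\<Sum>j\<in>J0. a j * y j)"

definition cov :: "'i \<Rightarrow> real" where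
  "cov i = (\<Sum>j\<in>J0. a j * \<kappa> i j)"

definition vari :: real where
  "vari = (\<Sum>i\<in>J0. \<Sum>j\<in>J0. a i * a j * \<kappa> i j)"

lemma vari_eq: "vari = (\<Sum>i\<in>J0. a i * cov i)"
  by (simp add: vari_def cov_def sum_distrib_left mult.assoc)

lemma lin_measurable [measurable]: "lin \<in> borel_measurable \<nu>"
  unfolding lin_def[abs_def] using J0
  by (intro borel_measurable_sum borel_measurable_times borel_measurable_const component_measurable) auto

text \<open>\<open>cov i / sqrt vari\<close> is the regression coefficient of coordinate
  \<open>i\<close> on the normalised \<open>lin\<close>. The part explained by \<open>lin\<close> is
  removed and the same multiple of \<open>\<xi>\<close> put in its place.\<close>

definition swap :: "('i \<Rightarrow> real) \<Rightarrow> real \<Rightarrow> 'i \<Rightarrow> real" where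
  "swap y \<xi> = (\<lambda>i\<in>I. y i - (lin y / sqrt vari - \<xi>) * (cov i / sqrt vari))"

lemma swap_measurable [measurable]: "(\<lambda>(y, \<xi>). swap y \<xi>) \<in> \<nu> \<Otimes>\<^sub>M borel \<rightarrow>\<^sub>M PiM I (\<lambda>_. borel)"
  unfolding swap_def by (intro measurable_split_conv[THEN iffD2] refl) measurable

lemma swap_measurable_normal [measurable]:
  "(\<lambda>(y, \<xi>). swap y \<xi>) \<in> \<nu> \<Otimes>\<^sub>M std_normal_distribution \<rightarrow>\<^sub>M PiM I (\<lambda>_. borel)"
proof -
  have "measurable (\<nu> \<Otimes>\<^sub>M std_normal_distribution) Z = measurable (\<nu> \<Otimes>\<^sub>M borel) Z" for Z :: "'z measure"
    by (intro measurable_cong_sets sets_pair_measure_cong) auto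
  then show ?thesis using swap_measurable by simp
qed

text \<open>\<open>c\<close> is the covariance of the test functional with \<open>lin\<close>, so
  the exponent is the residual after regression on \<open>lin\<close>, whose variance is smaller by
  \<open>c^2 / vari\<close>.\<close>

lemma char_shift:
  fixes t :: "'i \<Rightarrow> real"
  assumes J: "finite J" "J \<subseteq> I" and v: "vari > 0"
  defines "c \<equiv> \<Sum>j\<in>J. t j * cov j"
  shows "(CLINT y|\<nu>. iexp ((\<Sum>j\<in>J. t j * y j) - c / vari * lin y)) =
    exp (- ((\<Sum>i\<in>J. \<Sum>j\<in>J. t i * t j * \<kappa> i j) - c\<^sup>2 / vari) / 2)"
proof -
  \<comment> \<open>\<open>J\<close> and \<open>J0\<close> may overlap; extending both coefficient
    families by zero to a common index set lets them be subtracted.\<close>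
  define L where "L = J \<union> J0"
  have L: "finite L" "L \<subseteq> I" "J \<subseteq> L" "J0 \<subseteq> L" using J J0 by (auto simp: L_def)
  define t' where "t' i = (if i \<in> J then t i else 0)" for i
  define a' where "a' i = (if i \<in> J0 then a i else 0)" for i
  define l where "l = c / vari"
  have st: "(\<Sum>i\<in>L. t' i * g i) = (\<Sum>i\<in>J. t i * g i)" for g
    using L by (intro sum.mono_neutral_cong_right) (auto simp: t'_def)
  have sa: "(\<Sum>i\<in>L. a' i * g i) = (\<Sum>i\<in>J0. a i * g i)" for g
    using L by (intro sum.mono_neutral_cong_right) (auto simp: a'_def)
  have "(\<Sum>j\<in>L. (t' j - l * a' j) * y j) = (\<Sum>j\<in>J. t j * y j) - l * lin y" for y
    using st[of y] sa[of y] by (simp add: left_diff_distrib sum_subtractf lin_def mult.assoc flip: sum_distrib_left)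
  then have "(CLINT y|\<nu>. iexp ((\<Sum>j\<in>J. t j * y j) - l * lin y)) =
      exp (- (\<Sum>i\<in>L. \<Sum>j\<in>L. (t' i - l * a' i) * (t' j - l * a' j) * \<kappa> i j) / 2)"
    using char_\<nu>[OF L(1,2), of "\<lambda>j. t' j - l * a' j"] by simp
  also have "(\<Sum>i\<in>L. \<Sum>j\<in>L. (t' i - l * a' i) * (t' j - l * a' j) * \<kappa> i j) =
      (\<Sum>i\<in>L. t' i * (\<Sum>j\<in>L. t' j * \<kappa> i j)) - l * (\<Sum>i\<in>L. t' i * (\<Sum>j\<in>L. a' j * \<kappa> i j))
      - l * (\<Sum>i\<in>L. a' i * (\<Sum>j\<in>L. t' j * \<kappa> i j)) + l\<^sup>2 * (\<Sum>i\<in>L. a' i * (\<Sum>j\<in>L. a' j * \<kappa> i j))"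
    by (simp add: sum_distrib_left sum.distrib sum_subtractf algebra_simps power2_eq_square)
  also have "(\<Sum>i\<in>L. a' i * (\<Sum>j\<in>L. t' j * \<kappa> i j)) = (\<Sum>i\<in>L. t' i * (\<Sum>j\<in>L. a' j * \<kappa> i j))"
    unfolding sum_distrib_left by (subst sum.swap) (simp add: \<kappa>_sym mult.left_commute)
  also have "(\<Sum>i\<in>L. t' i * (\<Sum>j\<in>L. a' j * \<kappa> i j)) = c"
    by (simp add: st sa c_def cov_def)
  also have "(\<Sum>i\<in>L. a' i * (\<Sum>j\<in>L. a' j * \<kappa> i j)) = vari"
    by (simp add: sa vari_eq cov_def)
  also have "(\<Sum>i\<in>L. t' i * (\<Sum>j\<in>L. t' j * \<kappa> i j)) = (\<Sum>i\<in>J. \<Sum>j\<in>J. t i * t j * \<kappa> i j)"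
    unfolding st by (simp add: sum_distrib_left mult.assoc)
  also have "(\<Sum>i\<in>J. \<Sum>j\<in>J. t i * t j * \<kappa> i j) - l * c - l * c + l\<^sup>2 * vari =
      (\<Sum>i\<in>J. \<Sum>j\<in>J. t i * t j * \<kappa> i j) - c\<^sup>2 / vari"
    using v by (simp add: l_def field_simps power2_eq_square)
  finally show ?thesis by (simp add: l_def)
qed

text \<open>
  Replacing the coordinate \<open>lin\<close> by an independent normal variable does not change the law, and it
  turns the exponential tilt into a one-dimensional one.
\<close>

lemma distr_swap:
  assumes v: "vari > 0"
  shows "distr (\<nu> \<Otimes>\<^sub>M std_normal_distribution) (PiM I (\<lambda>_. borel)) (\<lambda>(y, \<xi>). swap y \<xi>) = \<nu>"
proof -
  interpret N: real_distribution std_normal_distribution by (rule real_dist_normal_dist)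
  interpret PN: pair_prob_space \<nu> std_normal_distribution ..
  note m = swap_measurable_normal
  show ?thesis
  proof (rule PiM_eqI_char)
    show "finite_measure (distr (\<nu> \<Otimes>\<^sub>M std_normal_distribution) (PiM I (\<lambda>_. borel)) (\<lambda>(y, \<xi>). swap y \<xi>))"
      by (rule PN.finite_measure_distr[OF m])
    show "finite_measure \<nu>" by (rule finite_measure_axioms)
    show "sets \<nu> = sets (PiM I (\<lambda>_. borel))" by (rule sets_\<nu>)
    fix J t assume J: "finite J" "J \<subseteq> I"
    have mJ': "(\<lambda>y. \<Sum>j\<in>J. t j * y j) \<in> borel_measurable \<nu>"
      using J by (intro borel_measurable_sum borel_measurable_times borel_measurable_const component_measurable) auto
    then have mJ: "(\<lambda>y. \<Sum>j\<in>J. t j * y j) \<in> borel_measurable (PiM I (\<lambda>_. borel))"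
      unfolding measurable_cong_sets[OF sets_\<nu> refl] .
    define c where "c = (\<Sum>j\<in>J. t j * cov j)"
    define f where "f y = iexp ((\<Sum>j\<in>J. t j * y j) - c / vari * lin y)" for y
    define g where "g \<xi> = iexp (c / sqrt vari * \<xi>)" for \<xi>
    \<comment> \<open>The exponential splits into a residual and a function of \<open>\<xi>\<close>.
      The variance \<open>c^2 / vari\<close> missing from the residual is exactly what
      \<open>\<xi>\<close> contributes.\<close>
    have fg: "iexp (\<Sum>j\<in>J. t j * swap y \<xi> j) = f y * g \<xi>" for y \<xi>
    proof -
      have "(\<Sum>j\<in>J. t j * swap y \<xi> j) = (\<Sum>j\<in>J. t j * y j - (lin y / sqrt vari - \<xi>) / sqrt vari * (t j * cov j))"
      proof -
        have "z * (u - e * (b / q)) = z * u - e / q * (z * b)" for z u e b q :: real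
          by (simp add: right_diff_distrib)
        then show ?thesis using J by (intro sum.cong refl) (auto simp: swap_def)
      qed
      also have "\<dots> = (\<Sum>j\<in>J. t j * y j) - (lin y / sqrt vari - \<xi>) / sqrt vari * c"
        by (simp add: sum_subtractf c_def sum_distrib_left)
      also have "\<dots> = ((\<Sum>j\<in>J. t j * y j) - c / vari * lin y) + c / sqrt vari * \<xi>"
        using v by (simp add: field_simps)
      finally show ?thesis unfolding f_def g_def by (simp only: of_real_add distrib_left exp_add)
    qed
    have [measurable]: "f \<in> borel_measurable \<nu>" "g \<in> borel_measurable borel"
      unfolding f_def[abs_def] g_def[abs_def] using mJ' by measurable
    have nf: "norm (f y * g \<xi>) = 1" for y \<xi>
      unfolding f_def g_def norm_mult by (simp del: of_real_diff of_real_mult of_real_divide)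
    have int: "integrable (\<nu> \<Otimes>\<^sub>M std_normal_distribution) (\<lambda>(y, \<xi>). f y * g \<xi>)"
      by (rule PN.integrable_const_bound[of _ 1]) (auto simp: nf case_prod_beta)
    have "(CLINT y|distr (\<nu> \<Otimes>\<^sub>M std_normal_distribution) (PiM I (\<lambda>_. borel)) (\<lambda>(y, \<xi>). swap y \<xi>). iexp (\<Sum>j\<in>J. t j * y j))
      = (CLINT z|(\<nu> \<Otimes>\<^sub>M std_normal_distribution). f (fst z) * g (snd z))"
      using mJ by (subst integral_distr[OF m]) (auto simp: fg case_prod_beta simp del: of_real_sum)
    also have "\<dots> = (CLINT y|\<nu>. f y) * (CLINT \<xi>|std_normal_distribution. g \<xi>)"
      by (rule CLINT_pair_times[OF _ _ int]) unfold_locales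
    also have "(CLINT \<xi>|std_normal_distribution. g \<xi>) = char std_normal_distribution (c / sqrt vari)"
      unfolding g_def char_def by simp
    also have "\<dots> = of_real (exp (- (c / sqrt vari)\<^sup>2 / 2))"
      by (simp add: char_std_normal_distribution)
    also have "(CLINT y|\<nu>. f y) = of_real (exp (- ((\<Sum>i\<in>J. \<Sum>j\<in>J. t i * t j * \<kappa> i j) - c\<^sup>2 / vari) / 2))"
      unfolding f_def c_def by (subst char_shift[OF J v]) (simp flip: exp_of_real)
    also have "\<dots> * of_real (exp (- (c / sqrt vari)\<^sup>2 / 2)) = of_real (exp (- (\<Sum>i\<in>J. \<Sum>j\<in>J. t i * t j * \<kappa> i j) / 2))"
      using v by (simp add: power_divide field_simps flip: of_real_mult exp_add)
    also have "\<dots> = (CLINT y|\<nu>. iexp (\<Sum>j\<in>J. t j * y j))"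
      by (subst char_\<nu>[OF J]) (simp flip: exp_of_real)
    finally show "(CLINT y|distr (\<nu> \<Otimes>\<^sub>M std_normal_distribution) (PiM I (\<lambda>_. borel)) (\<lambda>(y, \<xi>). swap y \<xi>). iexp (\<Sum>j\<in>J. t j * y j))
      = (CLINT y|\<nu>. iexp (\<Sum>j\<in>J. t j * y j))" .
  qed simp
qed

text \<open>After swapping, \<open>lin\<close> equals \<open>sqrt vari * \<xi>\<close>, and the
  shift by \<open>cov\<close> amounts to adding \<open>sqrt vari\<close> to \<open>\<xi>\<close>.
  For each fixed \<open>y\<close> the claim is the tilt of a standard normal variable.\<close>

lemma Cameron_Martin:
  assumes v: "vari > 0" and F [measurable]: "F \<in> borel_measurable (PiM I (\<lambda>_. borel))"
  shows "(\<integral>\<^sup>+y. F (\<lambda>i\<in>I. y i + cov i) \<partial>\<nu>) = (\<integral>\<^sup>+y. F y * ennreal (exp (lin y - vari / 2)) \<partial>\<nu>)"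
proof -
  interpret N: real_distribution std_normal_distribution by (rule real_dist_normal_dist)
  interpret PN: pair_prob_space \<nu> std_normal_distribution ..
  note m = swap_measurable_normal
  have int: "(\<integral>\<^sup>+y. G y \<partial>\<nu>) = (\<integral>\<^sup>+y. \<integral>\<^sup>+\<xi>. G (swap y \<xi>) \<partial>std_normal_distribution \<partial>\<nu>)"
    if G [measurable]: "G \<in> borel_measurable (PiM I (\<lambda>_. borel))" for G :: "('i \<Rightarrow> real) \<Rightarrow> ennreal"
  proof -
    have "(\<integral>\<^sup>+y. G y \<partial>\<nu>) = (\<integral>\<^sup>+z. G (case z of (y, \<xi>) \<Rightarrow> swap y \<xi>) \<partial>(\<nu> \<Otimes>\<^sub>M std_normal_distribution))"
      by (subst distr_swap[OF v, symmetric], subst nn_integral_distr[OF m]) (auto simp: G)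
    also have "\<dots> = (\<integral>\<^sup>+y. \<integral>\<^sup>+\<xi>. G (case (y, \<xi>) of (y, \<xi>) \<Rightarrow> swap y \<xi>) \<partial>std_normal_distribution \<partial>\<nu>)"
      by (intro N.nn_integral_fst[symmetric] measurable_compose[OF m G])
    finally show ?thesis by simp
  qed
  have lin_swap: "lin (swap y \<xi>) = sqrt vari * \<xi>" for y \<xi>
  proof -
    have "lin (swap y \<xi>) = (\<Sum>j\<in>J0. a j * y j - (lin y / sqrt vari - \<xi>) / sqrt vari * (a j * cov j))"
    proof -
      have "z * (u - e * (c / q)) = z * u - e / q * (z * c)" for z u e c q :: real
        by (simp add: right_diff_distrib)
      then show ?thesis
        unfolding lin_def[of "swap y \<xi>"] using J0 by (intro sum.cong refl) (auto simp: swap_def)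
    qed
    also have "\<dots> = lin y - (lin y / sqrt vari - \<xi>) / sqrt vari * vari"
      by (simp add: sum_subtractf vari_eq lin_def sum_distrib_left)
    also have "\<dots> = sqrt vari * \<xi>" using v by (simp add: field_simps real_div_sqrt)
    finally show ?thesis .
  qed
  have swap_shift: "(\<lambda>i\<in>I. swap y \<xi> i + cov i) = swap y (\<xi> + sqrt vari)" for y \<xi>
    using v by (auto simp: swap_def fun_eq_iff restrict_def field_simps)
  have lin_m [measurable]: "lin \<in> borel_measurable (PiM I (\<lambda>_. borel))"
    using lin_measurable by (simp cong: measurable_cong_sets add: sets_\<nu>)
  have [measurable]: "(\<lambda>y. \<lambda>i\<in>I. y i + cov i) \<in> PiM I (\<lambda>_. borel) \<rightarrow>\<^sub>M PiM I (\<lambda>_. borel)"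
    by measurable
  have sec [measurable]: "swap y \<in> borel \<rightarrow>\<^sub>M PiM I (\<lambda>_. borel)" if "y \<in> space \<nu>" for y
    using measurable_compose[OF measurable_Pair1'[OF that] swap_measurable] by simp
  have "(\<integral>\<^sup>+y. F y * ennreal (exp (lin y - vari / 2)) \<partial>\<nu>) =
      (\<integral>\<^sup>+y. \<integral>\<^sup>+\<xi>. F (swap y \<xi>) * ennreal (exp (sqrt vari * \<xi> - (sqrt vari)\<^sup>2 / 2)) \<partial>std_normal_distribution \<partial>\<nu>)"
    using v by (subst int) (auto simp: lin_swap)
  also have "\<dots> = (\<integral>\<^sup>+y. \<integral>\<^sup>+\<xi>. F (swap y (\<xi> + sqrt vari)) \<partial>std_normal_distribution \<partial>\<nu>)"
    by (intro nn_integral_cong nn_integral_std_normal_tilt measurable_compose[OF sec F])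
  also have "\<dots> = (\<integral>\<^sup>+y. F (\<lambda>i\<in>I. y i + cov i) \<partial>\<nu>)"
    by (subst int) (auto simp: swap_shift)
  finally show ?thesis ..
qed

end

text \<open>Let \<open>Z\<close> be the density of the shifted law. In
  \<open>Z \<le> K + Z^2 / K\<close> the first term costs \<open>K\<close> times the unshifted
  probability of \<open>D\<close>; the second is controlled by the second moment
  \<open>exp vari\<close>, whatever \<open>D\<close> is. The zero shift is treated apart, since the
  formula divides by \<open>vari\<close>.\<close>

lemma shift_bound:
  assumes J0: "finite J0" "J0 \<subseteq> I" and v: "vari J0 a > 0 \<or> (\<forall>j\<in>J0. a j = 0)"
    and D [measurable]: "D \<in> sets \<nu>" and K: "K \<ge> 1"
  shows "measure \<nu> {y \<in> space \<nu>. (\<lambda>i\<in>I. y i + cov J0 a i) \<in> D} \<le> K * measure \<nu> D + exp (vari J0 a) / K"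
proof (cases "vari J0 a > 0")
  case False
  then have a: "\<And>j. j \<in> J0 \<Longrightarrow> a j = 0" using v by auto
  have "{y \<in> space \<nu>. (\<lambda>i\<in>I. y i + cov J0 a i) \<in> D} = D"
    using sets.sets_into_space[OF D] a
    by (auto simp: cov_def[OF J0] space_\<nu> space_PiM PiE_iff extensional_restrict subset_eq)
  moreover have "1 * measure \<nu> D \<le> K * measure \<nu> D" using K by (intro mult_right_mono) auto
  ultimately show ?thesis using K by (simp add: add_increasing2)
next
  case True
  let ?v = "vari J0 a" and ?l = "lin J0 a"
  \<comment> \<open>Doubling the coefficients quadruples the variance. Applied to the constant 1,
    the shift formula then gives \<open>one\<close>, which is the second moment of the density
    divided by \<open>exp vari\<close>.\<close>
  have vari2: "vari J0 (\<lambda>j. 2 * a j) = 4 * ?v"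
    by (simp add: vari_def[OF J0] sum_distrib_left algebra_simps)
  have lin2: "lin J0 (\<lambda>j. 2 * a j) y = 2 * ?l y" for y
    by (simp add: lin_def[OF J0] sum_distrib_left algebra_simps)
  have D' [measurable]: "D \<in> sets (PiM I (\<lambda>_. borel))" using D sets_\<nu> by simp
  have lm [measurable]: "?l \<in> borel_measurable \<nu>" by (rule lin_measurable[OF J0])
  have one: "(\<integral>\<^sup>+y. ennreal (exp (2 * ?l y - 2 * ?v)) \<partial>\<nu>) = 1"
    using Cameron_Martin[OF J0, of "\<lambda>j. 2 * a j" "\<lambda>_. 1"] True by (simp add: vari2 lin2 emeasure_space_1)
  have Z: "exp (?l y - ?v / 2) \<le> K + exp ?v / K * exp (2 * ?l y - 2 * ?v)" for y
  proof -
    define z where "z = exp (?l y - ?v / 2)"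
    have "exp ?v * exp (2 * ?l y - 2 * ?v) = z * z"
      by (simp add: z_def algebra_simps flip: exp_add)
    moreover have "z \<le> K + z * z / K"
    proof -
      have "0 \<le> (z - K)\<^sup>2" by simp
      then have "2 * (z * K) \<le> z * z + K * K" by (simp add: power2_eq_square algebra_simps)
      moreover have "0 \<le> z * K" using K by (simp add: z_def)
      ultimately have "z * K \<le> K * K + z * z" by linarith
      then show ?thesis using K by (simp add: field_simps)
    qed
    ultimately show ?thesis by (simp add: z_def)
  qed
  have [measurable]: "(\<lambda>y. \<lambda>i\<in>I. y i + cov J0 a i) \<in> \<nu> \<rightarrow>\<^sub>M PiM I (\<lambda>_. borel)"
    by measurable
  have "emeasure \<nu> {y \<in> space \<nu>. (\<lambda>i\<in>I. y i + cov J0 a i) \<in> D} = (\<integral>\<^sup>+y. indicator D (\<lambda>i\<in>I. y i + cov J0 a i) \<partial>\<nu>)"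
  proof -
    let ?S = "{y \<in> space \<nu>. (\<lambda>i\<in>I. y i + cov J0 a i) \<in> D}"
    have "?S \<in> sets \<nu>" by measurable
    moreover have "(\<integral>\<^sup>+y. indicator D (\<lambda>i\<in>I. y i + cov J0 a i) \<partial>\<nu>) = (\<integral>\<^sup>+y. indicator ?S y \<partial>\<nu>)"
      by (intro nn_integral_cong) (auto simp: indicator_def)
    ultimately show ?thesis by simp
  qed
  also have "\<dots> = (\<integral>\<^sup>+y. indicator D y * ennreal (exp (?l y - ?v / 2)) \<partial>\<nu>)"
    by (rule Cameron_Martin[OF J0 True]) simp
  also have "\<dots> \<le> (\<integral>\<^sup>+y. ennreal K * indicator D y + ennreal (exp ?v / K) * ennreal (exp (2 * ?l y - 2 * ?v)) \<partial>\<nu>)"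
    using Z K by (intro nn_integral_mono) (auto simp: indicator_def simp flip: ennreal_mult ennreal_plus)
  also have "\<dots> = ennreal K * emeasure \<nu> D + ennreal (exp ?v / K)"
    by (subst nn_integral_add) (auto simp: nn_integral_cmult one)
  also have "\<dots> = ennreal (K * measure \<nu> D + exp ?v / K)"
    using K by (simp add: emeasure_eq_measure ennreal_mult ennreal_plus)
  finally show ?thesis using K by (subst (asm) emeasure_eq_measure, subst (asm) ennreal_le_iff) simp_all
qed

end

section \<open>The law of the noise\<close>

lemma centred_gaussian_char:
  assumes "prob_space Q" and Z: "centred_gaussian Q Z v" and v: "v \<ge> 0"
  shows "(CLINT \<omega>|Q. iexp (Z \<omega>)) = exp (- v / 2)"
proof -
  interpret prob_space Q by fact
  have Zm [measurable]: "Z \<in> borel_measurable Q" using Z by (simp add: centred_gaussian_def)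
  show ?thesis
  proof (cases "v = 0")
    case True
    have "(CLINT \<omega>|Q. iexp (Z \<omega>)) = (CLINT x|distr Q borel Z. iexp x)"
      by (subst integral_distr) auto
    also have "\<dots> = 1" using Z True by (simp add: centred_gaussian_def integral_return)
    finally show ?thesis using True by simp
  next
    case False
    then have v: "v > 0" using v by simp
    have "distributed Q lborel Z (normal_density 0 (sqrt v))"
      using Z False by (auto simp: distributed_def centred_gaussian_def cong: distr_cong)
    then have d: "distributed Q lborel (\<lambda>\<omega>. Z \<omega> / sqrt v) std_normal_density"
      using normal_standard_normal_convert[of "sqrt v" Z 0] v by simp
    have "(CLINT \<omega>|Q. iexp (Z \<omega>)) = (CLINT \<omega>|Q. iexp (sqrt v * (Z \<omega> / sqrt v)))" using v by simp
    also have "\<dots> = (CLINT x|distr Q lborel (\<lambda>\<omega>. Z \<omega> / sqrt v). iexp (sqrt v * x))"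
      by (subst integral_distr) auto
    also have "\<dots> = char std_normal_distribution (sqrt v)"
      using distributed_distr_eq_density[OF d] by (simp add: char_def)
    also have "\<dots> = exp (- v / 2)" using v by (simp add: char_std_normal_distribution exp_of_real)
    finally show ?thesis .
  qed
qed

lemma L2_norm_sum_sq:
  assumes "\<And>k. k \<in> K \<Longrightarrow> f k \<in> L2 M"
  shows "(L2_norm M (\<lambda>x. \<Sum>k\<in>K. c k * f k x))\<^sup>2 = (\<Sum>k\<in>K. \<Sum>l\<in>K. c k * c l * L2_inner M (f k) (f l))"
proof -
  have "(L2_norm M (\<lambda>x. \<Sum>k\<in>K. c k * f k x))\<^sup>2 = (\<integral>x. (\<Sum>k\<in>K. \<Sum>l\<in>K. c k * c l * (f k x * f l x)) \<partial>M)"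
    by (simp add: L2_norm_sq L2_inner_def sum_product mult_ac)
  also have "\<dots> = (\<Sum>k\<in>K. \<Sum>l\<in>K. c k * c l * L2_inner M (f k) (f l))"
    using assms by (simp add: L2_inner_def Bochner_Integration.integral_sum L2_integrable_mult)
  finally show ?thesis .
qed

text \<open>Independence is given for the sigma-algebras of whole sequences, whereas the data see
  only a finite part; measurable functions of independent variables are independent.\<close>

lemma (in prob_space) indep_distr_pair:
  assumes ind: "indep_set (sets (vimage_algebra (space M) f N)) (sets (vimage_algebra (space M) g N'))"
    and f: "f \<in> M \<rightarrow>\<^sub>M N" and g: "g \<in> M \<rightarrow>\<^sub>M N'" and a: "a \<in> N \<rightarrow>\<^sub>M L" and b: "b \<in> N' \<rightarrow>\<^sub>M L'"
  shows "distr M (L \<Otimes>\<^sub>M L') (\<lambda>\<omega>. (a (f \<omega>), b (g \<omega>))) = distr M L (\<lambda>\<omega>. a (f \<omega>)) \<Otimes>\<^sub>M distr M L' (\<lambda>\<omega>. b (g \<omega>))"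
proof -
  have af [measurable]: "(\<lambda>\<omega>. a (f \<omega>)) \<in> M \<rightarrow>\<^sub>M L" and bg [measurable]: "(\<lambda>\<omega>. b (g \<omega>)) \<in> M \<rightarrow>\<^sub>M L'"
    using measurable_compose[OF f a] measurable_compose[OF g b] by auto
  interpret D1: prob_space "distr M L (\<lambda>\<omega>. a (f \<omega>))" by (rule prob_space_distr[OF af])
  interpret D2: prob_space "distr M L' (\<lambda>\<omega>. b (g \<omega>))" by (rule prob_space_distr[OF bg])
  have sub: "(\<lambda>\<omega>. a (f \<omega>)) -` A \<inter> space M \<in> sets (vimage_algebra (space M) f N)"
    if f: "f \<in> M \<rightarrow>\<^sub>M N" and a: "a \<in> N \<rightarrow>\<^sub>M L" and A: "A \<in> sets L" for f a A and N :: "'z measure" and L :: "'y measure"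
  proof -
    have "f \<in> vimage_algebra (space M) f N \<rightarrow>\<^sub>M N"
      using f by (intro measurable_vimage_algebra1) (auto simp: measurable_def)
    then have "(\<lambda>\<omega>. a (f \<omega>)) \<in> vimage_algebra (space M) f N \<rightarrow>\<^sub>M L" using a by (rule measurable_compose)
    from measurable_sets[OF this A] show ?thesis by simp
  qed
  show ?thesis
  proof (rule pair_measure_eqI[symmetric])
    fix A B assume "A \<in> sets (distr M L (\<lambda>\<omega>. a (f \<omega>)))" "B \<in> sets (distr M L' (\<lambda>\<omega>. b (g \<omega>)))"
    then have AB [measurable]: "A \<in> sets L" "B \<in> sets L'" by auto
    have "emeasure (distr M (L \<Otimes>\<^sub>M L') (\<lambda>\<omega>. (a (f \<omega>), b (g \<omega>)))) (A \<times> B) =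
       emeasure M (((\<lambda>\<omega>. a (f \<omega>)) -` A \<inter> space M) \<inter> ((\<lambda>\<omega>. b (g \<omega>)) -` B \<inter> space M))"
      by (subst emeasure_distr) (auto intro!: arg_cong[where f="emeasure M"])
    also have "\<dots> = emeasure M ((\<lambda>\<omega>. a (f \<omega>)) -` A \<inter> space M) * emeasure M ((\<lambda>\<omega>. b (g \<omega>)) -` B \<inter> space M)"
      using indep_setD[OF ind sub[OF f a AB(1)] sub[OF g b AB(2)]] by (simp add: emeasure_eq_measure ennreal_mult)
    finally show "emeasure (distr M L (\<lambda>\<omega>. a (f \<omega>))) A * emeasure (distr M L' (\<lambda>\<omega>. b (g \<omega>))) B =
        emeasure (distr M (L \<Otimes>\<^sub>M L') (\<lambda>\<omega>. (a (f \<omega>), b (g \<omega>)))) (A \<times> B)"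
      by (simp add: emeasure_distr)
  qed (auto simp: D1.sigma_finite_measure_axioms D2.sigma_finite_measure_axioms)
qed

locale white_noise_sample = prob_space Q for Q :: "'q measure" +
  fixes S1 S2 :: "real set" and Xs :: "nat \<Rightarrow> 'q \<Rightarrow> real \<Rightarrow> real"
    and \<epsilon> :: "nat \<Rightarrow> 'q \<Rightarrow> (real \<Rightarrow> real) \<Rightarrow> real" and \<sigma> :: real
  assumes \<sigma>: "\<sigma> > 0"
    and Xs_measurable: "\<And>i. i \<ge> 1 \<Longrightarrow> Xs i \<in> Q \<rightarrow>\<^sub>M path_space S1"
    and noise: "\<And>i. i \<ge> 1 \<Longrightarrow> white_noise Q S2 \<sigma> (\<epsilon> i)"
    and noise_indep: "indep_vars (\<lambda>_. noise_space S2) (\<lambda>i \<omega>. restrict (\<epsilon> i \<omega>) (L2 (leb S2))) {1..}"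
    and X_noise_indep: "indep_set
      (sets (vimage_algebra (space Q) (\<lambda>\<omega>. \<lambda>i\<in>{1..}. Xs i \<omega>)
        (PiM {1..} (\<lambda>_. path_space S1))))
      (sets (vimage_algebra (space Q) (\<lambda>\<omega>. \<lambda>i\<in>{1..}. restrict (\<epsilon> i \<omega>) (L2 (leb S2)))
        (PiM {1..} (\<lambda>_. noise_space S2))))"
begin

abbreviation "LS2 \<equiv> L2 (leb S2)"

text \<open>All \<open>n\<close> noise processes become one Gaussian process indexed by pairs, so
  that a single shift acts on all observations at once.\<close>

abbreviation index :: "nat \<Rightarrow> (nat \<times> (real \<Rightarrow> real)) set" where
  "index n \<equiv> {1..n} \<times> LS2"

abbreviation G :: "nat \<Rightarrow> (nat \<times> (real \<Rightarrow> real) \<Rightarrow> real) measure" where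
  "G n \<equiv> PiM (index n) (\<lambda>_. borel)"

abbreviation PX :: "nat \<Rightarrow> (nat \<Rightarrow> real \<Rightarrow> real) measure" where
  "PX n \<equiv> PiM {1..n} (\<lambda>_. path_space S1)"

definition all_noise :: "nat \<Rightarrow> 'q \<Rightarrow> nat \<times> (real \<Rightarrow> real) \<Rightarrow> real" where
  "all_noise n \<omega> = (\<lambda>(i, g)\<in>index n. \<epsilon> i \<omega> g)"

definition all_paths :: "nat \<Rightarrow> 'q \<Rightarrow> nat \<Rightarrow> real \<Rightarrow> real" where
  "all_paths n \<omega> = (\<lambda>i\<in>{1..n}. Xs i \<omega>)"

definition \<kappa> :: "nat \<times> (real \<Rightarrow> real) \<Rightarrow> nat \<times> (real \<Rightarrow> real) \<Rightarrow> real" where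
  "\<kappa> = (\<lambda>(i, g) (j, g'). if i = j then \<sigma>\<^sup>2 * L2_inner (leb S2) g g' else 0)"

definition noise_law :: "nat \<Rightarrow> (nat \<times> (real \<Rightarrow> real) \<Rightarrow> real) measure" where
  "noise_law n = distr Q (G n) (all_noise n)"

definition path_law :: "nat \<Rightarrow> (nat \<Rightarrow> real \<Rightarrow> real) measure" where
  "path_law n = distr Q (PX n) (all_paths n)"

lemma noise_measurable: "i \<ge> 1 \<Longrightarrow> (\<lambda>\<omega>. restrict (\<epsilon> i \<omega>) LS2) \<in> Q \<rightarrow>\<^sub>M noise_space S2"
  using noise_indep by (auto simp: indep_vars_def)

text \<open>The product form lets covariates be held fixed by Fubini, without conditional
  distributions.\<close>

lemma joint_law: "distr Q (PX n \<Otimes>\<^sub>M G n) (\<lambda>\<omega>. (all_paths n \<omega>, all_noise n \<omega>)) = path_law n \<Otimes>\<^sub>M noise_law n"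
    and all_paths_measurable [measurable]: "all_paths n \<in> Q \<rightarrow>\<^sub>M PX n"
    and all_noise_measurable [measurable]: "all_noise n \<in> Q \<rightarrow>\<^sub>M G n"
proof -
  have a: "(\<lambda>x. restrict x {1..n}) \<in> PiM {1..} (\<lambda>_. path_space S1) \<rightarrow>\<^sub>M PX n"
    by (rule measurable_restrict_subset) auto
  have b: "(\<lambda>y. \<lambda>(i, g)\<in>index n. y i g) \<in> PiM {1..} (\<lambda>_. noise_space S2) \<rightarrow>\<^sub>M G n"
  proof (rule measurable_restrict)
    fix j assume "j \<in> index n"
    then obtain i g where j: "j = (i, g)" "i \<in> {1..}" "g \<in> LS2" by auto
    have "(\<lambda>y. y i g) \<in> borel_measurable (PiM {1..} (\<lambda>_. noise_space S2))"
      using measurable_compose[OF measurable_component_singleton[OF j(2), of "\<lambda>_. noise_space S2"]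
          measurable_component_singleton[OF j(3), of "\<lambda>_. borel"]] .
    then show "(\<lambda>y. case j of (i, g) \<Rightarrow> y i g) \<in> PiM {1..} (\<lambda>_. noise_space S2) \<rightarrow>\<^sub>M borel"
      by (simp add: j)
  qed
  have f: "(\<lambda>\<omega>. \<lambda>i\<in>{1..}. Xs i \<omega>) \<in> Q \<rightarrow>\<^sub>M PiM {1..} (\<lambda>_. path_space S1)"
    by (intro measurable_restrict Xs_measurable) auto
  have g: "(\<lambda>\<omega>. \<lambda>i\<in>{1..}. restrict (\<epsilon> i \<omega>) LS2) \<in> Q \<rightarrow>\<^sub>M PiM {1..} (\<lambda>_. noise_space S2)"
    by (intro measurable_restrict noise_measurable) auto
  have p: "all_paths n = (\<lambda>\<omega>. restrict (\<lambda>i\<in>{1..}. Xs i \<omega>) {1..n})"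
    by (auto simp: all_paths_def fun_eq_iff restrict_def)
  have q: "all_noise n = (\<lambda>\<omega>. \<lambda>(i, g)\<in>index n. (\<lambda>i\<in>{1..}. restrict (\<epsilon> i \<omega>) LS2) i g)"
    by (auto simp: all_noise_def fun_eq_iff restrict_def)
  show "distr Q (PX n \<Otimes>\<^sub>M G n) (\<lambda>\<omega>. (all_paths n \<omega>, all_noise n \<omega>)) = path_law n \<Otimes>\<^sub>M noise_law n"
    using indep_distr_pair[OF X_noise_indep f g a b] unfolding path_law_def noise_law_def p q .
  show "all_paths n \<in> Q \<rightarrow>\<^sub>M PX n" "all_noise n \<in> Q \<rightarrow>\<^sub>M G n"
    unfolding p q by (rule measurable_compose[OF f a], rule measurable_compose[OF g b])
qed

lemma char_single:
  assumes i: "i \<ge> 1" and J: "finite J" "J \<subseteq> LS2"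
  shows "(CLINT \<omega>|Q. iexp (\<Sum>g\<in>J. t g * \<epsilon> i \<omega> g)) =
    exp (- (\<Sum>g\<in>J. \<Sum>g'\<in>J. t g * t g' * (\<sigma>\<^sup>2 * L2_inner (leb S2) g g')) / 2)"
proof -
  obtain e where e: "bij_betw e {..<card J} J" using ex_bij_betw_nat_finite[OF J(1)] by (auto simp: lessThan_atLeast0)
  have s: "(\<Sum>k<card J. f (e k)) = (\<Sum>g\<in>J. f g)" for f :: "_ \<Rightarrow> real"
    by (rule sum.reindex_bij_betw[OF e])
  have "\<forall>k<card J. e k \<in> L2 (leb S2)" using e J(2) by (auto simp: bij_betw_def)
  then have "centred_gaussian Q (\<lambda>\<omega>. \<Sum>k<card J. t (e k) * \<epsilon> i \<omega> (e k))
      (\<sigma>\<^sup>2 * (L2_norm (leb S2) (\<lambda>x. \<Sum>k<card J. t (e k) * e k x))\<^sup>2)"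
    using noise[OF i, unfolded white_noise_def, rule_format, of "card J" e "\<lambda>k. t (e k)"] by blast
  then have cg: "centred_gaussian Q (\<lambda>\<omega>. \<Sum>g\<in>J. t g * \<epsilon> i \<omega> g) (\<sigma>\<^sup>2 * (L2_norm (leb S2) (\<lambda>x. \<Sum>g\<in>J. t g * g x))\<^sup>2)"
    using s[of "\<lambda>g. t g * \<epsilon> i _ g"] s[of "\<lambda>g. t g * g _"] by simp
  have "(L2_norm (leb S2) (\<lambda>x. \<Sum>g\<in>J. t g * g x))\<^sup>2 = (\<Sum>g\<in>J. \<Sum>g'\<in>J. t g * t g' * L2_inner (leb S2) g g')"
    by (rule L2_norm_sum_sq) (use J in auto)
  then have eq: "\<sigma>\<^sup>2 * (L2_norm (leb S2) (\<lambda>x. \<Sum>g\<in>J. t g * g x))\<^sup>2 =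
      (\<Sum>g\<in>J. \<Sum>g'\<in>J. t g * t g' * (\<sigma>\<^sup>2 * L2_inner (leb S2) g g'))"
    by (simp add: sum_distrib_left mult.left_commute mult.assoc)
  show ?thesis
    using centred_gaussian_char[OF prob_space_axioms cg] unfolding eq[symmetric] by simp
qed

lemma gaussian_noise: "gaussian_process (noise_law n) (index n) \<kappa>"
proof -
  interpret N: prob_space "noise_law n"
    unfolding noise_law_def by (rule prob_space_distr) measurable
  show ?thesis
  proof
    show "sets (noise_law n) = sets (G n)" by (simp add: noise_law_def)
    show "\<kappa> i j = \<kappa> j i" for i j by (auto simp: \<kappa>_def L2_inner_commute split: prod.split)
    fix J and t :: "nat \<times> (real \<Rightarrow> real) \<Rightarrow> real"
    assume J: "finite J" "J \<subseteq> index n"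
    define Ji where "Ji i = {g. (i, g) \<in> J}" for i
    have Ji: "finite (Ji i)" "Ji i \<subseteq> LS2" for i
    proof -
      have "Ji i \<subseteq> snd ` J" by (force simp: Ji_def)
      then show "finite (Ji i)" using J(1) finite_subset by blast
      show "Ji i \<subseteq> LS2" using J(2) by (auto simp: Ji_def)
    qed
    \<comment> \<open>Slicing the index set by observation separates the independent factors;
      between different observations \<open>\<kappa>\<close> is zero.\<close>
    have JS: "J = Sigma {1..n} Ji" using J(2) by (auto simp: Ji_def)
    have sumJ: "(\<Sum>j\<in>J. f j) = (\<Sum>i\<in>{1..n}. \<Sum>g\<in>Ji i. f (i, g))" for f :: "_ \<Rightarrow> real"
      unfolding JS using Ji by (subst sum.Sigma) auto
    define U where "U i \<omega> = (\<Sum>g\<in>Ji i. t (i, g) * \<epsilon> i \<omega> g)" for i \<omega>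
    have mJ: "(\<lambda>y. \<Sum>j\<in>J. t j * y j) \<in> borel_measurable (G n)"
    proof (intro borel_measurable_sum borel_measurable_times borel_measurable_const)
      fix j assume "j \<in> J"
      then have "j \<in> index n" using J by auto
      then show "(\<lambda>y. y j) \<in> borel_measurable (G n)"
        by (rule measurable_component_singleton[where M="\<lambda>_. borel"])
    qed
    have ind: "indep_vars (\<lambda>_. borel) (\<lambda>i \<omega>. iexp (U i \<omega>)) {1..n}"
    proof -
      have "indep_vars (\<lambda>_. noise_space S2) (\<lambda>i \<omega>. restrict (\<epsilon> i \<omega>) LS2) {1..n}"
        by (rule indep_vars_subset[OF noise_indep]) auto
      then have "indep_vars (\<lambda>_. borel) (\<lambda>i \<omega>. iexp (\<Sum>g\<in>Ji i. t (i, g) * restrict (\<epsilon> i \<omega>) LS2 g)) {1..n}"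
      proof (rule indep_vars_compose2)
        fix i
        have um: "(\<lambda>y. \<Sum>g\<in>Ji i. t (i, g) * y g) \<in> borel_measurable (noise_space S2)"
        proof (intro borel_measurable_sum borel_measurable_times borel_measurable_const)
          fix g assume "g \<in> Ji i"
          then have "g \<in> LS2" using Ji by auto
          then show "(\<lambda>y. y g) \<in> borel_measurable (noise_space S2)"
            by (rule measurable_component_singleton[where M="\<lambda>_. borel"])
        qed
        have "iexp \<in> borel_measurable borel" by measurable
        from measurable_compose[OF um this]
        show "(\<lambda>y. iexp (\<Sum>g\<in>Ji i. t (i, g) * y g)) \<in> borel_measurable (noise_space S2)" .
      qed
      moreover have "(\<Sum>g\<in>Ji i. t (i, g) * restrict (\<epsilon> i \<omega>) LS2 g) = U i \<omega>" for i \<omega>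
        unfolding U_def using Ji[of i] by (intro sum.cong) auto
      ultimately show ?thesis by (simp only:)
    qed
    have "(CLINT y|noise_law n. iexp (\<Sum>j\<in>J. t j * y j)) = (CLINT \<omega>|Q. iexp (\<Sum>j\<in>J. t j * all_noise n \<omega> j))"
    proof -
      have ie: "iexp \<in> borel_measurable borel" by measurable
      show ?thesis
        unfolding noise_law_def by (rule integral_distr[OF all_noise_measurable measurable_compose[OF mJ ie]])
    qed
    also have "(\<lambda>\<omega>. \<Sum>j\<in>J. t j * all_noise n \<omega> j) = (\<lambda>\<omega>. \<Sum>i\<in>{1..n}. U i \<omega>)"
    proof
      fix \<omega>
      have "(\<Sum>j\<in>J. t j * all_noise n \<omega> j) = (\<Sum>i\<in>{1..n}. \<Sum>g\<in>Ji i. t (i, g) * all_noise n \<omega> (i, g))" by (rule sumJ)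
      also have "\<dots> = (\<Sum>i\<in>{1..n}. U i \<omega>)"
        unfolding U_def using Ji by (intro sum.cong refl) (auto simp: all_noise_def)
      finally show "(\<Sum>j\<in>J. t j * all_noise n \<omega> j) = (\<Sum>i\<in>{1..n}. U i \<omega>)" .
    qed
    also have "(\<lambda>\<omega>. iexp (\<Sum>i\<in>{1..n}. U i \<omega>)) = (\<lambda>\<omega>. \<Prod>i\<in>{1..n}. iexp (U i \<omega>))"
      by (simp add: exp_sum sum_distrib_left)
    also have "(CLINT \<omega>|Q. (\<Prod>i\<in>{1..n}. iexp (U i \<omega>))) = (\<Prod>i\<in>{1..n}. CLINT \<omega>|Q. iexp (U i \<omega>))"
    proof (rule indep_vars_lebesgue_integral[OF _ ind])
      fix i assume i: "i \<in> {1..n}"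
      have "(\<lambda>\<omega>. iexp (U i \<omega>)) \<in> borel_measurable Q" using ind i by (auto simp: indep_vars_def)
      then show "integrable Q (\<lambda>\<omega>. iexp (U i \<omega>))" by (intro integrable_const_bound[of _ 1]) auto
    qed simp
    also have "\<dots> = (\<Prod>i\<in>{1..n}. exp (- (\<Sum>g\<in>Ji i. \<Sum>g'\<in>Ji i. t (i, g) * t (i, g') * (\<sigma>\<^sup>2 * L2_inner (leb S2) g g')) / 2))"
      unfolding U_def of_real_prod using Ji by (intro prod.cong refl char_single) auto
    also have "\<dots> = exp (\<Sum>i\<in>{1..n}. - (\<Sum>g\<in>Ji i. \<Sum>g'\<in>Ji i. t (i, g) * t (i, g') * (\<sigma>\<^sup>2 * L2_inner (leb S2) g g')) / 2)"
      by (simp add: exp_sum)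
    also have "(\<Sum>i\<in>{1..n}. - (\<Sum>g\<in>Ji i. \<Sum>g'\<in>Ji i. t (i, g) * t (i, g') * (\<sigma>\<^sup>2 * L2_inner (leb S2) g g')) / 2) =
       - (\<Sum>i\<in>J. \<Sum>j\<in>J. t i * t j * \<kappa> i j) / 2"
    proof -
      have "(\<Sum>j\<in>{1..n}. \<Sum>g'\<in>Ji j. t (i, g) * t (j, g') * \<kappa> (i, g) (j, g')) =
         (\<Sum>g'\<in>Ji i. t (i, g) * t (i, g') * (\<sigma>\<^sup>2 * L2_inner (leb S2) g g'))" if "i \<in> {1..n}" for i g
      proof -
        have "(\<Sum>j\<in>{1..n}. \<Sum>g'\<in>Ji j. t (i, g) * t (j, g') * \<kappa> (i, g) (j, g')) =
          (\<Sum>j\<in>{1..n}. if j = i then \<Sum>g'\<in>Ji i. t (i, g) * t (i, g') * (\<sigma>\<^sup>2 * L2_inner (leb S2) g g') else 0)"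
          by (intro sum.cong refl) (auto simp: \<kappa>_def intro!: sum.neutral)
        then show ?thesis using that by simp
      qed
      then show ?thesis by (simp add: sumJ sum_negf sum_divide_distrib)
    qed
    finally show "(CLINT y|noise_law n. iexp (\<Sum>j\<in>J. t j * y j)) = exp (- (\<Sum>i\<in>J. \<Sum>j\<in>J. t i * t j * \<kappa> i j) / 2)"
      by (simp flip: exp_of_real)
  qed
qed

end

section \<open>Indistinguishability of orthogonal signals\<close>

context white_noise_sample
begin

definition observe :: "nat \<Rightarrow> (nat \<Rightarrow> real \<Rightarrow> real) \<Rightarrow> (nat \<times> (real \<Rightarrow> real) \<Rightarrow> real) \<Rightarrow> sample" where
  "observe n x y = (\<lambda>i\<in>{1..n}. (x i, \<lambda>g\<in>LS2. y (i, g)))"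

text \<open>Noise plus the pairing of the regression function \<open>h (x i) * g0\<close> with
  \<open>g\<close>.\<close>

definition shifted :: "nat \<Rightarrow> ((real \<Rightarrow> real) \<Rightarrow> real) \<Rightarrow> (real \<Rightarrow> real) \<Rightarrow> (nat \<Rightarrow> real \<Rightarrow> real) \<Rightarrow>
    (nat \<times> (real \<Rightarrow> real) \<Rightarrow> real) \<Rightarrow> nat \<times> (real \<Rightarrow> real) \<Rightarrow> real" where
  "shifted n h g0 x y = (\<lambda>(i, g)\<in>index n. y (i, g) + h (x i) * L2_inner (leb S2) g0 g)"

abbreviation "SM n \<equiv> PiM {1..n} (\<lambda>_. path_space S1 \<Otimes>\<^sub>M noise_space S2)"

lemma observe_measurable: "(\<lambda>(x, y). observe n x y) \<in> PX n \<Otimes>\<^sub>M G n \<rightarrow>\<^sub>M SM n"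
  unfolding observe_def case_prod_beta'
proof (intro measurable_restrict measurable_Pair)
  fix i assume i: "i \<in> {1..n}"
  show "(\<lambda>z. fst z i) \<in> PX n \<Otimes>\<^sub>M G n \<rightarrow>\<^sub>M path_space S1"
    by (rule measurable_compose[OF measurable_fst measurable_component_singleton[OF i, of "\<lambda>_. path_space S1"]])
  fix g assume "g \<in> LS2"
  then have "(i, g) \<in> index n" using i by simp
  then show "(\<lambda>z. snd z (i, g)) \<in> PX n \<Otimes>\<^sub>M G n \<rightarrow>\<^sub>M borel"
    by (rule measurable_compose[OF measurable_snd measurable_component_singleton[of _ _ "\<lambda>_. borel"]])
qed

lemma shifted_measurable:
  assumes h: "h \<in> borel_measurable (path_space S1)"
  shows "(\<lambda>(x, y). shifted n h g0 x y) \<in> PX n \<Otimes>\<^sub>M G n \<rightarrow>\<^sub>M G n"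
  unfolding shifted_def case_prod_beta'
proof (rule measurable_restrict)
  fix j assume j: "j \<in> index n"
  then have i: "fst j \<in> {1..n}" by auto
  have "(\<lambda>z. snd z j) \<in> PX n \<Otimes>\<^sub>M G n \<rightarrow>\<^sub>M borel"
    by (rule measurable_compose[OF measurable_snd measurable_component_singleton[OF j, of "\<lambda>_. borel"]])
  moreover have "(\<lambda>z. h (fst z (fst j))) \<in> PX n \<Otimes>\<^sub>M G n \<rightarrow>\<^sub>M borel"
    by (rule measurable_compose[OF measurable_compose[OF measurable_fst
          measurable_component_singleton[OF i, of "\<lambda>_. path_space S1"]] h])
  ultimately show "(\<lambda>z. snd z (fst j, snd j) + h (fst z (fst j)) * L2_inner (leb S2) g0 (snd j)) \<in> PX n \<Otimes>\<^sub>M G n \<rightarrow>\<^sub>M borel"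
    by (simp add: borel_measurable_add borel_measurable_times)
qed

lemma observe_shifted_pair_measurable:
  assumes h: "h \<in> borel_measurable (path_space S1)"
  shows "(\<lambda>z. observe n (fst z) (shifted n h g0 (fst z) (snd z))) \<in> PX n \<Otimes>\<^sub>M G n \<rightarrow>\<^sub>M SM n"
  using measurable_compose[OF measurable_Pair[OF measurable_fst shifted_measurable[OF h, of n g0]] observe_measurable]
  by (simp add: case_prod_beta')

abbreviation signal_data :: "nat \<Rightarrow> ((real \<Rightarrow> real) \<Rightarrow> real) \<Rightarrow> (real \<Rightarrow> real) \<Rightarrow> 'q \<Rightarrow> sample" where
  "signal_data n h g0 \<omega> \<equiv> observe n (all_paths n \<omega>) (shifted n h g0 (all_paths n \<omega>) (all_noise n \<omega>))"

lemma signal_data_measurable: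
  assumes h: "h \<in> borel_measurable (path_space S1)"
  shows "signal_data n h g0 \<in> Q \<rightarrow>\<^sub>M SM n"
proof -
  have pm: "(\<lambda>\<omega>. (all_paths n \<omega>, all_noise n \<omega>)) \<in> Q \<rightarrow>\<^sub>M PX n \<Otimes>\<^sub>M G n" by measurable
  show ?thesis using measurable_compose[OF pm observe_shifted_pair_measurable[OF h]] by simp
qed

lemma prob_space_path_law: "prob_space (path_law n)"
  unfolding path_law_def by (rule prob_space_distr) measurable

lemma prob_space_noise_law: "prob_space (noise_law n)"
  unfolding noise_law_def by (rule prob_space_distr) measurable

text \<open>With the covariates fixed, adding the signal is a Cameron-Martin shift. Its variance is
  the sum of \<open>(h (x i))^2 / \<sigma>^2\<close>, the same for every unit vector
  \<open>g0\<close>.\<close>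

lemma shifted_prob_le:
  assumes g0: "g0 \<in> LS2" "L2_inner (leb S2) g0 g0 = 1"
    and h: "\<And>i. i \<in> {1..n} \<Longrightarrow> \<bar>h (x i)\<bar> \<le> B" and K: "K \<ge> 1"
    and D: "D \<in> sets (G n)"
  shows "measure (noise_law n) {y \<in> space (G n). shifted n h g0 x y \<in> D} \<le>
    K * measure (noise_law n) D + exp (n * B\<^sup>2 / \<sigma>\<^sup>2) / K"
proof -
  interpret gp: gaussian_process "noise_law n" "index n" \<kappa> by (rule gaussian_noise)
  have sets: "sets (noise_law n) = sets (G n)" "space (noise_law n) = space (G n)"
    by (simp_all add: noise_law_def)
  define J0 where "J0 = {1..n} \<times> {g0}"
  \<comment> \<open>The division by \<open>\<sigma>^2\<close> cancels the factor in
    \<open>\<kappa>\<close>, so that \<open>cov\<close> is the signal itself.\<close>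
  define a where "a j = h (x (fst j)) / \<sigma>\<^sup>2" for j :: "nat \<times> (real \<Rightarrow> real)"
  have J0: "finite J0" "J0 \<subseteq> index n" using g0 by (auto simp: J0_def)
  have sumJ0: "(\<Sum>j\<in>J0. F j) = (\<Sum>i\<in>{1..n}. F (i, g0))" for F :: "_ \<Rightarrow> real"
    unfolding J0_def by (rule sum.reindex_bij_witness[where i="\<lambda>i. (i, g0)" and j=fst]) auto
  have cov: "gp.cov J0 a (i, g) = h (x i) * L2_inner (leb S2) g0 g" if "i \<in> {1..n}" for i g
  proof -
    have "gp.cov J0 a (i, g) = (\<Sum>j\<in>{1..n}. if j = i then h (x i) * L2_inner (leb S2) g0 g else 0)"
      unfolding gp.cov_def[OF J0] sumJ0 using \<sigma>
      by (intro sum.cong refl) (auto simp: a_def \<kappa>_def L2_inner_commute)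
    then show ?thesis using that by simp
  qed
  have vari: "gp.vari J0 a = (\<Sum>i\<in>{1..n}. (h (x i))\<^sup>2 / \<sigma>\<^sup>2)"
    unfolding gp.vari_eq[OF J0] sumJ0 by (intro sum.cong refl) (simp add: cov g0 a_def power2_eq_square)
  have vari_pos: "gp.vari J0 a > 0 \<or> (\<forall>j\<in>J0. a j = 0)"
  proof (cases "\<forall>i\<in>{1..n}. h (x i) = 0")
    case True
    then show ?thesis by (auto simp: J0_def a_def)
  next
    case False
    then obtain i where "i \<in> {1..n}" "h (x i) \<noteq> 0" by blast
    then have "gp.vari J0 a > 0" unfolding vari using \<sigma> by (intro sum_pos2[of _ i]) auto
    then show ?thesis ..
  qed
  have "gp.vari J0 a \<le> (\<Sum>i\<in>{1..n}. B\<^sup>2 / \<sigma>\<^sup>2)"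
    unfolding vari
  proof (intro sum_mono divide_right_mono)
    fix i assume "i \<in> {1..n}"
    then have "\<bar>h (x i)\<bar>\<^sup>2 \<le> B\<^sup>2" using h by (intro power_mono) auto
    then show "(h (x i))\<^sup>2 \<le> B\<^sup>2" by simp
  qed simp
  then have v: "gp.vari J0 a \<le> n * B\<^sup>2 / \<sigma>\<^sup>2" by simp
  have "shifted n h g0 x y = (\<lambda>j\<in>index n. y j + gp.cov J0 a j)" for y
    unfolding shifted_def by (auto simp: fun_eq_iff restrict_def cov)
  then have "measure (noise_law n) {y \<in> space (G n). shifted n h g0 x y \<in> D} \<le>
      K * measure (noise_law n) D + exp (gp.vari J0 a) / K"
    using gp.shift_bound[OF J0 vari_pos _ K, of D] D sets by simp
  also have "exp (gp.vari J0 a) / K \<le> exp (n * B\<^sup>2 / \<sigma>\<^sup>2) / K"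
    using v K by (intro divide_right_mono) auto
  finally show ?thesis by simp
qed

text \<open>The bound is proved for each fixed covariate vector and then integrated; vectors beyond
  the truncation contribute nothing.\<close>

lemma sum_regions_le:
  fixes N :: nat
  assumes h: "h \<in> borel_measurable (path_space S1)"
    and g: "\<And>k. k < N \<Longrightarrow> g k \<in> LS2" "\<And>k. k < N \<Longrightarrow> L2_inner (leb S2) (g k) (g k) = 1"
    and D: "\<And>k. k < N \<Longrightarrow> D k \<in> sets (SM n)" and disj: "disjoint_family_on D {..<N}" and K: "K \<ge> 1"
  shows "(\<Sum>k<N. prob {\<omega> \<in> space Q. (\<forall>i\<in>{1..n}. \<bar>h (Xs i \<omega>)\<bar> \<le> B) \<and>
      signal_data n h (g k) \<omega> \<in> D k})
    \<le> K + N * (exp (n * B\<^sup>2 / \<sigma>\<^sup>2) / K)"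
proof -
  interpret pl: prob_space "path_law n" by (rule prob_space_path_law)
  interpret nl: prob_space "noise_law n" by (rule prob_space_noise_law)
  define e where "e = exp (n * B\<^sup>2 / \<sigma>\<^sup>2) / K"
  have e0: "e \<ge> 0" using K by (simp add: e_def)
  define Bs where "Bs k = {z \<in> space (PX n \<Otimes>\<^sub>M G n). (\<forall>i\<in>{1..n}. \<bar>h (fst z i)\<bar> \<le> B) \<and>
      observe n (fst z) (shifted n h (g k) (fst z) (snd z)) \<in> D k}" for k
  have sets_l [measurable_cong]: "sets (path_law n) = sets (PX n)" "sets (noise_law n) = sets (G n)"
    by (simp_all add: path_law_def noise_law_def)
  have space_l: "space (path_law n) = space (PX n)" "space (noise_law n) = space (G n)"
    by (simp_all add: path_law_def noise_law_def)
  have Bs: "Bs k \<in> sets (PX n \<Otimes>\<^sub>M G n)" if k: "k < N" for k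
  proof -
    have 1: "{z \<in> space (PX n \<Otimes>\<^sub>M G n). \<forall>i\<in>{1..n}. \<bar>h (fst z i)\<bar> \<le> B} \<in> sets (PX n \<Otimes>\<^sub>M G n)"
    proof (rule sets.sets_Collect_finite_All)
      fix i assume i: "i \<in> {1..n}"
      have [measurable]: "(\<lambda>z. h (fst z i)) \<in> borel_measurable (PX n \<Otimes>\<^sub>M G n)"
        by (rule measurable_compose[OF measurable_compose[OF measurable_fst
             measurable_component_singleton[OF i, of "\<lambda>_. path_space S1"]] h])
      show "{z \<in> space (PX n \<Otimes>\<^sub>M G n). \<bar>h (fst z i)\<bar> \<le> B} \<in> sets (PX n \<Otimes>\<^sub>M G n)" by measurable
    qed simp_all
    have 2: "(\<lambda>z. observe n (fst z) (shifted n h (g k) (fst z) (snd z))) -` D k \<inter> space (PX n \<Otimes>\<^sub>M G n) \<in> sets (PX n \<Otimes>\<^sub>M G n)"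
      by (rule measurable_sets[OF observe_shifted_pair_measurable[OF h] D[OF k]])
    have "Bs k = {z \<in> space (PX n \<Otimes>\<^sub>M G n). \<forall>i\<in>{1..n}. \<bar>h (fst z i)\<bar> \<le> B} \<inter>
        ((\<lambda>z. observe n (fst z) (shifted n h (g k) (fst z) (snd z))) -` D k \<inter> space (PX n \<Otimes>\<^sub>M G n))"
      by (auto simp: Bs_def)
    then show ?thesis using 1 2 by auto
  qed
  let ?pair = "\<lambda>\<omega>. (all_paths n \<omega>, all_noise n \<omega>)"
  have pairm: "?pair \<in> Q \<rightarrow>\<^sub>M PX n \<Otimes>\<^sub>M G n" by measurable
  have ev: "{\<omega> \<in> space Q. (\<forall>i\<in>{1..n}. \<bar>h (Xs i \<omega>)\<bar> \<le> B) \<and>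
      signal_data n h (g k) \<omega> \<in> D k} = ?pair -` Bs k \<inter> space Q" for k
    using measurable_space[OF pairm] by (auto simp: Bs_def all_paths_def)
  have em: "ennreal (prob (?pair -` Bs k \<inter> space Q)) = (\<integral>\<^sup>+x. emeasure (noise_law n) (Pair x -` Bs k) \<partial>path_law n)" if k: "k < N" for k
  proof -
    have "ennreal (prob (?pair -` Bs k \<inter> space Q)) = emeasure (path_law n \<Otimes>\<^sub>M noise_law n) (Bs k)"
      unfolding joint_law[symmetric] using Bs[OF k] pairm by (simp add: emeasure_distr emeasure_eq_measure)
    also have "\<dots> = (\<integral>\<^sup>+x. emeasure (noise_law n) (Pair x -` Bs k) \<partial>path_law n)"
      by (rule nl.emeasure_pair_measure_alt) (use Bs[OF k] in \<open>simp cong: sets_pair_measure_cong add: sets_l\<close>)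
    finally show ?thesis .
  qed
  have sec: "(\<Sum>k<N. emeasure (noise_law n) (Pair x -` Bs k)) \<le> ennreal (K + N * e)" if x: "x \<in> space (PX n)" for x
  proof (cases "\<forall>i\<in>{1..n}. \<bar>h (x i)\<bar> \<le> B")
    case False
    then have "Pair x -` Bs k = {}" for k by (auto simp: Bs_def)
    then show ?thesis by simp
  next
    case True
    define Dx where "Dx k = {y \<in> space (G n). observe n x y \<in> D k}" for k
    have Dx: "Dx k \<in> sets (G n)" if "k < N" for k
    proof -
      have "(\<lambda>y. observe n x y) \<in> G n \<rightarrow>\<^sub>M SM n"
        using measurable_compose[OF measurable_Pair1'[OF x] observe_measurable] by simp
      from measurable_sets[OF this D[OF that]] show ?thesis by (simp add: Dx_def vimage_def Int_def conj_commute)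
    qed
    have sh: "shifted n h (g k) x y \<in> space (G n)" for k y
      by (simp add: shifted_def space_PiM)
    have "Pair x -` Bs k = {y \<in> space (G n). shifted n h (g k) x y \<in> Dx k}" for k
      using x True sh by (auto simp: Bs_def Dx_def space_pair_measure)
    then have "emeasure (noise_law n) (Pair x -` Bs k) \<le> ennreal (K * measure (noise_law n) (Dx k) + e)" if "k < N" for k
      unfolding nl.emeasure_eq_measure e_def using shifted_prob_le[OF g[OF that] _ K Dx[OF that], of h x B] True
      by (intro ennreal_leI) auto
    then have "(\<Sum>k<N. emeasure (noise_law n) (Pair x -` Bs k)) \<le> (\<Sum>k<N. ennreal (K * measure (noise_law n) (Dx k) + e))"
      by (intro sum_mono) auto
    also have "\<dots> = ennreal (\<Sum>k<N. K * measure (noise_law n) (Dx k) + e)"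
      using K e0 by (intro sum_ennreal) auto
    also have "\<dots> \<le> ennreal (K + N * e)"
    proof (rule ennreal_leI)
      \<comment> \<open>Under the common unshifted law the disjoint regions share total mass at most
        1. Hence \<open>K\<close> is paid once, while the error \<open>e\<close> is paid
        \<open>N\<close> times.\<close>
      have "(\<Sum>k<N. measure (noise_law n) (Dx k)) = measure (noise_law n) (\<Union>k<N. Dx k)"
      proof (rule nl.finite_measure_finite_Union[symmetric])
        show "disjoint_family_on Dx {..<N}"
          using disj unfolding disjoint_family_on_def Dx_def by blast
      qed (use Dx sets_l in auto)
      also have "\<dots> \<le> 1" by (rule nl.prob_le_1)
      finally have "K * (\<Sum>k<N. measure (noise_law n) (Dx k)) \<le> K * 1" using K by (intro mult_left_mono) auto
      then show "(\<Sum>k<N. K * measure (noise_law n) (Dx k) + e) \<le> K + N * e"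
        by (simp add: sum.distrib sum_distrib_left)
    qed
    finally show ?thesis .
  qed
  have secm: "(\<lambda>x. emeasure (noise_law n) (Pair x -` Bs k)) \<in> borel_measurable (path_law n)" if "k < N" for k
    by (rule nl.measurable_emeasure_Pair) (use Bs[OF that] in \<open>simp cong: sets_pair_measure_cong add: sets_l\<close>)
  have "ennreal (\<Sum>k<N. prob (?pair -` Bs k \<inter> space Q)) = (\<Sum>k<N. \<integral>\<^sup>+x. emeasure (noise_law n) (Pair x -` Bs k) \<partial>path_law n)"
    using em by (subst sum_ennreal[symmetric]) auto
  also have "\<dots> = (\<integral>\<^sup>+x. (\<Sum>k<N. emeasure (noise_law n) (Pair x -` Bs k)) \<partial>path_law n)"
    using secm by (intro nn_integral_sum[symmetric]) auto
  also have "\<dots> \<le> (\<integral>\<^sup>+x. ennreal (K + N * e) \<partial>path_law n)"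
    using sec by (intro nn_integral_mono) (auto simp: space_l)
  also have "\<dots> = ennreal (K + N * e)" by (simp add: pl.emeasure_space_1)
  finally show ?thesis
    using K e0 unfolding ev e_def[symmetric] by (subst (asm) ennreal_le_iff) auto
qed

text \<open>The average over the signals is at most \<open>K / N\<close> plus the error term, so
  some signal is missed. \<open>h\<close> may be unbounded, but the event that it exceeds
  \<open>m\<close> on the sample decreases to the empty set. \<open>N\<close> precedes
  \<open>g\<close> and \<open>D\<close>, so it depends on neither.\<close>

lemma indistinguishable:
  assumes h: "h \<in> borel_measurable (path_space S1)" and \<delta>: "\<delta> > 0"
  shows "\<exists>N::nat. \<forall>g D. (\<forall>k<N. g k \<in> LS2 \<and> L2_inner (leb S2) (g k) (g k) = 1 \<and> D k \<in> sets (SM n)) \<longrightarrow>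
      disjoint_family_on D {..<N} \<longrightarrow>
    (\<exists>k<N. prob {\<omega> \<in> space Q.
      signal_data n h (g k) \<omega> \<in> D k} \<le> \<delta>)"
proof -
  define E where "E m = {\<omega> \<in> space Q. \<exists>i\<in>{1..n}. \<bar>h (Xs i \<omega>)\<bar> > real m}" for m
  have hX [measurable]: "(\<lambda>\<omega>. h (Xs i \<omega>)) \<in> borel_measurable Q" if "i \<ge> 1" for i
    using measurable_compose[OF Xs_measurable[OF that] h] .
  have Em [measurable]: "E m \<in> sets Q" for m
    unfolding E_def
  proof (rule sets.sets_Collect_finite_Ex)
    fix i assume "i \<in> {1..n}"
    then have "i \<ge> 1" by simp
    from hX[OF this] show "{\<omega> \<in> space Q. \<bar>h (Xs i \<omega>)\<bar> > real m} \<in> sets Q" by measurable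
  qed simp
  have "(\<Inter>m. E m) = {}"
  proof (rule ccontr)
    assume "(\<Inter>m. E m) \<noteq> {}"
    then obtain \<omega> where w: "\<And>m. \<exists>i\<in>{1..n}. \<bar>h (Xs i \<omega>)\<bar> > real m" by (auto simp: E_def)
    obtain m where m: "(\<Sum>i\<in>{1..n}. \<bar>h (Xs i \<omega>)\<bar>) \<le> real m" using real_arch_simple by blast
    obtain i where i: "i \<in> {1..n}" "\<bar>h (Xs i \<omega>)\<bar> > real m" using w by blast
    have "\<bar>h (Xs i \<omega>)\<bar> \<le> (\<Sum>i\<in>{1..n}. \<bar>h (Xs i \<omega>)\<bar>)" using i by (intro member_le_sum) auto
    then show False using m i by linarith
  qed
  moreover have "decseq E"
    unfolding decseq_def
  proof (intro allI impI)
    fix m m' :: nat assume "m \<le> m'"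
    then have "\<bar>z\<bar> > real m" if "\<bar>z\<bar> > real m'" for z :: real using that by linarith
    then show "E m' \<subseteq> E m" unfolding E_def by blast
  qed
  ultimately have "(\<lambda>m. prob (E m)) \<longlonglongrightarrow> 0"
    using finite_Lim_measure_decseq[of E] Em by (simp add: image_subset_iff)
  then obtain m where m: "prob (E m) < \<delta> / 2"
    using \<delta> by (metis LIMSEQ_D half_gt_zero order_refl real_norm_def diff_zero abs_of_nonneg measure_nonneg)
  define V where "V = exp (n * (real m)\<^sup>2 / \<sigma>\<^sup>2)"
  \<comment> \<open>This \<open>K\<close> makes the error term at most \<open>\<delta> / 4\<close>,
    and \<open>N > 4 * K / \<delta>\<close> does the same for \<open>K / N\<close>; the other
    \<open>\<delta> / 2\<close> is reserved for the event \<open>E m\<close>.\<close>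
  define K where "K = max 1 (4 * V / \<delta>)"
  have K: "K \<ge> 1" "V / K \<le> \<delta> / 4"
  proof -
    show "K \<ge> 1" by (simp add: K_def)
    have "4 * V / \<delta> \<le> K" by (simp add: K_def)
    then show "V / K \<le> \<delta> / 4" using \<delta> \<open>K \<ge> 1\<close> by (simp add: field_simps)
  qed
  obtain N :: nat where N: "4 * K / \<delta> < N" using reals_Archimedean2 by blast
  show ?thesis
  proof (rule exI[of _ N], intro allI impI)
    fix g D
    assume gD: "\<forall>k<N. g k \<in> LS2 \<and> L2_inner (leb S2) (g k) (g k) = 1 \<and> D k \<in> sets (SM n)"
      and disj: "disjoint_family_on D {..<N}"
    then have g: "\<And>k. k < N \<Longrightarrow> g k \<in> LS2" "\<And>k. k < N \<Longrightarrow> L2_inner (leb S2) (g k) (g k) = 1"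
      and D: "\<And>k. k < N \<Longrightarrow> D k \<in> sets (SM n)" by auto
    define ev where "ev k = {\<omega> \<in> space Q.
      signal_data n h (g k) \<omega> \<in> D k}" for k
    define ev' where "ev' k = {\<omega> \<in> space Q. (\<forall>i\<in>{1..n}. \<bar>h (Xs i \<omega>)\<bar> \<le> real m) \<and>
      signal_data n h (g k) \<omega> \<in> D k}" for k
    have sum: "(\<Sum>k<N. prob (ev' k)) \<le> K + N * (V / K)"
      unfolding ev'_def V_def by (rule sum_regions_le[OF h g D disj K(1)])
    have "\<exists>k<N. prob (ev' k) \<le> \<delta> / 2"
    proof (rule ccontr)
      assume "\<not> (\<exists>k<N. prob (ev' k) \<le> \<delta> / 2)"
      then have "(\<Sum>k<N. prob (ev' k)) \<ge> (\<Sum>k<N. \<delta> / 2)" by (intro sum_mono) (auto simp: not_le less_imp_le)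
      then have "N * (\<delta> / 2) \<le> (\<Sum>k<N. prob (ev' k))" by simp
      from this sum have "N * (\<delta> / 2) \<le> K + N * (V / K)" by (rule order_trans)
      also have "\<dots> \<le> K + N * (\<delta> / 4)" using K by (intro add_left_mono mult_left_mono) auto
      finally have "N * (\<delta> / 2) \<le> K + N * (\<delta> / 4)" .
      moreover have "N * (\<delta> / 2) = 2 * (N * (\<delta> / 4))" "N * \<delta> = 4 * (N * (\<delta> / 4))" by simp_all
      ultimately have "N * \<delta> \<le> 4 * K" by linarith
      moreover have "4 * K < N * \<delta>"
        using N \<delta> by (simp add: field_simps)
      ultimately show False by simp
    qed
    then obtain k where k: "k < N" "prob (ev' k) \<le> \<delta> / 2" by blast
    have evm: "ev k \<in> sets Q"
      using measurable_sets[OF signal_data_measurable[OF h] D[OF k(1)], of "g k"] by (simp add: ev_def vimage_def Int_def conj_commute)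
    have eq: "ev' k = ev k - E m" by (auto simp: ev'_def ev_def E_def not_less)
    have "prob (ev k) \<le> prob ((ev k - E m) \<union> E m)"
      using evm by (intro finite_measure_mono) auto
    also have "\<dots> \<le> prob (ev k - E m) + prob (E m)"
      using evm by (intro measure_Un_le) auto
    finally have "prob (ev k) \<le> \<delta>" using k(2) m unfolding eq by linarith
    then show "\<exists>k<N. prob {\<omega> \<in> space Q.
      signal_data n h (g k) \<omega> \<in> D k} \<le> \<delta>"
      using k(1) unfolding ev_def by blast
  qed
qed

end

section \<open>Arbitrarily long orthonormal families\<close>

text \<open>Cells of length \<open>m / N\<close> cover \<open>S\<close>, and each contains at most
  measure \<open>m / N\<close> of it. The total is \<open>m\<close>, so at least \<open>N\<close>
  cells meet \<open>S\<close> in positive measure.\<close>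

lemma ex_disjoint_positive_subsets:
  fixes S :: "real set"
  assumes S: "compact S" and pos: "emeasure lborel S > 0"
  shows "\<exists>C. (\<forall>k<N. C k \<in> sets borel \<and> C k \<subseteq> S \<and> measure lborel (C k) > 0) \<and> disjoint_family_on C {..<N::nat}"
proof (cases "N = 0")
  case True
  then show ?thesis by (auto simp: disjoint_family_on_def)
next
  case False
  have Sm [measurable]: "S \<in> sets borel" using S by (simp add: compact_imp_closed)
  have fin: "emeasure lborel S < \<infinity>" by (rule emeasure_compact_finite[OF S])
  define m where "m = measure lborel S"
  have m: "m > 0" using pos fin by (simp add: m_def measure_def enn2real_positive_iff)
  define d where "d = m / N"
  have d: "d > 0" using m False by (simp add: d_def)
  obtain B where B: "\<And>x. x \<in> S \<Longrightarrow> \<bar>x\<bar> \<le> B" using compact_imp_bounded[OF S] by (auto simp: bounded_iff)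
  \<comment> \<open>Enough cells to reach from \<open>- B\<close> past \<open>B\<close>.\<close>
  obtain M :: nat where M: "(2 * B) / d < M" using reals_Archimedean2 by blast
  define c where "c j = {- B + real j * d ..< - B + real (Suc j) * d} \<inter> S" for j
  have cm [measurable]: "c j \<in> sets borel" for j unfolding c_def by measurable
  have cS: "c j \<subseteq> S" for j by (auto simp: c_def)
  have cfin: "emeasure lborel (c j) \<noteq> \<infinity>" for j
  proof -
    have "emeasure lborel (c j) \<le> emeasure lborel S" using Sm by (intro emeasure_mono[OF cS]) simp
    then have "emeasure lborel (c j) < \<infinity>" using fin by (rule le_less_trans)
    then show ?thesis by simp
  qed
  have disj: "disjoint_family_on c A" for A
  proof (unfold disjoint_family_on_def, intro ballI impI, rule ccontr)
    fix i j assume "i \<noteq> j" "c i \<inter> c j \<noteq> {}"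
    then obtain x where x: "x \<in> c i" "x \<in> c j" by blast
    have "real i * d < real (Suc j) * d" "real j * d < real (Suc i) * d" using x by (auto simp: c_def)
    then have "i < Suc j" "j < Suc i" using d by (auto simp del: of_nat_Suc)
    then show False using \<open>i \<noteq> j\<close> by simp
  qed
  have cover: "S = (\<Union>j<M. c j)"
  proof (intro equalityI subsetI)
    fix x assume x: "x \<in> S"
    define j where "j = nat \<lfloor>(x + B) / d\<rfloor>"
    have nn: "0 \<le> (x + B) / d" using B[OF x] d by (intro divide_nonneg_pos) auto
    then have j: "real j \<le> (x + B) / d" "(x + B) / d < real j + 1" unfolding j_def by linarith+
    have "(x + B) / d \<le> (2 * B) / d" using B[OF x] d by (intro divide_right_mono) auto
    then have "real j < real M" using j M by linarith
    moreover have "x \<in> c j" using j d x by (auto simp: c_def field_simps)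
    ultimately show "x \<in> (\<Union>j<M. c j)" by auto
  qed (use cS in auto)
  define J where "J = {j. j < M \<and> measure lborel (c j) > 0}"
  have cd: "measure lborel (c j) \<le> d" for j
  proof -
    have "emeasure lborel (c j) \<le> emeasure lborel {- B + real j * d ..< - B + real (Suc j) * d}"
      unfolding c_def by (intro emeasure_mono) auto
    also have "\<dots> = ennreal d" using d by (simp add: algebra_simps)
    finally show ?thesis using d cfin[of j] by (simp add: measure_def enn2real_leI)
  qed
  have "m = (\<Sum>j<M. measure lborel (c j))"
    unfolding m_def cover using cfin disj by (intro measure_finite_Union) auto
  also have "\<dots> = (\<Sum>j\<in>J. measure lborel (c j))"
    by (intro sum.mono_neutral_right) (auto simp: J_def less_le)
  also have "\<dots> \<le> (\<Sum>j\<in>J. d)" by (intro sum_mono cd)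
  finally have "real N * d \<le> card J * d" using False by (simp add: d_def)
  then have card: "N \<le> card J" using d by simp
  have "finite J" by (simp add: J_def)
  then obtain e where e: "bij_betw e {..<card J} J" using ex_bij_betw_nat_finite by (auto simp: lessThan_atLeast0)
  have eJ: "e k \<in> J" if "k < N" for k using e that card by (auto simp: bij_betw_def)
  have "disjoint_family_on (\<lambda>k. c (e k)) {..<N}"
    unfolding disjoint_family_on_def
  proof (intro ballI impI)
    fix i j assume "i \<in> {..<N}" "j \<in> {..<N}" "i \<noteq> j"
    then have "e i \<noteq> e j" using e card by (auto simp: bij_betw_def inj_on_def)
    then show "c (e i) \<inter> c (e j) = {}" using disj[of UNIV] by (auto simp: disjoint_family_on_def)
  qed
  then show ?thesis using eJ cS cm by (intro exI[of _ "\<lambda>k. c (e k)"]) (auto simp: J_def)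
qed

text \<open>Normalised indicators of disjoint sets are orthonormal.\<close>

lemma ex_orthonormal:
  fixes N :: nat
  assumes S: "compact S" and pos: "emeasure lborel S > 0"
  obtains g where "\<And>k. k < N \<Longrightarrow> g k \<in> L2 (leb S)"
    "\<And>j k. j < N \<Longrightarrow> k < N \<Longrightarrow> L2_inner (leb S) (g j) (g k) = (if j = k then 1 else 0)"
proof -
  have Sm: "S \<in> sets borel" using S by (simp add: compact_imp_closed)
  obtain C where C: "\<And>k. k < N \<Longrightarrow> C k \<in> sets borel" "\<And>k. k < N \<Longrightarrow> C k \<subseteq> S"
    "\<And>k. k < N \<Longrightarrow> measure lborel (C k) > 0" "disjoint_family_on C {..<N}"
    using ex_disjoint_positive_subsets[OF assms, of N] by blast
  interpret finite_measure "leb S" by (rule finite_measure_leb[OF S])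
  have Cs: "C k \<in> sets (leb S)" "measure (leb S) (C k) = measure lborel (C k)" if "k < N" for k
    using C(1)[OF that] C(2)[OF that] Sm by (auto simp: leb_def sets_restrict_space_iff measure_restrict_space)
  define g where "g k x = indicator (C k) x / sqrt (measure lborel (C k))" for k and x :: real
  have m [measurable]: "g k \<in> borel_measurable (leb S)" if "k < N" for k
    unfolding g_def[abs_def] using Cs(1)[OF that] by measurable
  have in_L2: "g k \<in> L2 (leb S)" if "k < N" for k
  proof -
    have "(g k x)\<^sup>2 = indicator (C k) x / measure lborel (C k)" for x
      using C(3)[OF that] by (simp add: g_def power_divide indicator_def)
    moreover have "integrable (leb S) (\<lambda>x. indicator (C k) x :: real)"
      using Cs(1)[OF that] by (intro integrable_real_indicator) (auto simp: less_top[symmetric] emeasure_finite)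
    ultimately show ?thesis using m[OF that] by (simp add: L2_def)
  qed
  have "L2_inner (leb S) (g j) (g k) = (if j = k then 1 else 0)" if jk: "j < N" "k < N" for j k
  proof (cases "j = k")
    case True
    have "g k x * g k x = indicator (C k) x / measure lborel (C k)" for x
      using C(3)[OF jk(2)] by (simp add: g_def indicator_def)
    then have "L2_inner (leb S) (g k) (g k) = measure (leb S) (C k) / measure lborel (C k)"
      using Cs(1)[OF jk(2)] sets.sets_into_space[OF Cs(1)[OF jk(2)]] by (simp add: L2_inner_def Int_absorb2)
    then show ?thesis using True Cs(2)[OF jk(2)] C(3)[OF jk(2)] by simp
  next
    case False
    then have "C j \<inter> C k = {}" using C(4) jk by (auto simp: disjoint_family_on_def)
    then have z: "g j x * g k x = 0" for x by (auto simp: g_def indicator_def)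
    show ?thesis unfolding L2_inner_def z using False by simp
  qed
  then show ?thesis using in_L2 that by blast
qed

section \<open>The lower bound\<close>

locale regression_eigen = regression_operator P S1 S2 p X
  for P :: "'w measure" and S1 S2 p X +
  fixes \<eta> \<mu>1 :: real and f w :: "(nat \<Rightarrow> real) l2fam"
  assumes S2_pos: "emeasure lborel S2 > 0"
    and spec: "spectrum p (coef S1 S2) (AA_op p S1 S2 P X) \<subseteq> {0..\<eta>}"
    and f: "f \<in> L2_sum p (cube S1)" "L2_sum_norm p (cube S1) f = 1"
    and w: "is_Gamma p S1 P X f w" "L2_sum_norm p (cube S1) (w - \<mu>1 *\<^sub>R f) = 0"
    and \<mu>1: "\<mu>1 > 0"
begin

lemma f_unit: "L2_sum_inner p (cube S1) f f = 1"
  using f LS.nrm_sq[OF f(1)] by (simp add: LS_nrm)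

lemma nrm_etens: "g \<in> L2 (leb S2) \<Longrightarrow> LS.nrm p (coef S1 S2) (etens g f) = L2_norm (leb S2) g"
  unfolding LS.nrm_def by (simp add: inner_etens_etens[OF S1 S2 _ _ f(1)] f_unit L2_norm_def)

lemma etens_in_H: "g \<in> L2 (leb S2) \<Longrightarrow> etens g f \<in> H"
  by (rule etens_in[OF S1 S2 _ f(1)])

lemma etens_eigen: "g \<in> L2 (leb S2) \<Longrightarrow> LS.nrm p (coef S1 S2) (T (etens g f) - \<mu>1 *\<^sub>R etens g f) = 0"
  by (rule T_etens_eigen[OF _ f(1) w])

text \<open>Positive measure of \<open>S2\<close> supplies a unit vector \<open>g\<close>, so that
  \<open>etens g f\<close> is an eigenvector that is not null.\<close>

lemma \<mu>1_in_spectrum: "\<mu>1 \<in> spectrum p (coef S1 S2) T"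
proof -
  obtain g where g: "\<And>k. k < (1::nat) \<Longrightarrow> g k \<in> L2 (leb S2)"
    "\<And>j k. j < 1 \<Longrightarrow> k < 1 \<Longrightarrow> L2_inner (leb S2) (g j) (g k) = (if j = k then 1 else (0::real))"
    using ex_orthonormal[OF S2 S2_pos, of 1] by blast
  then have "g 0 \<in> L2 (leb S2)" "L2_norm (leb S2) (g 0) = 1" by (auto simp: L2_norm_def)
  then show ?thesis using eigenvalue_in_spectrum[OF etens_in_H etens_eigen] by (simp add: nrm_etens)
qed

lemma \<mu>1_le: "\<mu>1 \<le> \<eta>"
  using \<mu>1_in_spectrum spec by auto

sublocale symmetric_op H ip T "spectrum p (coef S1 S2) T" \<eta>
  using \<mu>1_in_spectrum spec by (intro symmetric_op_T) auto

lemma op_poly_eq: "op_poly q T u = opp q u"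
  by (simp add: op_poly_def opp_def fun_eq_iff)

abbreviation "ofun \<equiv> op_fun p (coef S1 S2) T"

lemma is_fun_op_fun:
  assumes "continuous_on {0..\<eta>} F" "u \<in> H"
  shows "is_fun F u (ofun F u)"
proof -
  have "ofun F u = (SOME w. is_fun F u w)"
    unfolding op_fun_def is_fun_def op_poly_eq L2_sum_dist_eq LS_nrm ..
  then show ?thesis using someI_ex[OF is_fun_exists[OF assms]] by simp
qed

abbreviation "nrm \<equiv> LS.nrm p (coef S1 S2)"

definition fnorm :: "(real \<Rightarrow> real) \<Rightarrow> (real \<times> (nat \<Rightarrow> real)) l2fam \<Rightarrow> real" where
  "fnorm F u = norm_LL2 p S1 S2 (ofun F u)"

lemma fnorm_nrm: "fnorm F u = nrm (ofun F u)"
  by (simp add: fnorm_def LS_nrm)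

text \<open>Makes the loss a continuous function of the estimate, so that the regions of
  \<open>minimax_risk\<close> are measurable.\<close>

lemma fnorm_lipschitz:
  assumes F: "continuous_on {0..\<eta>} F"
  obtains C where "\<And>u v. u \<in> H \<Longrightarrow> v \<in> H \<Longrightarrow> \<bar>fnorm F u - fnorm F v\<bar> \<le> C * nrm (u - v)"
proof -
  obtain C where C: "\<And>u w. u \<in> H \<Longrightarrow> is_fun F u w \<Longrightarrow> nrm w \<le> C * nrm u" using is_fun_bdd[OF F] by blast
  have "\<bar>fnorm F u - fnorm F v\<bar> \<le> C * nrm (u - v)" if uv: "u \<in> H" "v \<in> H" for u v
  proof -
    note i = is_fun_op_fun[OF F uv(1)] is_fun_op_fun[OF F uv(2)]
    have "\<bar>fnorm F u - fnorm F v\<bar> \<le> nrm (ofun F u - ofun F v)"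
      unfolding fnorm_nrm using i by (intro LS.nrm_diff_le) (auto simp: is_fun_def)
    also have "\<dots> \<le> C * nrm (u - v)" by (rule C[OF LS.H_diff[OF uv] is_fun_diff[OF F uv i]])
    finally show ?thesis .
  qed
  then show ?thesis using that by blast
qed

text \<open>\<open>u - v\<close> is an eigenvector, so its image is \<open>F \<mu>1\<close> times
  itself and is also the difference of the images of \<open>u\<close> and \<open>v\<close>. One
  estimate therefore cannot be close to two signals.\<close>

lemma fnorm_separation:
  assumes F: "continuous_on {0..\<eta>} F" and uv: "u \<in> H" "v \<in> H" and eq: "u - v = etens g f" and g: "g \<in> L2 (leb S2)"
  shows "\<bar>F \<mu>1\<bar> * L2_norm (leb S2) g \<le> fnorm F u + fnorm F v"
proof -
  let ?a = "ofun F u" and ?b = "ofun F v"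
  note i = is_fun_op_fun[OF F uv(1)] is_fun_op_fun[OF F uv(2)]
  have H: "?a \<in> H" "?b \<in> H" using i by (auto simp: is_fun_def)
  have gH: "etens g f \<in> H" by (rule etens_in_H[OF g])
  have "nrm ((?a - ?b) - F \<mu>1 *\<^sub>R etens g f) = 0"
    using is_fun_unique[OF F gH] is_fun_diff[OF F uv i] is_fun_eigenvector[OF gH etens_eigen[OF g] \<mu>1_in_spectrum]
    unfolding eq by blast
  then have "nrm (F \<mu>1 *\<^sub>R etens g f) = nrm (?a - ?b)"
    using LS.nrm_diff_le[where u="?a - ?b" and v="F \<mu>1 *\<^sub>R etens g f" and p=p and M="coef S1 S2"] H gH by auto
  also have "\<dots> \<le> nrm ?a + nrm ?b" using H by (rule LS.nrm_triangle_diff)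
  finally show ?thesis using gH g by (simp add: LS.nrm_scale nrm_etens fnorm_nrm)
qed

text \<open>The source element is \<open>R\<close> times the tensor of \<open>g\<close> and
  \<open>f\<close>, of norm exactly \<open>R\<close>; the operator \<open>\<phi>(T)\<close>
  multiplies it by \<open>\<phi> \<mu>1\<close>.\<close>

lemma etens_in_source_set:
  assumes \<phi>: "continuous_on {0..\<eta>} \<phi>" and R: "R > 0" and g: "g \<in> L2 (leb S2)" "L2_inner (leb S2) g g = 1"
  shows "etens (\<lambda>t. \<phi> \<mu>1 * R * g t) f \<in> source_set p S1 S2 P X \<phi> R"
proof -
  define v where "v = etens (\<lambda>t. R * g t) f"
  have Rg: "(\<lambda>t. R * g t) \<in> L2 (leb S2)" by (rule L2_scale[OF g(1)])
  have vH: "v \<in> H" unfolding v_def by (rule etens_in_H[OF Rg])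
  have "L2_norm (leb S2) (\<lambda>t. R * g t) = sqrt (R\<^sup>2 * L2_inner (leb S2) g g)"
    by (simp add: L2_norm_def L2_inner_def power2_eq_square mult_ac flip: integral_mult_right_zero)
  then have "L2_norm (leb S2) (\<lambda>t. R * g t) = R" using g R by simp
  then have "norm_LL2 p S1 S2 v \<le> R" using nrm_etens[OF Rg] by (simp add: v_def LS_nrm)
  moreover have eq: "etens (\<lambda>t. \<phi> \<mu>1 * R * g t) f = \<phi> \<mu>1 *\<^sub>R v"
    by (simp add: v_def etens_def fun_eq_iff)
  moreover have "nrm (\<phi> \<mu>1 *\<^sub>R v - ofun \<phi> v) = 0"
    using is_fun_unique[OF \<phi> vH] is_fun_eigenvector[OF vH _ \<mu>1_in_spectrum] etens_eigen[OF Rg]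
      is_fun_op_fun[OF \<phi> vH] unfolding v_def by blast
  ultimately show ?thesis
    using vH unfolding source_set_def by (auto simp: L2_sum_dist_eq LS_nrm)
qed

end

text \<open>The threshold \<open>\<theta>\<close> involves neither \<open>n\<close> nor
  \<open>\<delta>\<close>: taking more signals drives the success probability down without bringing
  the signals closer together.\<close>

lemma minimax_risk:
  fixes \<theta> :: real
  assumes eigen: "regression_eigen P S1 S2 p X \<eta> \<mu>1 f w"
    and sample: "white_noise_sample Q S1 S2 Xs \<epsilon> \<sigma>"
    and \<phi>: "continuous_on {0..\<eta>} \<phi>" "\<phi> \<mu>1 > 0" and R: "R > 0"
    and F: "continuous_on {0..\<eta>} F" "F \<mu>1 > 0"
    and \<theta>: "2 * \<theta> \<le> F \<mu>1 * (\<phi> \<mu>1 * R)"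
    and bhat: "bhat \<in> estimators p S1 S2 n" and \<delta>: "\<delta> > 0"
  shows "\<exists>\<beta>\<in>source_set p S1 S2 P X \<phi> R. 1 - \<delta> \<le> measure Q {\<omega> \<in> space Q.
     \<theta> \<le> norm_LL2 p S1 S2 (op_fun p (coef S1 S2) (AA_op p S1 S2 P X) F
        (\<lambda>l z. bhat (data p S1 S2 Xs \<epsilon> n \<beta> \<omega>) l z - \<beta> l z))}"
proof -
  interpret E: regression_eigen P S1 S2 p X \<eta> \<mu>1 f w by (rule eigen)
  interpret W: white_noise_sample Q S1 S2 Xs \<epsilon> \<sigma> by (rule sample)
  define c where "c = \<phi> \<mu>1 * R"
  have c: "c > 0" using \<phi> R by (simp add: c_def)
  \<comment> \<open>The scalar by which the regression function of every \<open>\<beta> k\<close>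
    multiplies \<open>g k\<close>.\<close>
  define h where "h x = c * L2_sum_inner p (cube S1) (tens x) f" for x
  have h: "h \<in> borel_measurable (path_space S1)"
    unfolding h_def[abs_def] using tens_inner_measurable[OF E.S1 E.f(1)] by simp
  obtain N :: nat where N: "\<forall>g D. (\<forall>k<N. g k \<in> W.LS2 \<and> L2_inner (leb S2) (g k) (g k) = 1 \<and> D k \<in> sets (W.SM n)) \<longrightarrow>
      disjoint_family_on D {..<N} \<longrightarrow>
    (\<exists>k<N. W.prob {\<omega> \<in> space Q.
      W.signal_data n h (g k) \<omega> \<in> D k} \<le> \<delta>)"
    using W.indistinguishable[OF h \<delta>, of n] by blast
  obtain g where g: "\<And>k. k < N \<Longrightarrow> g k \<in> L2 (leb S2)"
    "\<And>j k. j < N \<Longrightarrow> k < N \<Longrightarrow> L2_inner (leb S2) (g j) (g k) = (if j = k then 1 else 0)"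
    using ex_orthonormal[OF E.S2 E.S2_pos, of N] by blast
  define \<beta> where "\<beta> k = etens (\<lambda>t. c * g k t) f" for k
  have \<beta>H: "\<beta> k \<in> E.H" if "k < N" for k
    unfolding \<beta>_def by (rule E.etens_in_H[OF L2_scale[OF g(1)[OF that]]])
  have bm: "bhat \<in> W.SM n \<rightarrow>\<^sub>M borel_dist E.H (L2_sum_dist p (coef S1 S2))"
    using bhat by (simp add: estimators_def)
  have bH: "bhat z \<in> E.H" if "z \<in> space (W.SM n)" for z
    using measurable_space[OF bm that] by simp
  have Dm: "{z \<in> space (W.SM n). E.fnorm F (bhat z - \<beta> k) < \<theta>} \<in> sets (W.SM n)" if k: "k < N" for k
  proof -
    obtain C where C: "\<And>u v. u \<in> E.H \<Longrightarrow> v \<in> E.H \<Longrightarrow> \<bar>E.fnorm F u - E.fnorm F v\<bar> \<le> C * E.nrm (u - v)"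
      using E.fnorm_lipschitz[OF F(1)] by blast
    have "(\<lambda>u. E.fnorm F (u - \<beta> k)) \<in> borel_measurable (borel_dist E.H (L2_sum_dist p (coef S1 S2)))"
    proof (rule borel_dist_measurableI)
      fix u and e :: real assume u: "u \<in> E.H" and e: "e > 0"
      have "\<bar>E.fnorm F (u - \<beta> k) - E.fnorm F (v - \<beta> k)\<bar> < e"
        if v: "v \<in> E.H" and d: "L2_sum_dist p (coef S1 S2) u v < e / (\<bar>C\<bar> + 1)" for v
      proof -
        have "\<bar>E.fnorm F (u - \<beta> k) - E.fnorm F (v - \<beta> k)\<bar> \<le> C * E.nrm (u - v)"
          using C[of "u - \<beta> k" "v - \<beta> k"] u v \<beta>H[OF k] by simp
        also have "\<dots> \<le> (\<bar>C\<bar> + 1) * E.nrm (u - v)" using u v by (intro mult_right_mono) auto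
        also have "\<dots> < e" using d by (simp add: L2_sum_dist_eq LS_nrm field_simps)
        finally show ?thesis .
      qed
      then show "\<exists>r>0. \<forall>v\<in>E.H. L2_sum_dist p (coef S1 S2) u v < r \<longrightarrow>
          \<bar>E.fnorm F (u - \<beta> k) - E.fnorm F (v - \<beta> k)\<bar> < e"
        using e by (intro exI[of _ "e / (\<bar>C\<bar> + 1)"]) auto
    qed
    from measurable_compose[OF bm this] show ?thesis by measurable
  qed
  define D where "D k = {z \<in> space (W.SM n). E.fnorm F (bhat z - \<beta> k) < \<theta>}" for k
  have disj: "disjoint_family_on D {..<N}"
    unfolding disjoint_family_on_def
  proof (intro ballI impI, rule ccontr)
    fix j k assume jk: "j \<in> {..<N}" "k \<in> {..<N}" "j \<noteq> k" and "D j \<inter> D k \<noteq> {}"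
    then obtain z where z: "z \<in> space (W.SM n)" "E.fnorm F (bhat z - \<beta> j) < \<theta>" "E.fnorm F (bhat z - \<beta> k) < \<theta>"
      by (auto simp: D_def)
    \<comment> \<open>Subtracting the two errors cancels the estimate and leaves the tensor of
      \<open>d\<close> and \<open>f\<close>. By orthonormality \<open>d\<close> has squared norm
      \<open>2 * c^2\<close>, so its norm is at least \<open>c\<close>, the separation that
      \<open>2 * \<theta> \<le> F \<mu>1 * c\<close> asks for.\<close>
    define d where "d t = c * g k t - c * g j t" for t
    have jN: "j < N" "k < N" using jk by auto
    have L: "(\<lambda>t. c * g k t) \<in> L2 (leb S2)" "(\<lambda>t. c * g j t) \<in> L2 (leb S2)" using g(1) jN by (auto intro: L2_scale)
    have d: "d \<in> L2 (leb S2)" unfolding d_def[abs_def] by (rule L2_diff[OF L])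
    have "L2_inner (leb S2) d d = (\<integral>t. c\<^sup>2 * (g k t * g k t) - 2 * c\<^sup>2 * (g k t * g j t) + c\<^sup>2 * (g j t * g j t) \<partial>leb S2)"
      by (simp add: L2_inner_def d_def power2_eq_square algebra_simps)
    also have "\<dots> = c\<^sup>2 * L2_inner (leb S2) (g k) (g k) - 2 * c\<^sup>2 * L2_inner (leb S2) (g k) (g j) + c\<^sup>2 * L2_inner (leb S2) (g j) (g j)"
      unfolding L2_inner_def using L2_integrable_mult[OF g(1) g(1)] jN by simp
    also have "\<dots> = 2 * c\<^sup>2" using g(2) jN jk(3) by simp
    finally have "(L2_norm (leb S2) d)\<^sup>2 = 2 * c\<^sup>2" by (simp add: L2_norm_sq)
    then have "c\<^sup>2 \<le> (L2_norm (leb S2) d)\<^sup>2" by simp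
    then have nd: "c \<le> L2_norm (leb S2) d" by (rule power2_le_imp_le) simp
    have "(bhat z - \<beta> j) - (bhat z - \<beta> k) = etens d f"
      by (simp add: \<beta>_def d_def etens_def fun_eq_iff left_diff_distrib)
    from E.fnorm_separation[OF F(1) _ _ this d] have "\<bar>F \<mu>1\<bar> * L2_norm (leb S2) d < \<theta> + \<theta>"
      using z bH[OF z(1)] \<beta>H jN by fastforce
    moreover have "F \<mu>1 * c \<le> F \<mu>1 * L2_norm (leb S2) d" using nd F(2) by simp
    moreover have "\<bar>F \<mu>1\<bar> = F \<mu>1" using F(2) by simp
    ultimately show False using \<theta> unfolding c_def[symmetric] by simp
  qed
  have obs: "data p S1 S2 Xs \<epsilon> n (\<beta> k) \<omega> =
      W.signal_data n h (g k) \<omega>" for k \<omega>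
  proof -
    have "L2_inner (leb S2) (poly_reg p S1 (\<beta> k) x) u = h x * L2_inner (leb S2) (g k) u" for x u
      by (simp add: L2_inner_def \<beta>_def poly_reg_etens h_def mult_ac flip: integral_mult_right_zero)
    then show ?thesis
      by (auto simp: data_def W.observe_def W.all_paths_def W.shifted_def W.all_noise_def fun_eq_iff restrict_def)
  qed
  obtain k where k: "k < N" "W.prob {\<omega> \<in> space Q. data p S1 S2 Xs \<epsilon> n (\<beta> k) \<omega> \<in> D k} \<le> \<delta>"
    using N[rule_format, of g D] g Dm disj unfolding obs D_def by auto
  have dm: "data p S1 S2 Xs \<epsilon> n (\<beta> k) \<in> Q \<rightarrow>\<^sub>M W.SM n"
    unfolding obs by (rule W.signal_data_measurable[OF h])
  have Dk: "{\<omega> \<in> space Q. data p S1 S2 Xs \<epsilon> n (\<beta> k) \<omega> \<in> D k} \<in> W.events"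
    using measurable_sets[OF dm, of "D k"] Dm[OF k(1)] by (simp add: D_def vimage_def Int_def conj_commute)
  have "{\<omega> \<in> space Q. \<theta> \<le> norm_LL2 p S1 S2 (op_fun p (coef S1 S2) (AA_op p S1 S2 P X) F
        (\<lambda>l z. bhat (data p S1 S2 Xs \<epsilon> n (\<beta> k) \<omega>) l z - \<beta> k l z))} =
      space Q - {\<omega> \<in> space Q. data p S1 S2 Xs \<epsilon> n (\<beta> k) \<omega> \<in> D k}"
    using measurable_space[OF dm] unfolding L2_sum_diff_eq E.fnorm_def[symmetric] by (auto simp: D_def)
  then have "measure Q {\<omega> \<in> space Q. \<theta> \<le> norm_LL2 p S1 S2 (op_fun p (coef S1 S2) (AA_op p S1 S2 P X) F
        (\<lambda>l z. bhat (data p S1 S2 Xs \<epsilon> n (\<beta> k) \<omega>) l z - \<beta> k l z))} \<ge> 1 - \<delta>"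
    using W.prob_compl[OF Dk] k(2) by simp
  moreover have "\<beta> k \<in> source_set p S1 S2 P X \<phi> R"
    unfolding \<beta>_def c_def by (rule E.etens_in_source_set[OF \<phi>(1) R]) (use g k in auto)
  ultimately show ?thesis by blast
qed

section \<open>Decay of the rate and the conclusion\<close>

lemma continuous_on_power_fun: "s \<ge> 0 \<Longrightarrow> continuous_on {0..\<eta>} (power_fun s)"
  unfolding power_fun_def[abs_def]
  by (cases "s = 0") (auto intro!: continuous_on_powr' continuous_on_id continuous_on_const)

text \<open>Injectivity gives \<open>psi \<phi> b x0 \<noteq> 0\<close> at a small
  \<open>x0 > 0\<close>. For large \<open>n\<close> the intermediate value theorem then places the
  preimage of \<open>n powr (- 1 / 2)\<close> in \<open>{0..x0}\<close>, where \<open>\<phi>\<close>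
  is below \<open>e\<close> and the power is at most 1.\<close>

lemma rate_tendsto_0:
  assumes \<eta>: "\<eta> > 0" and \<phi>: "continuous_on {0..\<eta>} \<phi>" "mono_on {0..\<eta>} \<phi>" "\<phi> 0 = 0"
    and b: "b > 1" and inj: "inj_on (psi \<phi> b) {0..\<eta>}" and s: "s \<ge> 0" and e: "e > 0"
  shows "\<forall>\<^sub>F n in sequentially. rate \<phi> b \<eta> s n \<le> e"
proof -
  have nonneg: "0 \<le> \<phi> x" if "x \<in> {0..\<eta>}" for x
    using mono_onD[OF \<phi>(2), of 0 x] that \<eta> \<phi>(3) by auto
  obtain d where d: "d > 0" "\<And>x. x \<in> {0..\<eta>} \<Longrightarrow> \<bar>x\<bar> < d \<Longrightarrow> \<bar>\<phi> x\<bar> < e"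
    using \<phi>(1)[unfolded continuous_on_iff, rule_format, of 0 e] \<eta> e \<phi>(3) by (auto simp: dist_real_def)
  define x0 where "x0 = min (d / 2) (min 1 \<eta>)"
  have x0: "x0 > 0" "x0 \<le> \<eta>" "x0 \<le> 1" "x0 < d" using d \<eta> by (auto simp: x0_def)
  have psi0: "psi \<phi> b 0 = 0" by (simp add: psi_def)
  have "psi \<phi> b x0 \<noteq> psi \<phi> b 0" using inj_onD[OF inj, of x0 0] x0 \<eta> by auto
  moreover have "psi \<phi> b x0 \<ge> 0" unfolding psi_def using nonneg[of x0] x0 by simp
  ultimately have pos: "psi \<phi> b x0 > 0" using psi0 by simp
  have g: "1 / 2 + 1 / (2 * b) > 0" using b by (simp add: add_pos_pos)
  have cont: "continuous_on {0..x0} (psi \<phi> b)"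
    unfolding psi_def[abs_def] using x0 g
    by (intro continuous_on_mult continuous_on_subset[OF \<phi>(1)] continuous_on_powr' continuous_intros) auto
  have "(\<lambda>n. real n powr (- 1 / 2)) \<longlonglongrightarrow> 0"
    using tendsto_neg_powr[of "-1/2" "\<lambda>n. real n" sequentially] filterlim_real_sequentially by simp
  then have "\<forall>\<^sub>F n in sequentially. real n powr (- 1 / 2) < psi \<phi> b x0"
    using pos by (rule order_tendstoD(2))
  then show ?thesis
  proof eventually_elim
    case (elim n)
    then obtain x where x: "0 \<le> x" "x \<le> x0" "psi \<phi> b x = real n powr (- 1 / 2)"
      using IVT'[of "psi \<phi> b" 0 "real n powr (- 1 / 2)" x0] x0 psi0 cont by auto
    then have "the_inv_into {0..\<eta>} (psi \<phi> b) (real n powr (- 1 / 2)) = x"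
      using x0 by (intro the_inv_into_f_eq[OF inj]) auto
    then have "rate \<phi> b \<eta> s n = \<phi> x * x powr s" by (simp add: rate_def)
    also have "\<dots> \<le> e * 1"
    proof (rule mult_mono)
      show "\<phi> x \<le> e" using d(2)[of x] x x0 by force
      show "x powr s \<le> 1" using powr_le1[of s x] x x0 s by simp
    qed (use e in auto)
    finally show ?case by simp
  qed
qed

theorem theorem4p3:
  fixes S1 S2 :: "real set" and p :: nat
    and P :: "'w measure" and X :: "'w \<Rightarrow> real \<Rightarrow> real"
    and Q :: "'q measure" and Xs :: "nat \<Rightarrow> 'q \<Rightarrow> real \<Rightarrow> real"
    and \<epsilon> :: "nat \<Rightarrow> 'q \<Rightarrow> (real \<Rightarrow> real) \<Rightarrow> real"
    and \<mu> :: "nat \<Rightarrow> real" and \<phi> :: "real \<Rightarrow> real"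
    and \<sigma> \<eta> R b s :: real
  assumes S1: "compact S1" and S2: "compact S2" "emeasure lborel S2 > 0"
    \<comment> \<open>if S2 is a null set, the parameter space is {0} and the claim fails\<close>
    and p: "p \<ge> 1"
    \<comment> \<open>the process X and the operators built from it\<close>
    and P: "prob_space P"
    and X_paths: "X \<in> P \<rightarrow>\<^sub>M path_space S1"
    and X_joint: "(\<lambda>(\<omega>, t). X \<omega> t) \<in> borel_measurable (P \<Otimes>\<^sub>M leb S1)"
    and A_bounded: "\<forall>u\<in>LL2 p S1 S2. A_op p S1 X u \<in> L2 (P \<Otimes>\<^sub>M leb S2)"
      "\<exists>C. \<forall>u\<in>LL2 p S1 S2. L2_norm (P \<Otimes>\<^sub>M leb S2) (A_op p S1 X u) \<le> C * norm_LL2 p S1 S2 u"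
    and Gamma_bounded: "\<forall>f\<in>L2_sum p (cube S1). \<exists>w. is_Gamma p S1 P X f w"
      "bounded_op p (cube S1) (Gamma_op p S1 P X)"
    and spec: "spectrum p (coef S1 S2) (AA_op p S1 S2 P X) \<subseteq> {0..\<eta>}"
    \<comment> \<open>the sample\<close>
    and Q: "prob_space Q"
    and X_indep: "prob_space.indep_vars Q (\<lambda>_. path_space S1) Xs {1..}"
    and X_distr: "\<forall>i\<ge>1. distr Q (path_space S1) (Xs i) = distr P (path_space S1) X"
    and sigma: "\<sigma> > 0"
    and noise: "\<forall>i\<ge>1. white_noise Q S2 \<sigma> (\<epsilon> i)"
    and noise_indep: "prob_space.indep_vars Q (\<lambda>_. noise_space S2)
      (\<lambda>i \<omega>. restrict (\<epsilon> i \<omega>) (L2 (leb S2))) {1..}"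
    and X_noise_indep: "prob_space.indep_set Q
      (sets (vimage_algebra (space Q) (\<lambda>\<omega>. \<lambda>i\<in>{1..}. Xs i \<omega>)
        (PiM {1..} (\<lambda>_. path_space S1))))
      (sets (vimage_algebra (space Q) (\<lambda>\<omega>. \<lambda>i\<in>{1..}. restrict (\<epsilon> i \<omega>) (L2 (leb S2)))
        (PiM {1..} (\<lambda>_. noise_space S2))))"
    \<comment> \<open>the source condition and the eigenvalue decay\<close>
    and R: "R > 0"
    and phi: "continuous_on {0..\<eta>} \<phi>" "mono_on {0..\<eta>} \<phi>" "\<phi> 0 = 0"
    and b: "b > 1"
    and mu: "eigenvalue_list p (cube S1) (Gamma_op p S1 P X) \<mu>"
    and mu_lower: "\<exists>C>0. \<forall>i\<ge>1. real i powr (- b) \<le> C * \<mu> i"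
    and mu_upper: "\<exists>C>0. \<forall>i\<ge>1. \<mu> i \<le> C * real i powr (- b)"
    and psi_inv: "inj_on (psi \<phi> b) {0..\<eta>}"
    and s: "0 \<le> s" "s \<le> 1 / 2"
  shows "\<exists>L. (\<forall>a>0. (\<lambda>n. INF bhat\<in>estimators p S1 S2 n.
              SUP \<beta>\<in>source_set p S1 S2 P X \<phi> R.
                measure Q {\<omega> \<in> space Q.
                  norm_LL2 p S1 S2
                    (op_fun p (coef S1 S2) (AA_op p S1 S2 P X) (power_fun s)
                      (\<lambda>l z. bhat (data p S1 S2 Xs \<epsilon> n \<beta> \<omega>) l z - \<beta> l z))
                  \<ge> a * rate \<phi> b \<eta> s n}) \<longlonglongrightarrow> L a)
           \<and> (L \<longlongrightarrow> 1) (at_right 0)"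
  proof -
  interpret prob_space Q by (rule Q)
  let ?T = "AA_op p S1 S2 P X" and ?M = "coef S1 S2"
  let ?G = "Gamma_op p S1 P X"
  obtain K where "K > 0" "\<And>i. i \<ge> 1 \<Longrightarrow> real i powr (- b) \<le> K * \<mu> i" using mu_lower by blast
  then have \<mu>1: "\<mu> 1 > 0" by (smt (verit) of_nat_1 order_refl powr_one_eq_one zero_less_mult_pos)
  \<comment> \<open>The index set \<open>{1}\<close> witnesses multiplicity at least 1, so there is
    an eigenvector that is not null.\<close>
  have "has_indep_eigenvectors p (cube S1) ?G (\<mu> 1) 1"
    using mu \<mu>1 unfolding eigenvalue_list_def by (auto intro!: exI[of _ "{1::nat}"])
  then obtain F where F: "F (0::nat) \<in> L2_sum p (cube S1)"
    "L2_sum_dist p (cube S1) (?G (F 0)) (\<lambda>l x. \<mu> 1 * F 0 l x) = 0"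
    "\<And>a. L2_sum_norm p (cube S1) (\<lambda>l x. \<Sum>k<(1::nat). a k * F k l x) = 0 \<Longrightarrow> a 0 = 0"
    unfolding has_indep_eigenvectors_def by auto
  define z where "z = L2_sum_norm p (cube S1) (F 0)"
  have "z \<noteq> 0" using F(3)[of "\<lambda>_. 1"] by (auto simp: z_def)
  then have z: "z > 0" using LS.nrm_nonneg[OF F(1)] by (simp add: z_def LS_nrm)
  define f where "f = (1 / z) *\<^sub>R F 0"
  obtain v where v: "is_Gamma p S1 P X (F 0) v" using Gamma_bounded(1) F(1) by blast
  have GF: "is_Gamma p S1 P X (F 0) (?G (F 0))" unfolding Gamma_op_def
    by (rule someI[where P = "is_Gamma p S1 P X (F 0)", OF v])
  \<comment> \<open>\<open>?G f\<close> is a separate Hilbert choice and need not be this multiple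
    of \<open>?G (F 0)\<close>; the weak image of \<open>f\<close> is obtained by scaling
    instead.\<close>
  define w where "w = (1 / z) *\<^sub>R ?G (F 0)"
  have GFH: "?G (F 0) \<in> L2_sum p (cube S1)" using GF by (simp add: is_Gamma_def)
  have fH: "f \<in> L2_sum p (cube S1)" unfolding f_def using F(1) by (rule LS.H_scale)
  have f1: "L2_sum_norm p (cube S1) f = 1"
    unfolding f_def using LS.nrm_scale[OF F(1), of "1 / z"] z by (simp add: LS_nrm z_def)
  have wf: "L2_sum_norm p (cube S1) (w - \<mu> 1 *\<^sub>R f) = 0"
  proof -
    have "w - \<mu> 1 *\<^sub>R f = (1 / z) *\<^sub>R (?G (F 0) - \<mu> 1 *\<^sub>R F 0)"
      by (simp add: w_def f_def scaleR_diff_right)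
    moreover have "(\<lambda>l x. \<mu> 1 * F 0 l x) = \<mu> 1 *\<^sub>R F 0" by (simp add: fun_eq_iff)
    ultimately show ?thesis
      using F(1,2) GFH LS.nrm_scale[of "?G (F 0) - \<mu> 1 *\<^sub>R F 0" p "cube S1" "1 / z"] by (simp add: LS_nrm L2_sum_dist_eq)
  qed
  have wG: "is_Gamma p S1 P X f w"
    unfolding is_Gamma_def
  proof (intro conjI ballI)
    show "w \<in> L2_sum p (cube S1)" unfolding w_def using GFH by (rule LS.H_scale)
    fix g assume g: "g \<in> L2_sum p (cube S1)"
    have sc: "L2_sum_inner p (cube S1) (chi X \<omega>) f = (1 / z) * L2_sum_inner p (cube S1) (chi X \<omega>) (F 0)" for \<omega>
      by (simp add: f_def L2_sum_inner_def L2_inner_def sum_distrib_left mult.left_commute sum_divide_distrib)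
    show "integrable P (\<lambda>\<omega>. L2_sum_inner p (cube S1) (chi X \<omega>) f * L2_sum_inner p (cube S1) (chi X \<omega>) g)"
      using GF g unfolding is_Gamma_def sc mult.assoc by (intro integrable_mult_right) blast
    show "L2_sum_inner p (cube S1) w g =
        (\<integral>\<omega>. L2_sum_inner p (cube S1) (chi X \<omega>) f * L2_sum_inner p (cube S1) (chi X \<omega>) g \<partial>P)"
      using GF g GFH unfolding is_Gamma_def sc mult.assoc w_def by (simp add: LS.ip_scale)
  qed
  have eigen: "regression_eigen P S1 S2 p X \<eta> (\<mu> 1) f w"
    unfolding regression_eigen_def regression_operator_def regression_operator_axioms_def regression_eigen_axioms_def
    using P S1 S2 X_paths A_bounded spec fH f1 wG wf \<mu>1 by blast
  interpret E: regression_eigen P S1 S2 p X \<eta> "\<mu> 1" f w by (rule eigen)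
  have sample: "white_noise_sample Q S1 S2 Xs \<epsilon> \<sigma>"
  proof
    show "Xs i \<in> Q \<rightarrow>\<^sub>M path_space S1" if "i \<ge> 1" for i
      using X_indep that by (auto simp: indep_vars_def)
  qed (use sigma noise noise_indep X_noise_indep in auto)
  have \<eta>: "\<eta> > 0" using E.\<mu>1_le \<mu>1 by simp
  have \<phi>1: "\<phi> (\<mu> 1) > 0"
  proof -
    have in_I: "\<mu> 1 \<in> {0..\<eta>}" using \<mu>1 E.\<mu>1_le by simp
    have "\<phi> (\<mu> 1) \<ge> 0" using mono_onD[OF phi(2), of 0 "\<mu> 1"] in_I \<eta> phi(3) by auto
    moreover have "\<phi> (\<mu> 1) \<noteq> 0"
      using inj_onD[OF psi_inv, of "\<mu> 1" 0] in_I \<eta> \<mu>1 by (auto simp: psi_def)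
    ultimately show ?thesis by simp
  qed
  \<comment> \<open>Half the separation guaranteed after applying the power \<open>s\<close>. It
    does not depend on \<open>n\<close>, so for every \<open>a\<close> the vanishing rate eventually
    falls below it.\<close>
  define \<kappa> where "\<kappa> = power_fun s (\<mu> 1) * (\<phi> (\<mu> 1) * R) / 2"
  have Fpos: "power_fun s (\<mu> 1) > 0" using \<mu>1 by (simp add: power_fun_def)
  have \<kappa>: "\<kappa> > 0" unfolding \<kappa>_def using Fpos \<phi>1 R by simp
  let ?pr = "\<lambda>a n bhat \<beta>. measure Q {\<omega> \<in> space Q.
      norm_LL2 p S1 S2 (op_fun p ?M ?T (power_fun s) (\<lambda>l z. bhat (data p S1 S2 Xs \<epsilon> n \<beta> \<omega>) l z - \<beta> l z))
      \<ge> a * rate \<phi> b \<eta> s n}"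
  have one: "(INF bhat\<in>estimators p S1 S2 n. SUP \<beta>\<in>source_set p S1 S2 P X \<phi> R. ?pr a n bhat \<beta>) = 1"
    if small: "a * rate \<phi> b \<eta> s n \<le> \<kappa>" for a n
  proof -
    have sup: "(SUP \<beta>\<in>source_set p S1 S2 P X \<phi> R. ?pr a n bhat \<beta>) = 1" if bhat: "bhat \<in> estimators p S1 S2 n" for bhat
    proof -
      have ex: "\<exists>\<beta>\<in>source_set p S1 S2 P X \<phi> R. 1 - \<delta> \<le> ?pr a n bhat \<beta>" if "\<delta> > 0" for \<delta>
        using small that
        by (intro minimax_risk[OF eigen sample phi(1) \<phi>1 R continuous_on_power_fun[OF s(1)] Fpos _ bhat]) (auto simp: \<kappa>_def)
      have ne: "source_set p S1 S2 P X \<phi> R \<noteq> {}" using ex[of 1] by auto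
      have bdd: "bdd_above (?pr a n bhat ` source_set p S1 S2 P X \<phi> R)"
        by (intro bdd_aboveI[of _ 1]) (auto intro: prob_le_1)
      have "(SUP \<beta>\<in>source_set p S1 S2 P X \<phi> R. ?pr a n bhat \<beta>) \<le> 1"
        using ne by (intro cSUP_least) (auto intro: prob_le_1)
      moreover have "1 \<le> (SUP \<beta>\<in>source_set p S1 S2 P X \<phi> R. ?pr a n bhat \<beta>) + \<delta>" if \<delta>: "\<delta> > 0" for \<delta>
      proof -
        obtain \<beta> where "\<beta> \<in> source_set p S1 S2 P X \<phi> R" "1 - \<delta> \<le> ?pr a n bhat \<beta>" using ex[OF \<delta>] by blast
        then show ?thesis using cSUP_upper[OF _ bdd, of \<beta>] by linarith
      qed
      ultimately show ?thesis by (meson antisym field_le_epsilon)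
    qed
    \<comment> \<open>The infimum of the constant 1 is 1 only over a nonempty set; the zero
      estimator belongs to it.\<close>
    have "(\<lambda>_. 0) \<in> estimators p S1 S2 n"
      unfolding estimators_def by (rule measurable_const) (simp add: LS.H_zero)
    then have "estimators p S1 S2 n \<noteq> {}" by blast
    then show ?thesis using sup by (simp cong: INF_cong_simp)
  qed
  have ev: "\<forall>\<^sub>F n in sequentially. (INF bhat\<in>estimators p S1 S2 n. SUP \<beta>\<in>source_set p S1 S2 P X \<phi> R. ?pr a n bhat \<beta>) = 1"
    if a: "a > 0" for a
    using rate_tendsto_0[OF \<eta> phi b psi_inv s(1), of "\<kappa> / a"] \<kappa> a
    by (auto elim!: eventually_mono intro!: one simp: field_simps)
  show ?thesis
    \<comment> \<open>For each \<open>a\<close> the sequence is eventually equal to 1, so the inner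
      limit is 1 for every \<open>a\<close>.\<close>
    by (rule exI[of _ "\<lambda>_. 1"]) (auto intro!: tendsto_eventually ev)
qed

end
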